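(* Let $(\Gamma,\psi)$ and $(\Delta,\phi)$ be totally reduced GBS graphs with a common vertex set (identified by a bijection $V(\Gamma)=V(\Delta)$) and the same set of primes, each with one qc-class with nonempty quasi-conjugacy support, each clean and with floating pieces. Suppose that the two graphs have the same $\mathrm{min}_{\mathrm{qc}}(Q)$, $\mathrm{supp}_{\mathrm{qc}}(Q)$, $\mathrm{lin}_{\mathrm{qc}}(Q)$ (for their respective unique quasi-conjugacy class $Q$ containing the edges), and the same number of edges in each conjugacy class up to edge sign-changes. Suppose that both are in normal form with respect to the same family $F_0$ and the same minimal points $\{m_F\}_{F\ne F_0}$. Then there is a sequence of edge sign-changes, slides, swaps and connections going from $(\Gamma,\psi)$ to $(\Delta,\phi)$.
   Context: A graph (in the sense of Serre) has a vertex set $V$, an edge set $E$, a fixed-point-free involution $e\mapsto\bar e$ on $E$, an initial-vertex map $\iota:E\to V$, and $\tau(e)=\iota(\bar e)$. A GBS graph $(\Gamma,\psi)$ is a finite connected graph $\Gamma$ with a function $\psi:E(\Gamma)\to\mathbb Z\setminus\{0\}$; it encodes the graph of groups with all vertex and edge groups $\mathbb Z$ and edge maps $G_e\to G_{\tau(e)}$ given by multiplication by $\psi(e)$, and its GBS group is the fundamental group. It is totally reduced if it has the minimal number of vertices and edges among GBS graphs with isomorphic GBS group. Let $\mathcal P$ (the set of primes) be the finite set of primes dividing some $\psi(e)$, and $\mathbf A=\mathbb Z/2\mathbb Z\oplus\bigoplus_{r\in\mathcal P}\mathbb Z$. For $\mathbf a=(a_0,(a_r)_r)\in\mathbf A$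 write $\mathbf a\ge\mathbf 0$ if $a_r\ge0$ for all $r\in\mathcal P$ (no condition on $a_0$); $\mathbf A^+=\{\mathbf a\ge\mathbf 0\}$; $\mathrm{supp}(\mathbf a)=\{r\in\mathcal P:a_r\ne0\}$; $\boldsymbol\varepsilon\in\mathbf A$ is the element of order 2. The affine representation $\Lambda$ is the graph with $V(\Lambda)=V(\Gamma)\times\mathbf A^+$, $E(\Lambda)=E(\Gamma)$, same reverse map, and $\tau_\Lambda(e)=(\tau_\Gamma(e),(a_0,(a_r)_r))$ where $\psi(e)=(-1)^{a_0}\prod_r r^{a_r}$. Below $\iota(e),\tau(e)$ denote endpoints in $\Lambda$. Put $(v,\mathbf a)+\mathbf w=(v,\mathbf a+\mathbf w)$, and $p\le p'$ if $p'=p+\mathbf w$ with $\mathbf w\in\mathbf A^+$. An affine path from $p$ to $p'$ is a sequence of edges $(e_1,\dots,e_\ell)$, $\ell\ge0$, for which there are $\mathbf w_i\in\mathbf A^+$ with $\iota(e_1)+\mathbf w_1=p$, $\tau(e_\ell)+\mathbf w_\ell=p'$, $\tau(e_i)+\mathbf w_i=\iota(e_{i+1})+\mathbf w_{i+1}$. Write $p\sim_{\mathrm c}q$ (conjugate) if there is an affine path from $p$ to $q$; $p\preceq_{\mathrm c}q$ if $p\le q'$ for some $q'\sim_{\mathrm c}q$; $p\sim_{\mathrm{qc}}q$ (quasi-conjugate) if $p\preceq_{\mathrm c}q$ and $q\preceq_{\mathrm c}p$. An edge belongs to the (quasi-)conjugacy class of its endpoints. For a quasi-conjugacy class $Q$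 and $p\in Q$ (independently of $p$): $\mathrm{min}_{\mathrm{qc}}(Q)=\{q\in Q:\forall q'\in Q,\ q'\le q\Rightarrow q\le q'\}$ is the set of minimal points; $\mathrm{supp}_{\mathrm{qc}}(Q)=\bigcup\{\mathrm{supp}(\mathbf u):\mathbf u\in\mathbf A^+,\ p+\mathbf u\sim_{\mathrm{qc}}p\}$; $\mathrm{lin}_{\mathrm{qc}}(Q)=\{\mathbf w-\mathbf w':\mathbf w,\mathbf w'\in\mathbf A^+,\ p+\mathbf w\sim_{\mathrm c}p+\mathbf w'\sim_{\mathrm c}p\}$. $(\Gamma,\psi)$ has one qc-class $Q$ if all its edges belong to $Q$. "Same number of edges in each conjugacy class up to edge sign-changes" means: after performing suitable edge sign-changes on one of the graphs, the two graphs have the same conjugacy classes containing at least one edge (as subsets of the common $V(\Lambda)$), with the same number of edges in each. Convention: minimal points $m$ and $m+\boldsymbol\varepsilon$ are identified and treated as one minimal point; an endpoint is "at $m$" if it equals $m$ or $m+\boldsymbol\varepsilon$. An edge and its reverse count as one edge. A point $p$ lies above $m$ with full-support gap if $p=m+\mathbf w$ with $\mathbf w\in\mathbf A^+$ and $\mathrm{supp}(\mathbf w)=\mathrm{supp}_{\mathrm{qc}}(Q)$. Two points of $Q$ are in the same family if they have the form $(v,\mathbf a),(v,\mathbf b)$ with $\mathrm{supp}(\mathbf b-\mathbf a)\subseteq\mathrm{supp}_{\mathrm{qc}}(Q)$; this partitions $Q$ into finitely many families, each containing a minimal point. $(\Gamma,\psi)$ is clean if every minimal point contains exactly one endpoint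 of exactly one edge and no edge has both endpoints at minimal points. It has floating pieces if it has strictly more edges than minimal points. An edge is floating if none of its endpoints is at a minimal point. Normal form (with respect to a family $F_0$ and minimal points $m_F\in F$ for families $F\ne F_0$): (1) for every family $F\ne F_0$, the unique edge $e$ with $\iota(e)=m_F$ has $\tau(e)\in F_0$, lying above all minimal points of $F_0$ with full-support gap; (2) for every family $F$ and every minimal point $m\in F$ other than $m_F$ (for $F=F_0$, every minimal point), the unique edge $e$ with $\iota(e)=m$ has $\tau(e)\in F$, lying above all minimal points of $F$ with full-support gap; (3) for every floating edge $e$, both $\iota(e),\tau(e)$ are in $F_0$ and lie above all minimal points of $F_0$ with full-support gap. Moves ($p\,\text{---}\,q$ denotes an edge of $\Lambda$ with endpoints $p,q$; when two edges are involved they are distinct; the others are unchanged): Edge sign-change: $p\,\text{---}\,q$ becomes $p+\boldsymbol\varepsilon\,\text{---}\,q+\boldsymbol\varepsilon$. Slide: $p\,\text{---}\,q$ and $r\,\text{---}\,p+\mathbf a$ ($\mathbf a\in\mathbf A^+$) become $p\,\text{---}\,q$ and $r\,\text{---}\,q+\mathbf a$. Swap: $p\,\text{---}\,p+\mathbf w_1$ and $q\,\text{---}\,q+\mathbf w_2$ with $\mathbf w_1,\mathbf w_2\in\mathbf A^+$, $p\le q\le p+k_1\mathbf w_1$, $p\le q\le p+k_2\mathbf w_2$ for some $k_1,k_2\in\mathbb N$, become $q\,\text{---}\,q+\mathbf w_1$ and $p\,\text{---}\,p+\mathbf w_2$. Connection: $q\,\text{---}\,p+\mathbf w_1$ and $p\,\text{---}\,p+\mathbf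 w$ with $\mathbf w,\mathbf w_1,\mathbf w_2\in\mathbf A^+$, $\mathbf w_1+\mathbf w_2=k\mathbf w$, $k\in\mathbb N$, become $p\,\text{---}\,q+\mathbf w_2$ and $q\,\text{---}\,q+\mathbf w$. *)

theory Defs
  imports
    "HOL-Algebra.Group"
    "HOL-Computational_Algebra.Primes"
    "HOL-Library.Z2"
    "HOL-Library.Product_Plus"
    "HOL-Library.Function_Algebras"
begin

section \<open>Graphs in the sense of Serre\<close>

record ('v, 'e) sgraph =
  Verts :: "'v set"
  Edges :: "'e set"
  bar :: "'e \<Rightarrow> 'e"
  init :: "'e \<Rightarrow> 'v"

definition term_of :: "('v, 'e) sgraph \<Rightarrow> 'e \<Rightarrow> 'v" where
  "term_of G e = init G (bar G e)"

definition sgraph :: "('v, 'e) sgraph \<Rightarrow> bool" where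
  "sgraph G \<longleftrightarrow> (\<forall>e\<in>Edges G. init G e \<in> Verts G \<and> bar G e \<in> Edges G \<and>
      bar G (bar G e) = e \<and> bar G e \<noteq> e)"

definition connected_sgraph :: "('v, 'e) sgraph \<Rightarrow> bool" where
  "connected_sgraph G \<longleftrightarrow> Verts G \<noteq> {} \<and>
     (\<forall>u\<in>Verts G. \<forall>v\<in>Verts G. (u, v) \<in> {(init G e, term_of G e) | e. e \<in> Edges G}\<^sup>*)"

text \<open>\<open>Edges\<close> contains each edge together with its reverse; a geometric edge is such a pair.\<close>

definition geom_edges :: "('v, 'e) sgraph \<Rightarrow> 'e set set" where
  "geom_edges G = (\<lambda>e. {e, bar G e}) ` Edges G"

definition same_graph :: "('v, 'e) sgraph \<Rightarrow> ('v, 'f) sgraph \<Rightarrow> bool" where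
  "same_graph G H \<longleftrightarrow> Verts G = Verts H \<and>
     (\<exists>f. bij_betw f (Edges G) (Edges H) \<and>
        (\<forall>e\<in>Edges G. f (bar G e) = bar H (f e) \<and> init H (f e) = init G e))"


section \<open>GBS graphs and GBS groups\<close>

definition gbs_graph :: "('v, 'e) sgraph \<Rightarrow> ('e \<Rightarrow> int) \<Rightarrow> bool" where
  "gbs_graph G \<psi> \<longleftrightarrow> sgraph G \<and> finite (Verts G) \<and> finite (Edges G) \<and> connected_sgraph G \<and>
     (\<forall>e\<in>Edges G. \<psi> e \<noteq> 0)"

text \<open>
  The fundamental group of the graph of groups at a base vertex, following Serre. The ambient
  group is generated by a generator \<open>x\<^sub>v\<close> of each vertex group and by the edges, subject to
  \<open>e bar(e) = 1\<close> and \<open>e x\<^sub>t\<^bsup>\<psi>(e)\<^esup> bar(e) = x\<^sub>i\<^bsup>\<psi>(bar(e))\<^esup>\<close>, where \<open>i\<close> and \<open>t\<close> are the initial and the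
  terminal vertex of \<open>e\<close>; the fundamental group consists of the classes of the words that
  describe loops at the base vertex. The letter \<open>VGen v True\<close> is \<open>x\<^sub>v\<close> and \<open>VGen v False\<close>
  is its inverse.
\<close>

datatype ('v, 'e) letter = VGen 'v bool | EGen 'e

definition gen_power :: "'v \<Rightarrow> int \<Rightarrow> ('v, 'e) letter list" where
  "gen_power v k = replicate (nat \<bar>k\<bar>) (VGen v (k \<ge> 0))"

inductive bass_step ::
  "('v, 'e) sgraph \<Rightarrow> ('e \<Rightarrow> int) \<Rightarrow> ('v, 'e) letter list \<Rightarrow> ('v, 'e) letter list \<Rightarrow> bool"
  for G \<psi> where
  vertex_cancel: "v \<in> Verts G \<Longrightarrow> bass_step G \<psi> (u @ [VGen v b, VGen v (\<not> b)] @ w) (u @ w)"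
| edge_cancel: "e \<in> Edges G \<Longrightarrow> bass_step G \<psi> (u @ [EGen e, EGen (bar G e)] @ w) (u @ w)"
| edge_rel: "e \<in> Edges G \<Longrightarrow>
    bass_step G \<psi> (u @ [EGen e] @ gen_power (term_of G e) (\<psi> e) @ [EGen (bar G e)] @ w)
      (u @ gen_power (init G e) (\<psi> (bar G e)) @ w)"

abbreviation bass_eq ::
  "('v, 'e) sgraph \<Rightarrow> ('e \<Rightarrow> int) \<Rightarrow> ('v, 'e) letter list \<Rightarrow> ('v, 'e) letter list \<Rightarrow> bool" where
  "bass_eq G \<psi> \<equiv> equivclp (bass_step G \<psi>)"

fun word_path :: "('v, 'e) sgraph \<Rightarrow> 'v \<Rightarrow> ('v, 'e) letter list \<Rightarrow> 'v \<Rightarrow> bool" where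
  "word_path G u [] v \<longleftrightarrow> u \<in> Verts G \<and> u = v"
| "word_path G u (VGen x b # w) v \<longleftrightarrow> x = u \<and> word_path G u w v"
| "word_path G u (EGen e # w) v \<longleftrightarrow> e \<in> Edges G \<and> init G e = u \<and> word_path G (term_of G e) w v"

definition gbs_group ::
  "('v, 'e) sgraph \<Rightarrow> ('e \<Rightarrow> int) \<Rightarrow> 'v \<Rightarrow> ('v, 'e) letter list set monoid" where
  "gbs_group G \<psi> v =
     \<lparr>carrier = {{z. bass_eq G \<psi> w z} | w. word_path G v w v},
      monoid.mult = (\<lambda>A B. {z. \<exists>a\<in>A. \<exists>b\<in>B. bass_eq G \<psi> (a @ b) z}),
      monoid.one = {z. bass_eq G \<psi> [] z}\<rparr>"

lemma bass_eq_append: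
  assumes "bass_eq G \<psi> a a'" and "bass_eq G \<psi> b b'"
  shows "bass_eq G \<psi> (a @ b) (a' @ b')"
proof -
  have left: "bass_step G \<psi> (c @ x) (c @ y)" if "bass_step G \<psi> x y" for c x y
    using that
  proof cases
    case (vertex_cancel v u b w)
    then show ?thesis using bass_step.vertex_cancel[of v G \<psi> "c @ u" b w] by simp
  next
    case (edge_cancel e u w)
    then show ?thesis using bass_step.edge_cancel[of e G \<psi> "c @ u" w] by simp
  next
    case (edge_rel e u w)
    then show ?thesis using bass_step.edge_rel[of e G \<psi> "c @ u" w] by simp
  qed
  have right: "bass_step G \<psi> (x @ c) (y @ c)" if "bass_step G \<psi> x y" for c x y
    using that
  proof cases
    case (vertex_cancel v u b w)
    then show ?thesis using bass_step.vertex_cancel[of v G \<psi> u b "w @ c"] by simp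
  next
    case (edge_cancel e u w)
    then show ?thesis using bass_step.edge_cancel[of e G \<psi> u "w @ c"] by simp
  next
    case (edge_rel e u w)
    then show ?thesis using bass_step.edge_rel[of e G \<psi> u "w @ c"] by simp
  qed
  have "bass_eq G \<psi> (a @ b) (a' @ b)"
    using assms(1)
    by (induction rule: equivclp_induct) (simp, metis right equivclp_into_equivclp)
  moreover have "bass_eq G \<psi> (a' @ b) (a' @ b')"
    using assms(2)
    by (induction rule: equivclp_induct) (simp, metis left equivclp_into_equivclp)
  ultimately show ?thesis by (rule equivclp_trans)
qed

lemma word_path_append:
  "word_path G u w v \<Longrightarrow> word_path G v w' x \<Longrightarrow> word_path G u (w @ w') x"
  by (induction G u w v rule: word_path.induct) auto

fun letter_inverse :: "('v, 'e) sgraph \<Rightarrow> ('v, 'e) letter \<Rightarrow> ('v, 'e) letter" where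
  "letter_inverse G (VGen v b) = VGen v (\<not> b)"
| "letter_inverse G (EGen e) = EGen (bar G e)"

lemma word_path_start: "sgraph G \<Longrightarrow> word_path G u w v \<Longrightarrow> u \<in> Verts G"
  by (induction G u w v rule: word_path.induct) (auto simp: sgraph_def)

lemma word_path_inverse:
  assumes G: "sgraph G"
  shows "word_path G u w v \<Longrightarrow> word_path G v (rev (map (letter_inverse G) w)) u \<and>
    bass_eq G \<psi> (rev (map (letter_inverse G) w) @ w) []"
proof (induction w arbitrary: u)
  case Nil
  then show ?case by auto
next
  case (Cons l w)
  let ?r = "rev (map (letter_inverse G) w)"
  obtain u' where path: "word_path G u' w v" and inv: "word_path G u' [letter_inverse G l] u"
    and cancel: "bass_step G \<psi> ([] @ [letter_inverse G l, l] @ []) ([] @ [])"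
  proof (cases l)
    case (VGen x b)
    then have "x = u" and path: "word_path G u w v" using Cons.prems by auto
    moreover have "u \<in> Verts G" using word_path_start[OF G path] .
    ultimately show ?thesis
      using that[of u] VGen vertex_cancel[of x G \<psi> "[]" "\<not> b" "[]"] by simp
  next
    case (EGen e)
    then have e: "e \<in> Edges G" "init G e = u" and path: "word_path G (term_of G e) w v"
      using Cons.prems by auto
    then have "bar G e \<in> Edges G" "bar G (bar G e) = e" "u \<in> Verts G"
      using G by (auto simp: sgraph_def)
    then show ?thesis
      using that[of "term_of G e"] e path EGen edge_cancel[of "bar G e" G \<psi> "[]" "[]"]
      by (simp add: term_of_def)
  qed
  have "bass_eq G \<psi> [letter_inverse G l, l] []"
    using r_into_equivclp[of "bass_step G \<psi>", OF cancel] by simp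
  then have "bass_eq G \<psi> (?r @ [letter_inverse G l, l] @ w) (?r @ [] @ w)"
    by (intro bass_eq_append equivclp_refl)
  also have "bass_eq G \<psi> (?r @ [] @ w) []"
    using Cons.IH[OF path] by simp
  finally have "bass_eq G \<psi> (?r @ [letter_inverse G l, l] @ w) []" .
  moreover have "word_path G v (?r @ [letter_inverse G l]) u"
    using Cons.IH[OF path] inv by (blast intro: word_path_append)
  ultimately show ?case by simp
qed

lemma gbs_group_mult:
  "{z. bass_eq G \<psi> w z} \<otimes>\<^bsub>gbs_group G \<psi> v\<^esub> {z. bass_eq G \<psi> w' z} = {z. bass_eq G \<psi> (w @ w') z}"
  (is "?L = ?R")
proof -
  have L: "?L = {z. \<exists>a b. bass_eq G \<psi> w a \<and> bass_eq G \<psi> w' b \<and> bass_eq G \<psi> (a @ b) z}"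
    unfolding gbs_group_def by auto
  show ?thesis unfolding L
    by (intro Collect_cong iffI) (blast intro: bass_eq_append equivclp_trans, metis equivclp_refl)
qed

lemma bass_class_eq: "bass_eq G \<psi> w w' \<Longrightarrow> {z. bass_eq G \<psi> w z} = {z. bass_eq G \<psi> w' z}"
  by (metis equivclp_trans equivclp_sym)

lemma group_gbs_group:
  assumes "sgraph G" and "v \<in> Verts G"
  shows "group (gbs_group G \<psi> v)"
proof (rule groupI)
  let ?K = "gbs_group G \<psi> v"
  have carrier: "x \<in> carrier ?K \<longleftrightarrow> (\<exists>w. x = {z. bass_eq G \<psi> w z} \<and> word_path G v w v)" for x
    by (auto simp: gbs_group_def)
  have one: "\<one>\<^bsub>?K\<^esub> = {z. bass_eq G \<psi> [] z}"
    by (simp add: gbs_group_def)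
  show "x \<otimes>\<^bsub>?K\<^esub> y \<in> carrier ?K" if "x \<in> carrier ?K" "y \<in> carrier ?K" for x y
    using that unfolding carrier by (metis gbs_group_mult word_path_append)
  show "\<one>\<^bsub>?K\<^esub> \<in> carrier ?K"
    unfolding carrier one using assms by (intro exI[of _ "[]"]) simp
  show "x \<otimes>\<^bsub>?K\<^esub> y \<otimes>\<^bsub>?K\<^esub> z = x \<otimes>\<^bsub>?K\<^esub> (y \<otimes>\<^bsub>?K\<^esub> z)"
    if "x \<in> carrier ?K" "y \<in> carrier ?K" "z \<in> carrier ?K" for x y z
    using that by (auto simp: carrier gbs_group_mult)
  show "\<one>\<^bsub>?K\<^esub> \<otimes>\<^bsub>?K\<^esub> x = x" if "x \<in> carrier ?K" for x
    using that by (auto simp: carrier one gbs_group_mult)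
  show "\<exists>y\<in>carrier ?K. y \<otimes>\<^bsub>?K\<^esub> x = \<one>\<^bsub>?K\<^esub>" if x: "x \<in> carrier ?K" for x
  proof -
    obtain w where w: "x = {z. bass_eq G \<psi> w z}" "word_path G v w v"
      using x unfolding carrier by blast
    let ?y = "{z. bass_eq G \<psi> (rev (map (letter_inverse G) w)) z}"
    have "?y \<in> carrier ?K"
      unfolding carrier using word_path_inverse[OF assms(1) w(2)] by blast
    moreover have "?y \<otimes>\<^bsub>?K\<^esub> x = \<one>\<^bsub>?K\<^esub>"
      unfolding w(1) gbs_group_mult one
      by (rule bass_class_eq) (use word_path_inverse[OF assms(1) w(2)] in blast)
    ultimately show ?thesis by blast
  qed
qed

text \<open>The isomorphism type of the group does not depend on the base vertices.\<close>

definition iso_gbs_groups ::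
  "('v, 'e) sgraph \<Rightarrow> ('e \<Rightarrow> int) \<Rightarrow> ('w, 'f) sgraph \<Rightarrow> ('f \<Rightarrow> int) \<Rightarrow> bool" where
  "iso_gbs_groups G \<psi> H \<phi> \<longleftrightarrow>
     (\<exists>v\<in>Verts G. \<exists>w\<in>Verts H. gbs_group G \<psi> v \<cong> gbs_group H \<phi> w)"

text \<open>Every finite graph has a copy with vertices and edges in \<^typ>\<open>nat\<close>, so the competitors
  below represent all GBS graphs.\<close>

definition totally_reduced :: "('v, 'e) sgraph \<Rightarrow> ('e \<Rightarrow> int) \<Rightarrow> bool" where
  "totally_reduced G \<psi> \<longleftrightarrow> gbs_graph G \<psi> \<and>
     (\<forall>(H :: (nat, nat) sgraph) \<phi>. gbs_graph H \<phi> \<and> iso_gbs_groups G \<psi> H \<phi> \<longrightarrow>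
        card (Verts G) \<le> card (Verts H) \<and> card (geom_edges G) \<le> card (geom_edges H))"


section \<open>The affine representation\<close>

definition gbs_primes :: "('v, 'e) sgraph \<Rightarrow> ('e \<Rightarrow> int) \<Rightarrow> nat set" where
  "gbs_primes G \<psi> = {r. prime r \<and> (\<exists>e\<in>Edges G. int r dvd \<psi> e)}"

text \<open>The group \<open>A\<close> for a set \<open>P\<close> of primes is the subgroup of the following type given by the
  elements with support in \<open>P\<close>.\<close>

type_synonym avec = "bit \<times> (nat \<Rightarrow> int)"

definition supp :: "avec \<Rightarrow> nat set" where
  "supp a = {r. snd a r \<noteq> 0}"

definition Apos :: "nat set \<Rightarrow> avec set" where
  "Apos P = {a. supp a \<subseteq> P \<and> (\<forall>r. 0 \<le> snd a r)}"

definition eps :: avec where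
  "eps = (1, 0)"

definition nat_mult :: "nat \<Rightarrow> avec \<Rightarrow> avec" where
  "nat_mult k w = (\<Sum>_<k. w)"

text \<open>The exponent vector \<open>(a\<^sub>0, (a\<^sub>r)\<^sub>r)\<close> of a nonzero integer \<open>k = (-1)\<^bsup>a\<^sub>0\<^esup> * (\<Prod>\<^sub>r r\<^bsup>a\<^sub>r\<^esup>)\<close>.\<close>

definition exponents :: "int \<Rightarrow> avec" where
  "exponents k = (if k < 0 then 1 else 0, \<lambda>r. if prime r then int (multiplicity (int r) k) else 0)"

lemma exponents_decomp:
  assumes "k \<noteq> 0"
  shows "k = (if fst (exponents k) = 1 then -1 else 1) *
           (\<Prod>r | prime r \<and> int r dvd k. int r ^ nat (snd (exponents k) r))"
proof -
  have "(\<Prod>r | prime r \<and> int r dvd k. int r ^ nat (snd (exponents k) r)) =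
        (\<Prod>p\<in>prime_factors k. p ^ multiplicity p k)"
  proof (rule prod.reindex_bij_witness[of _ nat int])
    fix p assume "p \<in> prime_factors k"
    then have p: "prime p" "p dvd k" "0 \<le> p" by (auto simp: prime_ge_0_int)
    then show "int (nat p) = p" "nat p \<in> {r. prime r \<and> int r dvd k}" by simp_all
  next
    fix r assume "r \<in> {r. prime r \<and> int r dvd k}"
    then show "nat (int r) = r" "int r \<in> prime_factors k"
      "int r ^ multiplicity (int r) k = int r ^ nat (snd (exponents k) r)"
      using assms by (simp_all add: exponents_def prime_factors_dvd)
  qed
  also have "\<dots> = \<bar>k\<bar>"
    using prod_prime_factors[OF assms] by simp
  finally show ?thesis by (simp add: exponents_def)
qed

type_synonym 'v point = "'v \<times> avec"

definition shift :: "'v point \<Rightarrow> avec \<Rightarrow> 'v point" (infixl "\<^bold>+" 65) where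
  "p \<^bold>+ w = (fst p, snd p + w)"

definition point_le :: "nat set \<Rightarrow> 'v point \<Rightarrow> 'v point \<Rightarrow> bool" where
  "point_le P p p' \<longleftrightarrow> (\<exists>w\<in>Apos P. p' = p \<^bold>+ w)"

text \<open>The terminal endpoint of \<open>e\<close> in the affine representation is \<open>(term_of G e, exponents (\<psi> e))\<close>.\<close>

definition affine_rep :: "('v, 'e) sgraph \<Rightarrow> ('e \<Rightarrow> int) \<Rightarrow> ('v point, 'e) sgraph" where
  "affine_rep G \<psi> = \<lparr>Verts = Verts G \<times> Apos (gbs_primes G \<psi>), Edges = Edges G, bar = bar G,
     init = (\<lambda>e. (init G e, exponents (\<psi> (bar G e))))\<rparr>"

text \<open>From here on, \<open>L\<close> is a graph on the vertex set \<open>V \<times> Apos P\<close>.\<close>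

fun affine_path ::
  "nat set \<Rightarrow> ('v point, 'e) sgraph \<Rightarrow> 'v point \<Rightarrow> 'e list \<Rightarrow> 'v point \<Rightarrow> bool" where
  "affine_path P L p [] p' \<longleftrightarrow> p \<in> Verts L \<and> p = p'"
| "affine_path P L p (e # es) p' \<longleftrightarrow> e \<in> Edges L \<and>
     (\<exists>w\<in>Apos P. p = init L e \<^bold>+ w \<and> affine_path P L (term_of L e \<^bold>+ w) es p')"

definition conjugate :: "nat set \<Rightarrow> ('v point, 'e) sgraph \<Rightarrow> 'v point \<Rightarrow> 'v point \<Rightarrow> bool" where
  "conjugate P L p q \<longleftrightarrow> (\<exists>es. affine_path P L p es q)"

definition conj_le :: "nat set \<Rightarrow> ('v point, 'e) sgraph \<Rightarrow> 'v point \<Rightarrow> 'v point \<Rightarrow> bool" where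
  "conj_le P L p q \<longleftrightarrow> p \<in> Verts L \<and> (\<exists>q'. conjugate P L q' q \<and> point_le P p q')"

definition qconj :: "nat set \<Rightarrow> ('v point, 'e) sgraph \<Rightarrow> 'v point \<Rightarrow> 'v point \<Rightarrow> bool" where
  "qconj P L p q \<longleftrightarrow> conj_le P L p q \<and> conj_le P L q p"

definition conj_class :: "nat set \<Rightarrow> ('v point, 'e) sgraph \<Rightarrow> 'v point \<Rightarrow> 'v point set" where
  "conj_class P L p = {q. conjugate P L p q}"

definition qc_classes :: "nat set \<Rightarrow> ('v point, 'e) sgraph \<Rightarrow> 'v point set set" where
  "qc_classes P L = {{q. qconj P L p q} | p. p \<in> Verts L}"

definition one_qc_class :: "nat set \<Rightarrow> ('v point, 'e) sgraph \<Rightarrow> 'v point set \<Rightarrow> bool" where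
  "one_qc_class P L Q \<longleftrightarrow> Q \<in> qc_classes P L \<and> (\<forall>e\<in>Edges L. init L e \<in> Q)"

definition min_qc :: "nat set \<Rightarrow> 'v point set \<Rightarrow> 'v point set" where
  "min_qc P Q = {q \<in> Q. \<forall>q'\<in>Q. point_le P q' q \<longrightarrow> point_le P q q'}"

text \<open>In the next two definitions all points \<open>p\<close> of the class \<open>Q\<close> give the same result.\<close>

definition supp_qc :: "nat set \<Rightarrow> ('v point, 'e) sgraph \<Rightarrow> 'v point set \<Rightarrow> nat set" where
  "supp_qc P L Q = \<Union> {supp u | u p. p \<in> Q \<and> u \<in> Apos P \<and> qconj P L (p \<^bold>+ u) p}"

definition lin_qc :: "nat set \<Rightarrow> ('v point, 'e) sgraph \<Rightarrow> 'v point set \<Rightarrow> avec set" where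
  "lin_qc P L Q = {w - w' | w w' p. p \<in> Q \<and> w \<in> Apos P \<and> w' \<in> Apos P \<and>
     conjugate P L (p \<^bold>+ w) (p \<^bold>+ w') \<and> conjugate P L (p \<^bold>+ w') p}"


section \<open>Clean graphs, floating pieces and normal forms\<close>

text \<open>Minimal points \<open>m\<close> and \<open>m \<^bold>+ eps\<close> are identified.\<close>

definition at_point :: "'v point \<Rightarrow> 'v point \<Rightarrow> bool" where
  "at_point m p \<longleftrightarrow> p = m \<or> p = m \<^bold>+ eps"

text \<open>The first condition quantifies over oriented edges, so it also forbids both endpoints of one
  edge to be at \<open>m\<close>.\<close>

definition clean :: "nat set \<Rightarrow> ('v point, 'e) sgraph \<Rightarrow> 'v point set \<Rightarrow> bool" where
  "clean P L Q \<longleftrightarrow>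
     (\<forall>m\<in>min_qc P Q. \<exists>!e. e \<in> Edges L \<and> at_point m (init L e)) \<and>
     (\<forall>e\<in>Edges L. \<not> (init L e \<in> min_qc P Q \<and> term_of L e \<in> min_qc P Q))"

definition floating_pieces :: "nat set \<Rightarrow> ('v point, 'e) sgraph \<Rightarrow> 'v point set \<Rightarrow> bool" where
  "floating_pieces P L Q \<longleftrightarrow>
     card (geom_edges L) > card ((\<lambda>m. {m, m \<^bold>+ eps}) ` min_qc P Q)"

definition floating_edge :: "nat set \<Rightarrow> ('v point, 'e) sgraph \<Rightarrow> 'v point set \<Rightarrow> 'e \<Rightarrow> bool" where
  "floating_edge P L Q e \<longleftrightarrow> e \<in> Edges L \<and> init L e \<notin> min_qc P Q \<and> term_of L e \<notin> min_qc P Q"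

definition same_family :: "nat set \<Rightarrow> 'v point \<Rightarrow> 'v point \<Rightarrow> bool" where
  "same_family S p q \<longleftrightarrow> fst p = fst q \<and> supp (snd q - snd p) \<subseteq> S"

definition families :: "nat set \<Rightarrow> ('v point, 'e) sgraph \<Rightarrow> 'v point set \<Rightarrow> 'v point set set" where
  "families P L Q = {{q \<in> Q. same_family (supp_qc P L Q) p q} | p. p \<in> Q}"

definition full_gap_above ::
  "nat set \<Rightarrow> ('v point, 'e) sgraph \<Rightarrow> 'v point set \<Rightarrow> 'v point \<Rightarrow> 'v point \<Rightarrow> bool" where
  "full_gap_above P L Q m p \<longleftrightarrow> (\<exists>w\<in>Apos P. p = m \<^bold>+ w \<and> supp w = supp_qc P L Q)"

definition well_inside ::
  "nat set \<Rightarrow> ('v point, 'e) sgraph \<Rightarrow> 'v point set \<Rightarrow> 'v point set \<Rightarrow> 'v point \<Rightarrow> bool" where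
  "well_inside P L Q F p \<longleftrightarrow> p \<in> F \<and> (\<forall>m \<in> min_qc P Q \<inter> F. full_gap_above P L Q m p)"

text \<open>Used for clean graphs only, where the edge \<open>e\<close> in the first two clauses is unique. The value
  of \<open>mF\<close> at \<open>F\<^sub>0\<close> is irrelevant.\<close>

definition normal_form ::
  "nat set \<Rightarrow> ('v point, 'e) sgraph \<Rightarrow> 'v point set \<Rightarrow> 'v point set \<Rightarrow>
     ('v point set \<Rightarrow> 'v point) \<Rightarrow> bool" where
  "normal_form P L Q F\<^sub>0 mF \<longleftrightarrow>
     F\<^sub>0 \<in> families P L Q \<and>
     (\<forall>F \<in> families P L Q - {F\<^sub>0}. mF F \<in> min_qc P Q \<inter> F) \<and>
     (\<forall>F \<in> families P L Q - {F\<^sub>0}. \<forall>e\<in>Edges L. at_point (mF F) (init L e) \<longrightarrow>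
        well_inside P L Q F\<^sub>0 (term_of L e)) \<and>
     (\<forall>F \<in> families P L Q. \<forall>m \<in> min_qc P Q \<inter> F. F = F\<^sub>0 \<or> \<not> at_point (mF F) m \<longrightarrow>
        (\<forall>e\<in>Edges L. at_point m (init L e) \<longrightarrow> well_inside P L Q F (term_of L e))) \<and>
     (\<forall>e. floating_edge P L Q e \<longrightarrow>
        well_inside P L Q F\<^sub>0 (init L e) \<and> well_inside P L Q F\<^sub>0 (term_of L e))"


section \<open>Moves\<close>

definition set_ends ::
  "'e \<Rightarrow> 'v point \<Rightarrow> 'v point \<Rightarrow> ('v point, 'e) sgraph \<Rightarrow> ('v point, 'e) sgraph" where
  "set_ends e p q L = L\<lparr>init := (init L)(e := p, bar L e := q)\<rparr>"

definition joins :: "('v point, 'e) sgraph \<Rightarrow> 'e \<Rightarrow> 'v point \<Rightarrow> 'v point \<Rightarrow> bool" where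
  "joins L e p q \<longleftrightarrow> e \<in> Edges L \<and> init L e = p \<and> term_of L e = q"

definition distinct_edges :: "('v point, 'e) sgraph \<Rightarrow> 'e \<Rightarrow> 'e \<Rightarrow> bool" where
  "distinct_edges L d e \<longleftrightarrow> d \<noteq> e \<and> d \<noteq> bar L e"

inductive sign_change :: "('v point, 'e) sgraph \<Rightarrow> ('v point, 'e) sgraph \<Rightarrow> bool" where
  "joins L e p q \<Longrightarrow> sign_change L (set_ends e (p \<^bold>+ eps) (q \<^bold>+ eps) L)"

inductive slide :: "nat set \<Rightarrow> ('v point, 'e) sgraph \<Rightarrow> ('v point, 'e) sgraph \<Rightarrow> bool" for P where
  "\<lbrakk>distinct_edges L d e; joins L d p q; joins L e r (p \<^bold>+ a); a \<in> Apos P\<rbrakk>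
   \<Longrightarrow> slide P L (set_ends e r (q \<^bold>+ a) L)"

inductive swap :: "nat set \<Rightarrow> ('v point, 'e) sgraph \<Rightarrow> ('v point, 'e) sgraph \<Rightarrow> bool" for P where
  "\<lbrakk>distinct_edges L d e; joins L d p (p \<^bold>+ w\<^sub>1); joins L e q (q \<^bold>+ w\<^sub>2);
    w\<^sub>1 \<in> Apos P; w\<^sub>2 \<in> Apos P; point_le P p q;
    point_le P q (p \<^bold>+ nat_mult k\<^sub>1 w\<^sub>1); point_le P q (p \<^bold>+ nat_mult k\<^sub>2 w\<^sub>2)\<rbrakk>
   \<Longrightarrow> swap P L (set_ends d q (q \<^bold>+ w\<^sub>1) (set_ends e p (p \<^bold>+ w\<^sub>2) L))"

inductive connection :: "nat set \<Rightarrow> ('v point, 'e) sgraph \<Rightarrow> ('v point, 'e) sgraph \<Rightarrow> bool" for P where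
  "\<lbrakk>distinct_edges L d e; joins L d q (p \<^bold>+ w\<^sub>1); joins L e p (p \<^bold>+ w);
    w \<in> Apos P; w\<^sub>1 \<in> Apos P; w\<^sub>2 \<in> Apos P; w\<^sub>1 + w\<^sub>2 = nat_mult k w\<rbrakk>
   \<Longrightarrow> connection P L (set_ends d p (q \<^bold>+ w\<^sub>2) (set_ends e q (q \<^bold>+ w) L))"

definition move :: "nat set \<Rightarrow> ('v point, 'e) sgraph \<Rightarrow> ('v point, 'e) sgraph \<Rightarrow> bool" where
  "move P L L' \<longleftrightarrow> sign_change L L' \<or> slide P L L' \<or> swap P L L' \<or> connection P L L'"

text \<open>An edge belongs to the conjugacy class of its endpoints. Sign-changes preserve the relation
  \<^const>\<open>conjugate\<close> and only affect the class an edge belongs to; hence it does not matter which one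
  of the two graphs is modified.\<close>

definition edges_in_class :: "('v point, 'e) sgraph \<Rightarrow> 'v point set \<Rightarrow> 'e set set" where
  "edges_in_class L C = (\<lambda>e. {e, bar L e}) ` {e \<in> Edges L. init L e \<in> C}"

definition edge_classes :: "nat set \<Rightarrow> ('v point, 'e) sgraph \<Rightarrow> 'v point set set" where
  "edge_classes P L = {conj_class P L (init L e) | e. e \<in> Edges L}"

definition same_class_counts ::
  "nat set \<Rightarrow> ('v point, 'e) sgraph \<Rightarrow> ('v point, 'f) sgraph \<Rightarrow> bool" where
  "same_class_counts P L M \<longleftrightarrow>
     (\<exists>L'. sign_change\<^sup>*\<^sup>* L L' \<and> edge_classes P L' = edge_classes P M \<and>
        (\<forall>C\<in>edge_classes P M. card (edges_in_class L' C) = card (edges_in_class M C)))"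

end

theory Submission
  imports Defs "HOL.Modules"
begin

text \<open>
  Fix an edge \<open>e\<^sub>0\<close> at a minimal point of \<open>F\<^sub>0\<close>. It is a loop by a vector \<open>w\<^sub>0\<close> of full support, so
  every movable endpoint in \<open>F\<^sub>0\<close> can be raised by multiples of \<open>w\<^sub>0\<close> and is then high enough for
  any slide; all other data matter only modulo \<open>w\<^sub>0\<close>. Endpoints in another family are slid to
  \<open>F\<^sub>0\<close> and back along the edge at \<open>m\<^sub>F\<close>. The translations of \<open>e\<^sub>0\<close> and of the edges not
  starting at some \<open>m\<^sub>F\<close> form a tuple that generates \<open>lin(Q)\<close>. Slides are elementary operations on
  this tuple, reversing a floating edge is a sign change, and a swap exchanges the translation of
  \<open>e\<^sub>0\<close> with a positive translation of a floating edge.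

  Two generating tuples of the same length of a subgroup of \<open>\<int>/2 \<oplus> \<int>\<^sup>n\<close> differ by elementary operations
  and sign changes. They can be chosen such that the first entry stays positive: if the first entries
  are \<open>u\<close> and \<open>v\<close>, one passes through the vectors \<open>(v + m u) / D\<close> as in the Farey graph. Afterwards
  the remaining entries are compared modulo the first one.

  It remains to match the endpoints. Modulo \<open>lin(Q)\<close>, the position of a point of \<open>Q\<close> transported to
  \<open>F\<^sub>0\<close> is a conjugacy invariant, so that the edge counts yield a bijection between the floating edges
  whose endpoints differ by elements of \<open>lin(Q)\<close>, up to sign-changes, and a floating edge can be
  translated by all these elements.
\<close>

section \<open>Elementary operations on tuples\<close>

text \<open>The obstacle throughout is that an edge cannot be slid along itself: slides of an edge
  \<open>d\<close> may use only the conjugacies generated by the other edges, hence only the span of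
  their translations, and for an edge of \<open>K\<close> only the loops that can be reached without
  it. Every conjugacy relation below therefore carries the set of edges it may use. The missing
  multiples of an edge's own translation, and of the translations of the loops behind an edge of
  \<open>K\<close>, are recovered with the help of a floating edge; this is where floating pieces
  enter. A second constraint is positivity. Slides and swaps need gaps in \<open>Apos P\<close>, so
  that tuples are realized only modulo the translation of \<open>e\<^sub>0\<close>; when a swap
  changes this modulus, the other entries must be renormalized to the new one beforehand. Integer
  functionals see the vectors only up to one element of order 2, which is the reason for
  \<open>\<epsilon>\<close> in \<open>els_complete\<close>. Finally, sign-changes blur the conjugacy
  invariant by \<open>eps\<close>: edges are matched modulo the span enlarged by \<open>eps\<close>,
  and actual sign-changes remove the remaining ambiguity.\<close>

definition zmult :: "int \<Rightarrow> 'a::ab_group_add \<Rightarrow> 'a" where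
  "zmult n x = (if 0 \<le> n then (((+) x) ^^ nat n) 0 else - ((((+) x) ^^ nat (- n)) 0))"

lemma zmult_0 [simp]: "zmult 0 x = 0"
  by (simp add: zmult_def)

lemma zmult_succ: "zmult (n + 1) x = zmult n x + x"
proof (cases "0 \<le> n")
  case True
  then have "nat (n + 1) = Suc (nat n)" by simp
  then show ?thesis using True by (simp add: zmult_def algebra_simps)
next
  case False
  then have *: "nat (- n) = Suc (nat (- (n + 1)))" by simp
  have "n = - 1 \<or> n + 1 < 0" using False by linarith
  then show ?thesis using False by (auto simp: zmult_def *[simplified])
qed

lemma zmult_pred: "zmult (n - 1) x = zmult n x - x"
  using zmult_succ[of "n - 1" x] by (simp add: algebra_simps)

text \<open>Every abelian group becomes a module over the integers, which makes spans, their
  induction rule and their minimality available for tuples of vectors.\<close>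

interpretation zmod: module "zmult :: int \<Rightarrow> 'a::ab_group_add \<Rightarrow> 'a"
proof
  show left: "zmult (a + b) x = zmult a x + zmult b x" for a b and x :: 'a
  proof (induction b rule: int_induct[where k = 0])
    case (step1 i)
    then show ?case using zmult_succ[of "a + i" x] zmult_succ[of i x] by (simp add: algebra_simps)
  next
    case (step2 i)
    have "a + i - 1 = a + (i - 1)" by simp
    with step2 show ?case
      using zmult_pred[of "a + i" x] zmult_pred[of i x] by (metis add_diff_eq)
  qed simp
  show "zmult a (x + y) = zmult a x + zmult a y" for a and x y :: 'a
    by (induction a rule: int_induct[where k = 0]) (simp_all add: zmult_succ zmult_pred algebra_simps)
  show "zmult a (zmult b x) = zmult (a * b) x" for a b and x :: 'a
  proof (induction a rule: int_induct[where k = 0])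
    case (step1 i)
    have "zmult (i * b + b) x = zmult (i * b) x + zmult b x" by (rule left)
    then show ?case using step1 by (simp add: zmult_succ distrib_right)
  next
    case (step2 i)
    have "zmult (i * b) x = zmult (i * b - b) x + zmult b x" using left[of "i * b - b" b x] by simp
    then show ?case using step2 by (simp add: zmult_pred algebra_simps)
  qed simp
  show "zmult 1 x = x" for x :: 'a
    using zmult_succ[of 0 x] by simp
qed

abbreviation zspan :: "'a::ab_group_add set \<Rightarrow> 'a set" where
  "zspan \<equiv> zmod.span"

lemma additive_zmult:
  fixes \<phi> :: "'a::ab_group_add \<Rightarrow> 'b::ab_group_add"
  assumes "\<And>x y. \<phi> (x + y) = \<phi> x + \<phi> y"
  shows "\<phi> (zmult n x) = zmult n (\<phi> x)"
proof -
  have 0: "\<phi> 0 = 0" using assms[of 0 0] by simp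
  have "\<phi> (x - y) = \<phi> x - \<phi> y" for x y using assms[of "x - y" y] by (simp add: algebra_simps)
  then show ?thesis
    by (induction n rule: int_induct[where k = 0]) (simp_all add: assms 0 zmult_succ zmult_pred)
qed

lemma zmult_int [simp]: "zmult n (k :: int) = n * k"
  by (induction n rule: int_induct[where k = 0]) (simp_all add: zmult_succ zmult_pred algebra_simps)

text \<open>Tuples are functions on the whole index type of which only the entries in
  \<open>J\<close> may change; comparing two tuples thus always includes agreement outside
  \<open>J\<close>.\<close>

inductive elementary :: "'i set \<Rightarrow> ('i \<Rightarrow> 'a::ab_group_add) \<Rightarrow> ('i \<Rightarrow> 'a) \<Rightarrow> bool" for J where
  el_add: "\<lbrakk>i \<in> J; j \<in> J; i \<noteq> j; h = g(i := g i + g j)\<rbrakk> \<Longrightarrow> elementary J g h"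
| el_sub: "\<lbrakk>i \<in> J; j \<in> J; i \<noteq> j; h = g(i := g i - g j)\<rbrakk> \<Longrightarrow> elementary J g h"
| el_neg: "\<lbrakk>i \<in> J; h = g(i := - g i)\<rbrakk> \<Longrightarrow> elementary J g h"

lemma el_sym: "elementary J g h \<Longrightarrow> elementary J h g"
proof (induction rule: elementary.induct)
  case (el_add i j h g)
  then show ?case by (intro elementary.el_sub[of i J j]) (simp_all add: fun_eq_iff)
next
  case (el_sub i j h g)
  then show ?case by (intro elementary.el_add[of i J j]) (simp_all add: fun_eq_iff)
next
  case (el_neg i h g)
  then show ?case by (intro elementary.el_neg[of i J]) (simp_all add: fun_eq_iff)
qed

lemma els_sym: "(elementary J)\<^sup>*\<^sup>* g h \<Longrightarrow> (elementary J)\<^sup>*\<^sup>* h g"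
  by (induction rule: rtranclp_induct) (auto intro: converse_rtranclp_into_rtranclp el_sym)

lemma el_outside: "elementary J g h \<Longrightarrow> i \<notin> J \<Longrightarrow> h i = g i"
  by (induction rule: elementary.induct) auto

lemma els_outside: "(elementary J)\<^sup>*\<^sup>* g h \<Longrightarrow> i \<notin> J \<Longrightarrow> h i = g i"
  by (induction rule: rtranclp_induct) (auto simp: el_outside)

lemma el_mono: "elementary J g h \<Longrightarrow> J \<subseteq> J' \<Longrightarrow> elementary J' g h"
  by (induction rule: elementary.induct) (auto intro: elementary.intros)

lemma els_mono: "(elementary J)\<^sup>*\<^sup>* g h \<Longrightarrow> J \<subseteq> J' \<Longrightarrow> (elementary J')\<^sup>*\<^sup>* g h"
  by (metis el_mono mono_rtranclp)

lemma el_span_le: "elementary J g h \<Longrightarrow> zspan (h ` J) \<subseteq> zspan (g ` J)"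
proof (rule zmod.span_minimal)
  assume "elementary J g h"
  then show "h ` J \<subseteq> zspan (g ` J)"
    by cases (auto intro: zmod.span_base zmod.span_add zmod.span_diff zmod.span_neg)
qed simp

lemma el_span: "elementary J g h \<Longrightarrow> zspan (h ` J) = zspan (g ` J)"
  by (meson el_span_le el_sym subset_antisym)

lemma els_span: "(elementary J)\<^sup>*\<^sup>* g h \<Longrightarrow> zspan (h ` J) = zspan (g ` J)"
  by (induction rule: rtranclp_induct) (simp_all add: el_span)

lemma els_add_zmult:
  assumes "i \<in> J" "j \<in> J" "i \<noteq> j"
  shows "(elementary J)\<^sup>*\<^sup>* g (g(i := g i + zmult n (g j)))"
proof (induction n rule: int_induct[where k = 0])
  case base
  have "(elementary J)\<^sup>*\<^sup>* g (g(i := g i + zmult 0 (g j)))" by simp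
  then show ?case .
next
  case (step1 n)
  have "elementary J (g(i := g i + zmult n (g j))) (g(i := g i + zmult (n + 1) (g j)))"
    using assms by (intro el_add[of i J j]) (simp_all add: zmult_succ add.assoc)
  with step1(2) have "(elementary J)\<^sup>*\<^sup>* g (g(i := g i + zmult (n + 1) (g j)))"
    by (meson rtranclp.rtrancl_into_rtrancl)
  then show ?case .
next
  case (step2 n)
  have "elementary J (g(i := g i + zmult n (g j))) (g(i := g i + zmult (n - 1) (g j)))"
    using assms by (intro el_sub[of i J j]) (simp_all add: zmult_pred add_diff_eq)
  with step2(2) have "(elementary J)\<^sup>*\<^sup>* g (g(i := g i + zmult (n - 1) (g j)))"
    by (meson rtranclp.rtrancl_into_rtrancl)
  then show ?case .
qed

text \<open>A combination of the other entries can be added term by term, because those entries stay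
  unchanged meanwhile.\<close>

lemma els_add_span:
  assumes "i \<in> J" and "v \<in> zspan (g ` (J - {i}))"
  shows "(elementary J)\<^sup>*\<^sup>* g (g(i := g i + v))"
  using assms(2)
proof (induction v rule: zmod.span_induct_alt)
  case base
  have "(elementary J)\<^sup>*\<^sup>* g (g(i := g i + 0))" by simp
  then show ?case .
next
  case (step c x y)
  then obtain j where j: "j \<in> J" "j \<noteq> i" "x = g j" by auto
  have "(elementary J)\<^sup>*\<^sup>* (g(i := g i + y)) (g(i := g i + (zmult c x + y)))"
    using els_add_zmult[of i J j "g(i := g i + y)" c] assms(1) j by (simp add: ac_simps)
  with step(2) have "(elementary J)\<^sup>*\<^sup>* g (g(i := g i + (zmult c x + y)))"
    by (meson rtranclp_trans)
  then show ?case .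
qed

text \<open>Euclid's algorithm on the values of \<open>\<phi>\<close>: as long as two entries have
  nonzero values, adding or subtracting one of them decreases the sum of the absolute values. The
  single value that survives is then moved to the prescribed place \<open>k\<close>.\<close>

lemma els_euclid:
  fixes \<phi> :: "'a::ab_group_add \<Rightarrow> int"
  assumes add: "\<And>x y. \<phi> (x + y) = \<phi> x + \<phi> y" and "finite J" "k \<in> J"
  shows "\<exists>h. (elementary J)\<^sup>*\<^sup>* g h \<and> (\<forall>j\<in>J - {k}. \<phi> (h j) = 0) \<and> \<phi> (h k) \<ge> 0"
proof -
  have minus: "\<phi> (x - y) = \<phi> x - \<phi> y" for x y using add[of "x - y" y] by simp
  have 0: "\<phi> 0 = 0" using add[of 0 0] by simp
  have neg: "\<phi> (- x) = - \<phi> x" for x using minus[of 0 x] 0 by simp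
  show ?thesis
  proof (induction "\<Sum>j\<in>J. nat \<bar>\<phi> (g j)\<bar>" arbitrary: g rule: less_induct)
    case less
    have step: ?case if e: "elementary J g g'" "g' = g(i := x)" "i \<in> J" "\<bar>\<phi> x\<bar> < \<bar>\<phi> (g i)\<bar>" for g' i x
    proof -
      have "(\<Sum>j\<in>J. nat \<bar>\<phi> (g' j)\<bar>) < (\<Sum>j\<in>J. nat \<bar>\<phi> (g j)\<bar>)"
        using that assms(2) by (intro sum_strict_mono_ex1) auto
      from less[OF this] e(1) show ?thesis by (meson converse_rtranclp_into_rtranclp)
    qed
    show ?case
    proof (cases "\<exists>i\<in>J. \<exists>j\<in>J. i \<noteq> j \<and> \<phi> (g j) \<noteq> 0 \<and> \<bar>\<phi> (g j)\<bar> \<le> \<bar>\<phi> (g i)\<bar>")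
      case True
      then obtain i j where ij: "i \<in> J" "j \<in> J" "i \<noteq> j" "\<phi> (g j) \<noteq> 0" "\<bar>\<phi> (g j)\<bar> \<le> \<bar>\<phi> (g i)\<bar>"
        by blast
      show ?thesis
      proof (cases "sgn (\<phi> (g i)) = sgn (\<phi> (g j))")
        case True
        then have "\<bar>\<phi> (g i - g j)\<bar> < \<bar>\<phi> (g i)\<bar>"
          using ij unfolding minus by (auto simp: sgn_if split: if_splits)
        then show ?thesis using step[OF el_sub[OF ij(1-3) refl] refl ij(1)] by blast
      next
        case False
        then have "\<bar>\<phi> (g i + g j)\<bar> < \<bar>\<phi> (g i)\<bar>"
          using ij unfolding add by (auto simp: sgn_if split: if_splits)
        then show ?thesis using step[OF el_add[OF ij(1-3) refl] refl ij(1)] by blast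
      qed
    next
      case False
      then have one: "\<phi> (g i) = 0 \<or> \<phi> (g j) = 0" if "i \<in> J" "j \<in> J" "i \<noteq> j" for i j
        using that by (metis linear)
      show ?thesis
      proof (cases "\<forall>j\<in>J - {k}. \<phi> (g j) = 0")
        case True
        show ?thesis
        proof (cases "\<phi> (g k) \<ge> 0")
          case False
          have "(elementary J)\<^sup>*\<^sup>* g (g(k := - g k))" using el_neg[OF \<open>k \<in> J\<close> refl] by blast
          then show ?thesis using True False by (intro exI[of _ "g(k := - g k)"]) (auto simp: neg)
        qed (use True in blast)
      next
        case nz: False
        then obtain j where j: "j \<in> J" "j \<noteq> k" "\<phi> (g j) \<noteq> 0" by blast
        then have "\<phi> (g k) = 0" using one[of j k] \<open>k \<in> J\<close> by auto
        moreover have "\<phi> (g i) = 0" if "i \<in> J" "i \<noteq> j" for i using one[of i j] that j by auto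
        \<comment> \<open>Copy the value at \<open>j\<close> to \<open>k\<close>, then cancel it at
          \<open>j\<close>; \<open>h3\<close> corrects the sign.\<close>
        moreover define h1 where "h1 = g(k := g k + g j)"
        moreover define h2 where "h2 = h1(j := h1 j - h1 k)"
        moreover define h3 where "h3 = h2(k := - h2 k)"
        moreover have "elementary J g h1" "elementary J h1 h2" "elementary J h2 h3"
          unfolding h1_def h2_def h3_def using j \<open>k \<in> J\<close> by (auto intro: elementary.intros)
        moreover have "(elementary J)\<^sup>*\<^sup>* g h2" "(elementary J)\<^sup>*\<^sup>* g h3"
          using calculation by (meson r_into_rtranclp rtranclp.rtrancl_into_rtrancl)+
        ultimately show ?thesis using j
          by (intro exI[of _ "if \<phi> (g j) \<ge> 0 then h2 else h3"]) (auto simp: add minus neg 0)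
      qed
    qed
  qed
qed

lemma zspan_split:
  assumes "k \<in> J" "v \<in> zspan (g ` J)"
  obtains n w where "v = zmult n (g k) + w" "w \<in> zspan (g ` (J - {k}))"
proof -
  have "g ` J = {g k} \<union> g ` (J - {k})" using assms(1) by auto
  then have "v \<in> zspan ({g k} \<union> g ` (J - {k}))" using assms(2) by simp
  then show ?thesis unfolding zmod.span_Un zmod.span_singleton using that by auto
qed

lemma additive_zspan_zero:
  fixes \<phi> :: "'a::ab_group_add \<Rightarrow> 'b::ab_group_add"
  assumes add: "\<And>x y. \<phi> (x + y) = \<phi> x + \<phi> y"
    and "\<And>x. x \<in> A \<Longrightarrow> \<phi> x = 0" "v \<in> zspan A"
  shows "\<phi> v = 0"
  using assms(3)
proof (induction v rule: zmod.span_induct_alt)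
  case base
  then show ?case using add[of 0 0] by simp
next
  case (step c x y)
  then show ?case using additive_zmult[of \<phi>, OF add] by (simp add: add assms(2))
qed

text \<open>Since the other entries have value 0 and \<open>\<phi> (g k)\<close> is nonzero, a
  vanishing value forces the coefficient of \<open>g k\<close> to vanish.\<close>

lemma zspan_kernel:
  fixes \<phi> :: "'a::ab_group_add \<Rightarrow> int"
  assumes add: "\<And>x y. \<phi> (x + y) = \<phi> x + \<phi> y"
    and "k \<in> J" "\<And>j. j \<in> J - {k} \<Longrightarrow> \<phi> (g j) = 0" "\<phi> (g k) \<noteq> 0"
  shows "zspan (g ` (J - {k})) = {v \<in> zspan (g ` J). \<phi> v = 0}"
proof (intro equalityI subsetI CollectI conjI)
  fix v assume v: "v \<in> zspan (g ` (J - {k}))"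
  then show "v \<in> zspan (g ` J)" using zmod.span_mono[of "g ` (J - {k})" "g ` J"] by auto
  show "\<phi> v = 0" using additive_zspan_zero[of \<phi>, OF add _ v] assms(3) by auto
next
  fix v assume v: "v \<in> {v \<in> zspan (g ` J). \<phi> v = 0}"
  obtain n w where nw: "v = zmult n (g k) + w" "w \<in> zspan (g ` (J - {k}))"
    using v zspan_split[OF assms(2)] by blast
  have "\<phi> w = 0" using additive_zspan_zero[of \<phi>, OF add _ nw(2)] assms(3) by auto
  then have "n * \<phi> (g k) = 0" using v nw(1) additive_zmult[of \<phi>, OF add] by (simp add: add)
  then show "v \<in> zspan (g ` (J - {k}))" using nw assms(4) by simp
qed

lemma els_add_multiples:
  assumes "finite A" "A \<subseteq> J - {k}" "k \<in> J"
  shows "(elementary J)\<^sup>*\<^sup>* g (\<lambda>j. if j \<in> A then g j + zmult (n j) (g k) else g j)"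
  using assms(1,2)
proof (induction A rule: finite_induct)
  case empty
  have "(elementary J)\<^sup>*\<^sup>* g (\<lambda>j. if j \<in> {} then g j + zmult (n j) (g k) else g j)" by simp
  then show ?case .
next
  case (insert a A)
  let ?h = "\<lambda>A j. if j \<in> A then g j + zmult (n j) (g k) else g j"
  have "(elementary J)\<^sup>*\<^sup>* (?h A) ((?h A)(a := ?h A a + zmult (n a) (?h A k)))"
    using insert assms(3) by (intro els_add_zmult) auto
  moreover have "(?h A)(a := ?h A a + zmult (n a) (?h A k)) = ?h (insert a A)"
    using insert.hyps insert.prems by (auto simp: fun_eq_iff)
  ultimately have "(elementary J)\<^sup>*\<^sup>* (?h A) (?h (insert a A))" by metis
  moreover have "(elementary J)\<^sup>*\<^sup>* g (?h A)" using insert.IH insert.prems by blast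
  ultimately have "(elementary J)\<^sup>*\<^sup>* g (?h (insert a A))" by (rule rtranclp_trans[rotated])
  then show ?case .
qed

text \<open>Tuples of torsion elements with an entry \<open>\<epsilon>\<close> share the normal form
  with \<open>\<epsilon>\<close> at \<open>k\<close> alone: entry \<open>a\<close> makes entry
  \<open>k\<close> equal to \<open>\<epsilon>\<close>, and this clears the others because
  \<open>\<epsilon> + \<epsilon> = 0\<close>.\<close>

lemma els_torsion:
  assumes "finite J" "k \<in> J" "a \<in> J" "g a = \<epsilon>" "\<And>j. j \<in> J \<Longrightarrow> g j = 0 \<or> g j = \<epsilon>" "\<epsilon> + \<epsilon> = 0"
  shows "(elementary J)\<^sup>*\<^sup>* g (\<lambda>j. if j \<in> J then if j = k then \<epsilon> else 0 else g j)"
proof -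
  define h where "h = (if g k = \<epsilon> then g else g(k := g k + g a))"
  have gh: "(elementary J)\<^sup>*\<^sup>* g h"
    using assms by (auto simp: h_def intro!: r_into_rtranclp el_add[of k J a])
  have h: "h k = \<epsilon>" "\<And>j. j \<noteq> k \<Longrightarrow> h j = g j"
    using assms by (auto simp: h_def)
  define n :: "_ \<Rightarrow> int" where "n j = (if g j = 0 then 0 else 1)" for j
  have "(elementary J)\<^sup>*\<^sup>* h (\<lambda>j. if j \<in> J - {k} then h j + zmult (n j) (h k) else h j)"
    using assms by (intro els_add_multiples) auto
  moreover have "(\<lambda>j. if j \<in> J - {k} then h j + zmult (n j) (h k) else h j) =
      (\<lambda>j. if j \<in> J then if j = k then \<epsilon> else 0 else g j)"
  proof
    fix j show "(if j \<in> J - {k} then h j + zmult (n j) (h k) else h j) =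
      (if j \<in> J then if j = k then \<epsilon> else 0 else g j)"
      using h assms(2,6) assms(5)[of j] by (cases "j = k") (auto simp: n_def)
  qed
  ultimately have "(elementary J)\<^sup>*\<^sup>* h (\<lambda>j. if j \<in> J then if j = k then \<epsilon> else 0 else g j)"
    by metis
  with gh show ?thesis by (rule rtranclp_trans)
qed

text \<open>Induction on the set \<open>R\<close> of functionals. For one of them, Euclid's
  algorithm concentrates the values of both tuples at the same index \<open>k\<close>. The values
  there agree, being nonnegative generators of the same group of integers, and the remaining entries
  generate the kernel inside the common span, where the induction hypothesis applies. With no
  functional left, only 0 and \<open>\<epsilon>\<close> remain.\<close>

theorem els_complete:
  fixes g g' :: "'i \<Rightarrow> 'a::ab_group_add" and \<phi> :: "'k \<Rightarrow> 'a \<Rightarrow> int"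
  assumes add: "\<And>r x y. \<phi> r (x + y) = \<phi> r x + \<phi> r y"
    and "finite R" "finite J" "\<And>i. i \<notin> J \<Longrightarrow> g i = g' i" "zspan (g ` J) = zspan (g' ` J)"
    and "\<And>v. v \<in> zspan (g ` J) \<Longrightarrow> (\<And>r. r \<in> R \<Longrightarrow> \<phi> r v = 0) \<Longrightarrow> v = 0 \<or> v = \<epsilon>"
    and torsion: "\<epsilon> + \<epsilon> = 0"
  shows "(elementary J)\<^sup>*\<^sup>* g g'"
  using assms(2-6)
proof (induction R arbitrary: J g g' rule: finite_induct)
  case empty
  have g: "g j = 0 \<or> g j = \<epsilon>" if "j \<in> J" for j
    using empty.prems(4)[of "g j"] that zmod.span_base[of "g j" "g ` J"] by auto
  have g': "g' j = 0 \<or> g' j = \<epsilon>" if "j \<in> J" for j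
    using empty.prems(3) empty.prems(4)[of "g' j"] that zmod.span_base[of "g' j" "g' ` J"] by auto
  show ?case
  proof (cases "\<epsilon> = 0")
    case True
    then have "g = g'" using g g' empty.prems(2) by (metis ext)
    then show ?thesis by simp
  next
    case False
    \<comment> \<open>Whether some entry equals \<open>\<epsilon>\<close> depends only on the
      span.\<close>
    have nz: "\<exists>a\<in>J. h' a = \<epsilon>" if "a \<in> J" "h a = \<epsilon>" "zspan (h ` J) = zspan (h' ` J)"
      "\<And>j. j \<in> J \<Longrightarrow> h' j = 0 \<or> h' j = \<epsilon>" for a and h h' :: "'i \<Rightarrow> 'a"
    proof (rule ccontr)
      assume "\<not> ?thesis"
      then have "h' j = 0" if "j \<in> J" for j using \<open>j \<in> J\<close> \<open>\<And>j. j \<in> J \<Longrightarrow> h' j = 0 \<or> h' j = \<epsilon>\<close> by blast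
      then have "v = 0" if "v \<in> zspan (h' ` J)" for v
        using additive_zspan_zero[of "\<lambda>x. x" "h' ` J" v] that by auto
      moreover have "\<epsilon> \<in> zspan (h ` J)" using that zmod.span_base[of \<epsilon> "h ` J"] by auto
      ultimately show False using that False by auto
    qed
    show ?thesis
    proof (cases "\<exists>a\<in>J. g a = \<epsilon>")
      case True
      then obtain a where a: "a \<in> J" "g a = \<epsilon>" by blast
      obtain b where b: "b \<in> J" "g' b = \<epsilon>" using nz[OF a empty.prems(3) g'] by blast
      have "(\<lambda>j. if j \<in> J then if j = a then \<epsilon> else 0 else g' j) =
            (\<lambda>j. if j \<in> J then if j = a then \<epsilon> else 0 else g j)"
        using empty.prems(2) by (auto simp: fun_eq_iff)
      then show ?thesis
        using els_torsion[of J a a g \<epsilon>, OF empty.prems(1) a(1) a(1) a(2) g torsion]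
          els_sym[OF els_torsion[of J a b g' \<epsilon>, OF empty.prems(1) a(1) b(1) b(2) g' torsion]]
        by (metis (no_types, lifting) rtranclp_trans)
    next
      case no: False
      then have "\<not> (\<exists>b\<in>J. g' b = \<epsilon>)" using nz[OF _ _ empty.prems(3)[symmetric] g] by blast
      with no have "g = g'" using g g' empty.prems(2) by (metis ext)
      then show ?thesis by simp
    qed
  qed
next
  case (insert r R)
  show ?case
  proof (cases "J = {}")
    case True
    then have "g = g'" using insert.prems(2) by auto
    then show ?thesis by simp
  next
    case False
    then obtain k where k: "k \<in> J" by blast
    obtain h where h: "(elementary J)\<^sup>*\<^sup>* g h" "\<And>j. j \<in> J - {k} \<Longrightarrow> \<phi> r (h j) = 0" "\<phi> r (h k) \<ge> 0"
      using els_euclid[of "\<phi> r" J k g] add insert.prems(1) k by blast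
    obtain h' where h': "(elementary J)\<^sup>*\<^sup>* g' h'" "\<And>j. j \<in> J - {k} \<Longrightarrow> \<phi> r (h' j) = 0" "\<phi> r (h' k) \<ge> 0"
      using els_euclid[of "\<phi> r" J k g'] add insert.prems(1) k by blast
    have out: "h i = h' i" if "i \<notin> J" for i
      using that insert.prems(2) els_outside[OF h(1)] els_outside[OF h'(1)] by simp
    have sp: "zspan (h ` J) = zspan (h' ` J)" "zspan (h ` J) = zspan (g ` J)"
      using insert.prems(3) els_span[OF h(1)] els_span[OF h'(1)] by auto
    have div: "\<phi> r (u k) dvd \<phi> r v" if "v \<in> zspan (u ` J)" "\<And>j. j \<in> J - {k} \<Longrightarrow> \<phi> r (u j) = 0" for u v
    proof -
      obtain n w where nw: "v = zmult n (u k) + w" "w \<in> zspan (u ` (J - {k}))"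
        using zspan_split[OF k \<open>v \<in> zspan (u ` J)\<close>] by blast
      have "\<phi> r w = 0" using additive_zspan_zero[of "\<phi> r", OF add _ nw(2)] that(2) by auto
      then show ?thesis using nw(1) additive_zmult[of "\<phi> r", OF add] by (simp add: add)
    qed
    \<comment> \<open>Each tuple generates the other, so these two nonnegative values divide each
      other.\<close>
    have "\<phi> r (h k) = \<phi> r (h' k)"
      using div[of "h k" h'] div[of "h' k" h] h(2,3) h'(2,3) k sp(1)
        zmod.span_base[of "h k" "h ` J"] zmod.span_base[of "h' k" "h' ` J"]
      by (auto intro: zdvd_antisym_nonneg)
    have hh': "(elementary J)\<^sup>*\<^sup>* h h'"
    proof (cases "\<phi> r (h k) = 0")
      case True
      then have "\<phi> r (h j) = 0" if "j \<in> J" for j using h(2) that by (cases "j = k") auto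
      then have "\<phi> r v = 0" if "v \<in> zspan (h ` J)" for v
        using additive_zspan_zero[of "\<phi> r", OF add _ that] by auto
      then have "v = 0 \<or> v = \<epsilon>" if "v \<in> zspan (h ` J)" "\<And>q. q \<in> R \<Longrightarrow> \<phi> q v = 0" for v
        using insert.prems(4)[of v] that sp(2) by auto
      then show ?thesis using insert.IH[OF insert.prems(1) out sp(1)] by blast
    next
      case False
      have ker: "zspan (h ` (J - {k})) = {v \<in> zspan (h ` J). \<phi> r v = 0}"
        using zspan_kernel[of "\<phi> r" k J h] add k h(2) False by auto
      have ker': "zspan (h' ` (J - {k})) = {v \<in> zspan (h' ` J). \<phi> r v = 0}"
        using zspan_kernel[of "\<phi> r" k J h'] add k h'(2) False \<open>\<phi> r (h k) = \<phi> r (h' k)\<close> by auto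
      have img: "(h'(k := h k)) ` (J - {k}) = h' ` (J - {k})" by auto
      \<comment> \<open>Entry \<open>k\<close> is equalized artificially, since the induction
        hypothesis compares tuples that agree outside \<open>J - {k}\<close>. The error is a kernel
        element, hence a combination of the other entries, and is corrected afterwards.\<close>
      have "(elementary (J - {k}))\<^sup>*\<^sup>* h (h'(k := h k))"
      proof (rule insert.IH)
        show "zspan (h ` (J - {k})) = zspan ((h'(k := h k)) ` (J - {k}))"
          unfolding img ker ker' sp(1) ..
        show "v = 0 \<or> v = \<epsilon>" if "v \<in> zspan (h ` (J - {k}))" "\<And>r. r \<in> R \<Longrightarrow> \<phi> r v = 0" for v
          using that insert.prems(4)[of v] ker sp(2) by auto
      qed (use insert.prems(1) out in auto)
      then have 1: "(elementary J)\<^sup>*\<^sup>* h (h'(k := h k))" by (rule els_mono) auto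
      have "h' k - h k \<in> zspan (h' ` (J - {k}))"
      proof -
        have "h' k \<in> zspan (h' ` J)" "h k \<in> zspan (h' ` J)"
          using k sp(1) zmod.span_base[of "h k" "h ` J"] zmod.span_base[of "h' k" "h' ` J"] by auto
        moreover have "\<phi> r (h' k - h k) = 0"
          using add[of r "h' k - h k" "h k"] \<open>\<phi> r (h k) = \<phi> r (h' k)\<close> by simp
        ultimately show ?thesis unfolding ker' by (auto intro: zmod.span_diff)
      qed
      then have "(elementary J)\<^sup>*\<^sup>* (h'(k := h k)) ((h'(k := h k))(k := h k + (h' k - h k)))"
        using els_add_span[OF k, of "h' k - h k" "h'(k := h k)"] img by simp
      then have "(elementary J)\<^sup>*\<^sup>* (h'(k := h k)) h'" by simp
      with 1 show ?thesis by (meson rtranclp_trans)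
    qed
    show ?thesis using h(1) hh' els_sym[OF h'(1)] by (meson rtranclp_trans)
  qed
qed

section \<open>Operations that keep the first entry in a cone\<close>

text \<open>The operations that will be realized by moves, with \<open>o'\<close> for
  \<open>e\<^sub>0\<close> and \<open>f\<close> for a floating edge. Slides give additions,
  reversing \<open>f\<close> gives its negation, and entries are meaningful only modulo the first
  one. The first entry itself must stay the vector of a positive loop, so that only a swap changes
  it.\<close>

inductive pos :: "'a::ab_group_add set \<Rightarrow> 'i \<Rightarrow> 'i \<Rightarrow> 'i set \<Rightarrow> ('i \<Rightarrow> 'a) \<Rightarrow> ('i \<Rightarrow> 'a) \<Rightarrow> bool"
  for C o' f J where
  pos_add: "\<lbrakk>i \<in> J; j \<in> J; i \<noteq> j; h = g(i := g i + g j)\<rbrakk> \<Longrightarrow> pos C o' f J g h"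
| pos_sub: "\<lbrakk>i \<in> J; j \<in> J; i \<noteq> j; h = g(i := g i - g j)\<rbrakk> \<Longrightarrow> pos C o' f J g h"
| pos_neg: "h = g(f := - g f) \<Longrightarrow> pos C o' f J g h"
| pos_raise: "\<lbrakk>j \<in> J; h = g(j := g j + g o')\<rbrakk> \<Longrightarrow> pos C o' f J g h"
| pos_lower: "\<lbrakk>j \<in> J; h = g(j := g j - g o')\<rbrakk> \<Longrightarrow> pos C o' f J g h"
| pos_swap: "\<lbrakk>g o' \<in> C; g f \<in> C; h = g(o' := g f, f := g o')\<rbrakk> \<Longrightarrow> pos C o' f J g h"

text \<open>Only entry \<open>f\<close> may be negated directly. Elsewhere, three additions give a
  quarter turn in the entries \<open>i\<close> and \<open>f\<close>; its square negates both, and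
  negating \<open>f\<close> once more leaves the negation of \<open>i\<close>.\<close>

lemma pos_el:
  assumes "elementary J g h" "f \<in> J"
  shows "(pos C o' f J)\<^sup>*\<^sup>* g h"
  using assms(1)
proof cases
  case (el_neg i)
  have neg: "(pos C o' f J)\<^sup>*\<^sup>* u (u(f := - u f))" for u by (blast intro: pos_neg)
  show ?thesis
  proof (cases "i = f")
    case True
    then show ?thesis using neg[of g] el_neg by simp
  next
    case False
    have quarter: "(pos C o' f J)\<^sup>*\<^sup>* u (u(i := - u f, f := u i))" for u
    proof -
      define u1 where "u1 = u(f := u f + u i)"
      define u2 where "u2 = u1(i := u1 i - u1 f)"
      define u3 where "u3 = u2(f := u2 f + u2 i)"
      have "pos C o' f J u u1" "pos C o' f J u1 u2" "pos C o' f J u2 u3"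
        using False el_neg(1) assms(2)
        by (auto simp: u1_def u2_def u3_def intro: pos_add pos_sub)
      moreover have "u3 = u(i := - u f, f := u i)"
        using False by (auto simp: u1_def u2_def u3_def fun_eq_iff)
      ultimately show ?thesis by (meson r_into_rtranclp rtranclp.rtrancl_into_rtrancl)
    qed
    define u where "u = g(i := - g f, f := g i)"
    define v where "v = u(i := - u f, f := u i)"
    have "(pos C o' f J)\<^sup>*\<^sup>* g u" "(pos C o' f J)\<^sup>*\<^sup>* u v" "(pos C o' f J)\<^sup>*\<^sup>* v (v(f := - v f))"
      unfolding u_def v_def by (rule quarter neg)+
    moreover have "v(f := - v f) = h"
      unfolding u_def v_def el_neg(2) using False by (auto simp: fun_eq_iff)
    ultimately show ?thesis by (metis (no_types, lifting) rtranclp_trans)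
  qed
qed (use assms(2) in \<open>blast intro: pos_add pos_sub\<close>)+

lemma pos_els:
  assumes "(elementary J)\<^sup>*\<^sup>* g h" "f \<in> J"
  shows "(pos C o' f J)\<^sup>*\<^sup>* g h"
  using assms(1)
proof (induction rule: rtranclp_induct)
  case (step h k)
  show ?case using step(3) pos_el[OF step(2) assms(2)] by (rule rtranclp_trans)
qed simp

lemma pos_span_le:
  assumes "pos C o' f J g h" "f \<in> J" "o' \<notin> J"
  shows "zspan (h ` insert o' J) \<subseteq> zspan (g ` insert o' J)"
proof (rule zmod.span_minimal)
  have base: "g i \<in> zspan (g ` insert o' J)" if "i \<in> insert o' J" for i
    using that by (blast intro: zmod.span_base)
  have "h i \<in> zspan (g ` insert o' J)" if "i \<in> insert o' J" for i
    using assms(1)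
  proof cases
    case (pos_add k j)
    then show ?thesis using base[OF that] base[of j] by (auto intro: zmod.span_add)
  next
    case (pos_sub k j)
    then show ?thesis using base[OF that] base[of j] by (auto intro: zmod.span_diff)
  next
    case pos_neg
    then show ?thesis using base[OF that] by (auto intro: zmod.span_neg)
  next
    case (pos_raise j)
    then show ?thesis using base[OF that] base[of o'] by (auto intro: zmod.span_add)
  next
    case (pos_lower j)
    then show ?thesis using base[OF that] base[of o'] by (auto intro: zmod.span_diff)
  next
    case pos_swap
    then show ?thesis using base[OF that] base[of o'] base[of f] assms(2) by simp
  qed
  then show "h ` insert o' J \<subseteq> zspan (g ` insert o' J)" by blast
qed simp

lemma pos_sym:
  assumes "pos C o' f J g h" "f \<in> J" "o' \<notin> J"
  shows "pos C o' f J h g"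
  using assms(1)
proof cases
  case (pos_add i j)
  then show ?thesis by (intro pos.pos_sub[of i J j]) (auto simp: fun_eq_iff)
next
  case (pos_sub i j)
  then show ?thesis by (intro pos.pos_add[of i J j]) (auto simp: fun_eq_iff)
next
  case pos_neg
  then show ?thesis by (intro pos.pos_neg) (auto simp: fun_eq_iff)
next
  case (pos_raise j)
  moreover have "j \<noteq> o'" using pos_raise assms by auto
  ultimately show ?thesis by (intro pos.pos_lower[of j]) (auto simp: fun_eq_iff)
next
  case (pos_lower j)
  moreover have "j \<noteq> o'" using pos_lower assms by auto
  ultimately show ?thesis by (intro pos.pos_raise[of j]) (auto simp: fun_eq_iff)
next
  case pos_swap
  moreover have "f \<noteq> o'" using assms by auto
  ultimately show ?thesis by (intro pos.pos_swap) (auto simp: fun_eq_iff)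
qed

lemma poss_span:
  assumes "(pos C o' f J)\<^sup>*\<^sup>* g h" "f \<in> J" "o' \<notin> J"
  shows "zspan (h ` insert o' J) = zspan (g ` insert o' J)"
  using assms(1)
proof (induction rule: rtranclp_induct)
  case (step h k)
  have "zspan (k ` insert o' J) = zspan (h ` insert o' J)"
    using pos_span_le[OF step(2) assms(2,3)] pos_span_le[OF pos_sym[OF step(2) assms(2,3)] assms(2,3)]
    by (rule subset_antisym)
  with step(3) show ?case by (rule trans[rotated])
qed simp

lemma poss_raise_zmult:
  assumes "j \<in> J" "o' \<notin> J"
  shows "(pos C o' f J)\<^sup>*\<^sup>* g (g(j := g j + zmult n (g o')))"
proof (induction n rule: int_induct[where k = 0])
  case base
  have "(pos C o' f J)\<^sup>*\<^sup>* g (g(j := g j + zmult 0 (g o')))" by simp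
  then show ?case .
next
  case (step1 n)
  have "pos C o' f J (g(j := g j + zmult n (g o'))) (g(j := g j + zmult (n + 1) (g o')))"
    using assms by (intro pos_raise[of j]) (auto simp: zmult_succ add.assoc fun_eq_iff)
  with step1(2) have "(pos C o' f J)\<^sup>*\<^sup>* g (g(j := g j + zmult (n + 1) (g o')))"
    by (meson rtranclp.rtrancl_into_rtrancl)
  then show ?case .
next
  case (step2 n)
  have "pos C o' f J (g(j := g j + zmult n (g o'))) (g(j := g j + zmult (n - 1) (g o')))"
    using assms by (intro pos_lower[of j]) (auto simp: zmult_pred add_diff_eq fun_eq_iff)
  with step2(2) have "(pos C o' f J)\<^sup>*\<^sup>* g (g(j := g j + zmult (n - 1) (g o')))"
    by (meson rtranclp.rtrancl_into_rtrancl)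
  then show ?case .
qed

lemma poss_raise_all:
  assumes "finite A" "A \<subseteq> J" "o' \<notin> J"
  shows "(pos C o' f J)\<^sup>*\<^sup>* g (\<lambda>j. if j \<in> A then g j + zmult (n j) (g o') else g j)"
  using assms(1,2)
proof (induction A rule: finite_induct)
  case empty
  have "(pos C o' f J)\<^sup>*\<^sup>* g (\<lambda>j. if j \<in> {} then g j + zmult (n j) (g o') else g j)" by simp
  then show ?case .
next
  case (insert a A)
  let ?h = "\<lambda>A j. if j \<in> A then g j + zmult (n j) (g o') else g j"
  have "(pos C o' f J)\<^sup>*\<^sup>* (?h A) ((?h A)(a := ?h A a + zmult (n a) (?h A o')))"
    using insert.prems assms(3) by (intro poss_raise_zmult) auto
  moreover have "o' \<notin> A" using insert.prems assms(3) by auto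
  then have "(?h A)(a := ?h A a + zmult (n a) (?h A o')) = ?h (insert a A)"
    using insert.hyps by (auto simp: fun_eq_iff)
  ultimately have "(pos C o' f J)\<^sup>*\<^sup>* (?h A) (?h (insert a A))" by metis
  moreover have "(pos C o' f J)\<^sup>*\<^sup>* g (?h A)" using insert.IH insert.prems by blast
  ultimately have "(pos C o' f J)\<^sup>*\<^sup>* g (?h (insert a A))" by (rule rtranclp_trans[rotated])
  then show ?case .
qed

section \<open>Reaching a prescribed primitive first entry\<close>

lemma rtranclp_two: "r a b \<Longrightarrow> r b c \<Longrightarrow> r\<^sup>*\<^sup>* a c"
  by (meson r_into_rtranclp rtranclp.rtrancl_into_rtrancl)

text \<open>The subtractive Euclidean algorithm on the coefficients \<open>x\<close> and
  \<open>y\<close>. The entries transform contragrediently: lowering \<open>x\<close> by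
  \<open>y\<close> is compensated by adding \<open>h a\<close> to \<open>h b\<close>.\<close>

lemma els_gcd2:
  assumes "a \<noteq> b"
  shows "\<exists>h' m. (elementary {a, b})\<^sup>*\<^sup>* h h' \<and> zmult x (h a) + zmult y (h b) = zmult m (h' b)"
proof (induction "nat (\<bar>x\<bar> + \<bar>y\<bar>)" arbitrary: x y h rule: less_induct)
  case less
  have step: ?case if t: "elementary {a, b} h h1" "\<bar>x'\<bar> + \<bar>y'\<bar> < \<bar>x\<bar> + \<bar>y\<bar>"
    "zmult x (h a) + zmult y (h b) = zmult x' (h1 a) + zmult y' (h1 b)" for x' y' h1
  proof -
    obtain h' m where h': "(elementary {a, b})\<^sup>*\<^sup>* h1 h'" "zmult x' (h1 a) + zmult y' (h1 b) = zmult m (h' b)"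
      using less[of x' y' h1] t(2) by fastforce
    have "(elementary {a, b})\<^sup>*\<^sup>* h h'" using t(1) h'(1) by (rule converse_rtranclp_into_rtranclp[of "elementary {a, b}"])
    then show ?thesis using h'(2) t(3) by auto
  qed
  consider "x = 0" | "x \<noteq> 0" "y = 0" | "x \<noteq> 0" "y \<noteq> 0" "\<bar>y\<bar> \<le> \<bar>x\<bar>" "sgn x = sgn y"
    | "x \<noteq> 0" "y \<noteq> 0" "\<bar>y\<bar> \<le> \<bar>x\<bar>" "sgn x \<noteq> sgn y"
    | "x \<noteq> 0" "y \<noteq> 0" "\<bar>x\<bar> < \<bar>y\<bar>" "sgn x = sgn y"
    | "x \<noteq> 0" "y \<noteq> 0" "\<bar>x\<bar> < \<bar>y\<bar>" "sgn x \<noteq> sgn y"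
    using linorder_le_less_linear[of "\<bar>y\<bar>" "\<bar>x\<bar>"] by blast
  then show ?case
  proof cases
    case 1
    then show ?thesis by (intro exI[of _ h] exI[of _ y]) simp
  next
    case 2
    \<comment> \<open>With \<open>y = 0\<close> the entry \<open>h a\<close> must be transported to
      index \<open>b\<close>; after these two operations it stands there exactly.\<close>
    define h1 where "h1 = h(a := h a - h b)"
    define h2 where "h2 = h1(b := h1 b + h1 a)"
    have "elementary {a, b} h h1" by (rule el_sub[of a _ b, OF _ _ _ h1_def]) (use assms in auto)
    moreover have "elementary {a, b} h1 h2" by (rule el_add[of b _ a, OF _ _ _ h2_def]) (use assms in auto)
    ultimately have "(elementary {a, b})\<^sup>*\<^sup>* h h2" by (rule rtranclp_two[of "elementary {a, b}"])
    then show ?thesis using 2 assms by (intro exI[of _ h2] exI[of _ x]) (simp add: h1_def h2_def)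
  next
    case 3
    then have "\<bar>x - y\<bar> < \<bar>x\<bar>" by (auto simp: sgn_if split: if_splits)
    then have "\<bar>x - y\<bar> + \<bar>y\<bar> < \<bar>x\<bar> + \<bar>y\<bar>" by simp
    moreover have "zmult x (h a) + zmult y (h b) = zmult (x - y) ((h(b := h b + h a)) a) + zmult (y) ((h(b := h b + h a)) b)"
      using assms by (simp add: zmod.scale_left_diff_distrib zmod.scale_right_distrib)
    moreover have "elementary {a, b} h (h(b := h b + h a))"
      by (rule el_add[of b _ a]) (use assms in auto)
    ultimately show ?thesis by (intro step)
  next
    case 4
    then have "\<bar>x + y\<bar> < \<bar>x\<bar>" by (auto simp: sgn_if split: if_splits)
    then have "\<bar>x + y\<bar> + \<bar>y\<bar> < \<bar>x\<bar> + \<bar>y\<bar>" by simp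
    moreover have "zmult x (h a) + zmult y (h b) = zmult (x + y) ((h(b := h b - h a)) a) + zmult (y) ((h(b := h b - h a)) b)"
      using assms by (simp add: zmod.scale_left_distrib zmod.scale_right_diff_distrib)
    moreover have "elementary {a, b} h (h(b := h b - h a))"
      by (rule el_sub[of b _ a]) (use assms in auto)
    ultimately show ?thesis by (intro step)
  next
    case 5
    then have "\<bar>y - x\<bar> < \<bar>y\<bar>" by (auto simp: sgn_if split: if_splits)
    then have "\<bar>x\<bar> + \<bar>y - x\<bar> < \<bar>x\<bar> + \<bar>y\<bar>" by simp
    moreover have "zmult x (h a) + zmult y (h b) = zmult (x) ((h(a := h a + h b)) a) + zmult (y - x) ((h(a := h a + h b)) b)"
      using assms by (simp add: zmod.scale_left_diff_distrib zmod.scale_right_distrib)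
    moreover have "elementary {a, b} h (h(a := h a + h b))"
      by (rule el_add[of a _ b]) (use assms in auto)
    ultimately show ?thesis by (intro step)
  next
    case 6
    then have "\<bar>y + x\<bar> < \<bar>y\<bar>" by (auto simp: sgn_if split: if_splits)
    then have "\<bar>x\<bar> + \<bar>y + x\<bar> < \<bar>x\<bar> + \<bar>y\<bar>" by simp
    moreover have "zmult x (h a) + zmult y (h b) = zmult (x) ((h(a := h a - h b)) a) + zmult (y + x) ((h(a := h a - h b)) b)"
      using assms by (simp add: zmod.scale_left_distrib zmod.scale_right_diff_distrib)
    moreover have "elementary {a, b} h (h(a := h a - h b))"
      by (rule el_sub[of a _ b]) (use assms in auto)
    ultimately show ?thesis by (intro step)
  qed
qed

text \<open>The combination is gathered into entry \<open>f\<close> one index at a time, each time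
  by \<open>els_gcd2\<close>.\<close>

lemma els_gcd:
  assumes "finite J" "f \<in> J" "u \<in> zspan (g ` J)"
  shows "\<exists>h n. (elementary J)\<^sup>*\<^sup>* g h \<and> u = zmult n (h f)"
proof -
  have "\<exists>h n. (elementary (insert f B))\<^sup>*\<^sup>* g h \<and> u = zmult n (h f)"
    if "finite B" "f \<notin> B" "u \<in> zspan (g ` insert f B)" for B
    using that
  proof (induction B arbitrary: u rule: finite_induct)
    case empty
    then obtain n where "u = zmult n (g f)" by (auto simp: zmod.span_singleton)
    then show ?case by blast
  next
    case (insert j B)
    obtain n w where nw: "u = zmult n (g j) + w" "w \<in> zspan (g ` (insert f (insert j B) - {j}))"
      using zspan_split[of j "insert f (insert j B)" u g] insert.prems by blast
    have "insert f (insert j B) - {j} = insert f B" using insert.hyps(2) insert.prems(1) by auto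
    then obtain h m where h: "(elementary (insert f B))\<^sup>*\<^sup>* g h" "w = zmult m (h f)"
      using insert.IH[of w] nw(2) insert.prems by auto
    have hj: "h j = g j" using els_outside[OF h(1), of j] insert.hyps insert.prems by auto
    obtain h' m' where h': "(elementary {j, f})\<^sup>*\<^sup>* h h'" "zmult n (h j) + zmult m (h f) = zmult m' (h' f)"
      using els_gcd2[of j f h n m] insert.prems(1) by auto
    have "(elementary (insert f (insert j B)))\<^sup>*\<^sup>* g h" "(elementary (insert f (insert j B)))\<^sup>*\<^sup>* h h'"
      by (rule els_mono[OF h(1)], blast) (rule els_mono[OF h'(1)], blast)
    then have "(elementary (insert f (insert j B)))\<^sup>*\<^sup>* g h'" by (rule rtranclp_trans)
    then show ?case using h'(2) nw(1) h(2) hj by metis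
  qed
  from this[of "J - {f}"] assms show ?thesis by (simp add: insert_absorb)
qed

text \<open>Closure is phrased with the equation \<open>zmult n z = v + zmult m u\<close> because
  division in the group is neither always possible nor unique; the vectors met in the descent below
  are of exactly this form.\<close>

definition cone :: "'a::ab_group_add set \<Rightarrow> bool" where
  "cone C \<longleftrightarrow> 0 \<notin> C \<and> (\<forall>u\<in>C. \<forall>v\<in>C. \<forall>n>0. \<forall>m\<ge>0. \<forall>z. zmult n z = v + zmult m u \<longrightarrow> z \<in> C)"

text \<open>If \<open>v = a u + D x\<close> with \<open>D > 0\<close>, adding a multiple of \<open>u\<close> to \<open>x\<close> gives \<open>D x = v + m u\<close> with
  \<open>0 \<le> m < D\<close>. Then \<open>x\<close> lies in the cone, and exchanging \<open>u\<close> and \<open>x\<close> replaces \<open>D\<close> by \<open>m\<close>.\<close>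

lemma poss_descent:
  fixes \<Lambda> :: "'a::ab_group_add \<Rightarrow> int"
  assumes add: "\<And>x y. \<Lambda> (x + y) = \<Lambda> x + \<Lambda> y" and "\<Lambda> v = 1"
    and C: "cone C" "v \<in> C" and J: "f \<in> J" "o' \<notin> J"
  shows "g o' \<in> C \<Longrightarrow> v = zmult a (g o') + zmult (int D) (g f) \<Longrightarrow>
    \<exists>h. (pos C o' f J)\<^sup>*\<^sup>* g h \<and> h o' = v"
proof (induction D arbitrary: a g rule: less_induct)
  case (less D)
  have "o' \<noteq> f" using J by auto
  show ?case
  proof (cases "D = 0")
    case True
    then have v: "v = zmult a (g o')" using less.prems by simp
    \<comment> \<open>The functional \<open>\<Lambda>\<close> makes \<open>v\<close> primitive, so
      \<open>v\<close> is the first entry up to sign. The negative sign is excluded because 0, the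
      sum of two members, would lie in the cone.\<close>
    then have "a * \<Lambda> (g o') = 1" using additive_zmult[of \<Lambda>, OF add] assms(2) by simp
    then have "a = 1 \<or> a = - 1" by (auto simp: zmult_eq_1_iff)
    then show ?thesis
    proof
      assume "a = 1"
      then show ?thesis using v by auto
    next
      assume "a = - 1"
      then have "zmult 1 0 = v + zmult 1 (g o')" using v by simp
      then have "0 \<in> C" using C less.prems(1) unfolding cone_def by (metis zero_le_one zero_less_one)
      then show ?thesis using C unfolding cone_def by simp
    qed
  next
    case False
    define m where "m = (- a) mod int D"
    define t where "t = - ((- a) div int D)"
    have m: "0 \<le> m" "m < int D" using False by (auto simp: m_def)
    have "nat m < D" using m by simp
    have a: "a = int D * t - m"
      using mult_div_mod_eq[of "int D" "- a"] unfolding m_def t_def mult_minus_right by linarith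
    define g1 where "g1 = g(f := g f + zmult t (g o'))"
    define g2 where "g2 = g1(o' := g1 f, f := g1 o')"
    \<comment> \<open>Negating the old first entry makes its coefficient in \<open>v\<close> the
      nonnegative number \<open>m\<close>, which takes over the role of \<open>D\<close>.\<close>
    define g3 where "g3 = g2(f := - g2 f)"
    have eq: "zmult (int D) (g1 f) = v + zmult m (g o')"
      unfolding less.prems(2) a g1_def
      by (simp add: zmod.scale_left_diff_distrib zmod.scale_right_distrib)
    then have "g1 f \<in> C" using C less.prems(1) m unfolding cone_def by (metis False int_nat_eq of_nat_0_less_iff gr0I)
    have p1: "(pos C o' f J)\<^sup>*\<^sup>* g g1" unfolding g1_def by (rule poss_raise_zmult[OF J])
    have p2: "pos C o' f J g1 g2"
      by (rule pos_swap[OF _ _ g2_def]) (use \<open>g1 f \<in> C\<close> less.prems \<open>o' \<noteq> f\<close> in \<open>auto simp: g1_def\<close>)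
    have p3: "pos C o' f J g2 g3" unfolding g3_def by (rule pos_neg) simp
    have "v = zmult m (g3 f) + zmult (int D) (g3 o')"
      using eq \<open>o' \<noteq> f\<close> by (simp add: g3_def g2_def) (simp add: g1_def)
    then have "v = zmult (int D) (g3 o') + zmult (int (nat m)) (g3 f)" using m by (simp add: add.commute)
    moreover have "g3 o' \<in> C" using \<open>g1 f \<in> C\<close> \<open>o' \<noteq> f\<close> by (simp add: g3_def g2_def)
    ultimately obtain h where h: "(pos C o' f J)\<^sup>*\<^sup>* g3 h" "h o' = v"
      using less.IH[OF \<open>nat m < D\<close>, of g3 "int D"] by blast
    have "(pos C o' f J)\<^sup>*\<^sup>* g1 g3" using p2 p3 by (rule rtranclp_two[of "pos C o' f J"])
    with p1 have "(pos C o' f J)\<^sup>*\<^sup>* g g3" by (rule rtranclp_trans)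
    then show ?thesis using rtranclp_trans[OF _ h(1)] h(2) by blast
  qed
qed

text \<open>The part of \<open>v\<close> outside the first entry is gathered into a multiple of
  entry \<open>f\<close>; the absolute value of that multiple is the \<open>D\<close> at which the
  descent starts.\<close>

lemma poss_reach:
  fixes \<Lambda> :: "'a::ab_group_add \<Rightarrow> int"
  assumes add: "\<And>x y. \<Lambda> (x + y) = \<Lambda> x + \<Lambda> y" and "\<Lambda> v = 1"
    and C: "cone C" "v \<in> C" "g o' \<in> C" and J: "f \<in> J" "o' \<notin> J" "finite J"
    and v: "v \<in> zspan (g ` insert o' J)"
  shows "\<exists>h. (pos C o' f J)\<^sup>*\<^sup>* g h \<and> h o' = v"
proof -
  obtain a w where aw: "v = zmult a (g o') + w" "w \<in> zspan (g ` (insert o' J - {o'}))"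
    using zspan_split[OF _ v, of o'] by blast
  then obtain h n where h: "(elementary J)\<^sup>*\<^sup>* g h" "w = zmult n (h f)"
    using els_gcd[of J f w g] J by auto
  define h1 where "h1 = (if n \<ge> 0 then h else h(f := - h f))"
  have "(elementary J)\<^sup>*\<^sup>* h h1" using J(1) by (auto simp: h1_def intro: el_neg)
  then have "(elementary J)\<^sup>*\<^sup>* g h1" using h(1) by (meson rtranclp_trans)
  then have p: "(pos C o' f J)\<^sup>*\<^sup>* g h1" "h1 o' = g o'"
    using pos_els[OF _ J(1)] els_outside[OF _ J(2)] by blast+
  have "w = zmult (int (nat \<bar>n\<bar>)) (h1 f)" using h(2) by (auto simp: h1_def)
  then obtain k where k: "(pos C o' f J)\<^sup>*\<^sup>* h1 k" "k o' = v"
    using poss_descent[of \<Lambda>, OF add assms(2) C(1,2) J(1,2), of h1 a "nat \<bar>n\<bar>"] aw(1) p(2) C(3) by auto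
  then show ?thesis using rtranclp_trans[OF p(1) k(1)] by blast
qed

section \<open>Lifting tuples to a free abelian group\<close>

lemma el_lift:
  assumes "elementary I g g'" "\<And>x y. F (x + y) = F x + F y" "\<And>i. i \<in> I \<Longrightarrow> F (b i) = g i"
  shows "\<exists>b'. elementary I b b' \<and> (\<forall>i\<in>I. F (b' i) = g' i)"
proof -
  have minus: "F (x - y) = F x - F y" for x y using assms(2)[of "x - y" y] by (simp add: algebra_simps)
  have neg: "F (- x) = - F x" for x using minus[of 0 x] minus[of 0 0] by simp
  show ?thesis
    using assms(1)
  proof cases
    case (el_add i j)
    then show ?thesis using assms(2,3)
      by (intro exI[of _ "b(i := b i + b j)"]) (auto intro: elementary.el_add[of i _ j])
  next
    case (el_sub i j)
    then show ?thesis using assms(3) minus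
      by (intro exI[of _ "b(i := b i - b j)"]) (auto intro: elementary.el_sub[of i _ j])
  next
    case (el_neg i)
    then show ?thesis using assms(3) neg
      by (intro exI[of _ "b(i := - b i)"]) (auto intro: elementary.el_neg[of i])
  qed
qed

lemma els_lift:
  assumes "(elementary I)\<^sup>*\<^sup>* g g'" "\<And>x y. F (x + y) = F x + F y" "\<And>i. i \<in> I \<Longrightarrow> F (b i) = g i"
  shows "\<exists>b'. (elementary I)\<^sup>*\<^sup>* b b' \<and> (\<forall>i\<in>I. F (b' i) = g' i)"
  using assms(1)
proof (induction rule: rtranclp_induct)
  case base
  then show ?case using assms(3) by blast
next
  case (step h k)
  then obtain b' where b': "(elementary I)\<^sup>*\<^sup>* b b'" "\<forall>i\<in>I. F (b' i) = h i" by blast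
  then obtain b2 where b2: "elementary I b' b2" "\<forall>i\<in>I. F (b2 i) = k i"
    using el_lift[OF step(2), of F b'] assms(2) by blast
  show ?case using rtranclp.rtrancl_into_rtrancl[of "elementary I", OF b'(1) b2(1)] b2(2) by blast
qed

text \<open>The direction opposite to \<open>el_lift\<close>: operations upstairs descend along
  \<open>F\<close>. Images are compared on \<open>insert o' J\<close> only, since nothing is known
  about the other entries.\<close>

lemma pos_push:
  assumes "pos {c. F c \<in> C} o' f J b b'" "\<And>x y. F (x + y) = F x + F y"
    "\<And>i. i \<in> insert o' J \<Longrightarrow> F (b i) = g i" "f \<in> J"
  shows "\<exists>g'. pos C o' f J g g' \<and> (\<forall>i\<in>insert o' J. F (b' i) = g' i)"
proof -
  have minus: "F (x - y) = F x - F y" for x y using assms(2)[of "x - y" y] by (simp add: algebra_simps)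
  have neg: "F (- x) = - F x" for x using minus[of 0 x] minus[of 0 0] by simp
  have o': "F (b o') = g o'" and f: "F (b f) = g f" using assms(3,4) by auto
  show ?thesis
    using assms(1)
  proof cases
    case (pos_add i j)
    then show ?thesis using assms(2,3)
      by (intro exI[of _ "g(i := g i + g j)"]) (auto intro: pos.pos_add[of i _ j])
  next
    case (pos_sub i j)
    then show ?thesis using assms(3) minus
      by (intro exI[of _ "g(i := g i - g j)"]) (auto intro: pos.pos_sub[of i _ j])
  next
    case pos_neg
    then show ?thesis using assms(3,4) neg
      by (intro exI[of _ "g(f := - g f)"]) (auto intro: pos.pos_neg)
  next
    case (pos_raise j)
    then show ?thesis using assms(2,3)
      by (intro exI[of _ "g(j := g j + g o')"]) (auto intro: pos.pos_raise[of j])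
  next
    case (pos_lower j)
    then show ?thesis using assms(3) minus minus[of 0 0]
      by (intro exI[of _ "g(j := g j - g o')"]) (auto intro: pos.pos_lower[of j])
  next
    case pos_swap
    have "pos C o' f J g (g(o' := g f, f := g o'))"
      using pos_swap o' f by (intro pos.pos_swap) auto
    moreover have "\<forall>i\<in>insert o' J. F (b' i) = (g(o' := g f, f := g o')) i"
      using pos_swap assms(3) o' f by auto
    ultimately show ?thesis by blast
  qed
qed

lemma poss_push:
  assumes "(pos {c. F c \<in> C} o' f J)\<^sup>*\<^sup>* b b'" "\<And>x y. F (x + y) = F x + F y"
    "\<And>i. i \<in> insert o' J \<Longrightarrow> F (b i) = g i" "f \<in> J"
  shows "\<exists>g'. (pos C o' f J)\<^sup>*\<^sup>* g g' \<and> (\<forall>i\<in>insert o' J. F (b' i) = g' i)"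
  using assms(1)
proof (induction rule: rtranclp_induct)
  case base
  then show ?case using assms(3) by blast
next
  case (step c k)
  then obtain g' where g': "(pos C o' f J)\<^sup>*\<^sup>* g g'" "\<forall>i\<in>insert o' J. F (c i) = g' i" by blast
  then obtain g2 where g2: "pos C o' f J g' g2" "\<forall>i\<in>insert o' J. F (k i) = g2 i"
    using pos_push[OF step(2), of g'] assms(2,4) by blast
  show ?case using rtranclp.rtrancl_into_rtrancl[of "pos C o' f J", OF g'(1) g2(1)] g2(2) by blast
qed

text \<open>Coordinate functionals certifying that the entries of \<open>b\<close> form a basis of
  their span. They supply the functional with value 1 on the target vector that the descent
  requires.\<close>

definition dual :: "'i set \<Rightarrow> ('i \<Rightarrow> 'a::ab_group_add) \<Rightarrow> ('i \<Rightarrow> 'a \<Rightarrow> int) \<Rightarrow> bool" where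
  "dual I b \<Lambda> \<longleftrightarrow> (\<forall>i x y. \<Lambda> i (x + y) = \<Lambda> i x + \<Lambda> i y) \<and>
     (\<forall>i\<in>I. \<forall>k\<in>I. \<Lambda> i (b k) = (if i = k then 1 else 0))"

text \<open>The dual basis transforms contragrediently: adding \<open>b j\<close> to
  \<open>b i\<close> subtracts the functional of \<open>i\<close> from that of
  \<open>j\<close>.\<close>

lemma el_dual:
  assumes "elementary I b c" "dual I b \<Lambda>"
  shows "\<exists>\<Lambda>'. dual I c \<Lambda>'"
proof -
  have add: "\<Lambda> i (x + y) = \<Lambda> i x + \<Lambda> i y" for i x y using assms(2) by (simp add: dual_def)
  have d: "\<Lambda> i (b k) = (if i = k then 1 else 0)" if "i \<in> I" "k \<in> I" for i k
    using assms(2) that by (simp add: dual_def)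
  have minus: "\<Lambda> i (x - y) = \<Lambda> i x - \<Lambda> i y" for i x y using add[of i "x - y" y] by simp
  have neg: "\<Lambda> i (- x) = - \<Lambda> i x" for i x using minus[of i 0 x] minus[of i 0 0] by simp
  from assms(1) show ?thesis
  proof cases
    case (el_add i j)
    have "dual I c (\<lambda>k x. if k = j then \<Lambda> j x - \<Lambda> i x else \<Lambda> k x)"
      using el_add by (auto simp: dual_def add d)
    then show ?thesis by blast
  next
    case (el_sub i j)
    have "dual I c (\<lambda>k x. if k = j then \<Lambda> j x + \<Lambda> i x else \<Lambda> k x)"
      using el_sub by (auto simp: dual_def add minus d)
    then show ?thesis by blast
  next
    case (el_neg i)
    have "dual I c (\<lambda>k x. if k = i then - \<Lambda> i x else \<Lambda> k x)"
      using el_neg by (auto simp: dual_def add neg d)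
    then show ?thesis by blast
  qed
qed

lemma els_dual:
  assumes "(elementary I)\<^sup>*\<^sup>* b c" "dual I b \<Lambda>"
  shows "\<exists>\<Lambda>'. dual I c \<Lambda>'"
  using assms(1)
proof (induction rule: rtranclp_induct)
  case base
  show ?case using assms(2) by blast
next
  case (step c d)
  then show ?case using el_dual by blast
qed

lemma cone_vimage:
  assumes "cone C" and add: "\<And>x y. F (x + y) = F x + F y"
  shows "cone {c. F c \<in> C}"
  unfolding cone_def
proof (intro conjI ballI allI impI)
  have "F 0 = 0" using add[of 0 0] by simp
  then show "0 \<notin> {c. F c \<in> C}" using assms(1) by (simp add: cone_def)
  fix u v z and n m :: int
  assume *: "u \<in> {c. F c \<in> C}" "v \<in> {c. F c \<in> C}" "0 < n" "0 \<le> m" "zmult n z = v + zmult m u"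
  then have "zmult n (F z) = F v + zmult m (F u)"
    by (metis additive_zmult[of F, OF add] add)
  then show "z \<in> {c. F c \<in> C}" using * assms(1) unfolding cone_def by blast
qed

text \<open>Lifting the tuples to \<open>\<int>\<^sup>I\<close> makes the first entry of the target part of a basis.
  Once it is the first entry of both tuples, the rest can be compared modulo it.\<close>

theorem poss_complete:
  fixes g g' :: "'i \<Rightarrow> 'a::ab_group_add"
  assumes "finite J" and J: "f \<in> J" "o' \<notin> J" and els: "(elementary (insert o' J))\<^sup>*\<^sup>* g g'"
    and C: "cone C" "g o' \<in> C" "g' o' \<in> C"
  shows "\<exists>h. (pos C o' f J)\<^sup>*\<^sup>* g h \<and> (\<forall>i\<in>insert o' J. h i = g' i)"
proof -
  define I where "I = insert o' J"
  have "finite I" using assms(1) by (simp add: I_def)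
  \<comment> \<open>\<open>F\<close> sends the standard basis vectors \<open>E i\<close> to the
    entries \<open>g i\<close>, so operations on the basis cover operations on the tuple.\<close>
  define F :: "('i \<Rightarrow> int) \<Rightarrow> 'a" where "F c = (\<Sum>k\<in>I. zmult (c k) (g k))" for c
  define E :: "'i \<Rightarrow> 'i \<Rightarrow> int" where "E i k = (if k = i then 1 else 0)" for i k
  have F_add: "F (x + y) = F x + F y" for x y
    by (simp add: F_def zmod.scale_left_distrib sum.distrib)
  have F_E: "F (E i) = g i" if "i \<in> I" for i
    using \<open>finite I\<close> that
    by (simp add: F_def E_def if_distrib[of "\<lambda>n. zmult n _"] sum.delta cong: if_cong)
  obtain b where b: "(elementary I)\<^sup>*\<^sup>* E b" "\<And>i. i \<in> I \<Longrightarrow> F (b i) = g' i"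
    using els_lift[of I g g' F E, OF els[folded I_def] F_add F_E] by blast
  have "dual I E (\<lambda>i c. c i)" by (simp add: dual_def E_def)
  then obtain M where "dual I b M" using els_dual[OF b(1)] by blast
  define \<Lambda> where "\<Lambda> = M o'"
  have \<Lambda>_add: "\<Lambda> (x + y) = \<Lambda> x + \<Lambda> y" for x y
    using \<open>dual I b M\<close> unfolding dual_def \<Lambda>_def by blast
  have \<Lambda>_b: "\<Lambda> (b k) = (if k = o' then 1 else 0)" if "k \<in> I" for k
    using \<open>dual I b M\<close> that unfolding dual_def \<Lambda>_def I_def by auto
  define CC where "CC = {c. F c \<in> C}"
  have "cone CC" unfolding CC_def by (intro cone_vimage[of C F] C(1) F_add)
  have span_b: "zspan (b ` I) = zspan (E ` I)" by (rule els_span[OF b(1)])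
  have "o' \<in> I" by (simp add: I_def)
  have "\<exists>c. (pos CC o' f J)\<^sup>*\<^sup>* E c \<and> c o' = b o'"
  proof (rule poss_reach[of \<Lambda>, OF \<Lambda>_add _ \<open>cone CC\<close> _ _ J \<open>finite J\<close>])
    show "\<Lambda> (b o') = 1" using \<Lambda>_b \<open>o' \<in> I\<close> by simp
    show "b o' \<in> CC" using b(2) \<open>o' \<in> I\<close> C by (simp add: CC_def)
    show "E o' \<in> CC" using F_E \<open>o' \<in> I\<close> C by (simp add: CC_def)
    show "b o' \<in> zspan (E ` insert o' J)"
      using zmod.span_base[of "b o'" "b ` I"] span_b \<open>o' \<in> I\<close> by (auto simp: I_def[symmetric])
  qed
  then obtain c where c: "(pos CC o' f J)\<^sup>*\<^sup>* E c" "c o' = b o'" by blast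
  \<comment> \<open>The first entry has \<open>\<Lambda>\<close>-value 1, so subtracting multiples
    of it brings the other entries into the kernel of \<open>\<Lambda>\<close>, which the entries
    \<open>b j\<close> for \<open>j\<close> in \<open>J\<close> generate as well.\<close>
  define d where "d = (\<lambda>j. if j \<in> J then c j + zmult (- \<Lambda> (c j)) (c o') else c j)"
  have cd: "(pos CC o' f J)\<^sup>*\<^sup>* c d" unfolding d_def by (rule poss_raise_all[OF \<open>finite J\<close> subset_refl J(2)])
  have Ed: "(pos CC o' f J)\<^sup>*\<^sup>* E d" using c(1) cd by (rule rtranclp_trans)
  have span_d: "zspan (d ` I) = zspan (E ` I)" unfolding I_def by (rule poss_span[OF Ed J])
  have "d o' = b o'" using J(2) c(2) by (simp add: d_def)
  have \<Lambda>_minus: "\<Lambda> (x - y) = \<Lambda> x - \<Lambda> y" for x y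
    using \<Lambda>_add[of "x - y" y] by (simp only: diff_add_cancel)
  have \<Lambda>_d: "\<Lambda> (d j) = 0" if "j \<in> J" for j
  proof -
    have "d j = c j - zmult (\<Lambda> (c j)) (b o')" using that c(2) by (simp add: d_def)
    then show ?thesis
      using \<Lambda>_b[OF \<open>o' \<in> I\<close>] by (simp only: \<Lambda>_minus additive_zmult[of \<Lambda>, OF \<Lambda>_add]) simp
  qed
  have IJ: "I - {o'} = J" using J(2) by (auto simp: I_def)
  have ker_b: "zspan (b ` J) = {v \<in> zspan (E ` I). \<Lambda> v = 0}"
    unfolding IJ[symmetric] span_b[symmetric]
  proof (rule zspan_kernel[of \<Lambda> o' I b, OF \<Lambda>_add \<open>o' \<in> I\<close>])
    show "\<Lambda> (b j) = 0" if "j \<in> I - {o'}" for j using that \<Lambda>_b[of j] by auto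
    show "\<Lambda> (b o') \<noteq> 0" using \<Lambda>_b[OF \<open>o' \<in> I\<close>] by simp
  qed
  have ker_d: "zspan (d ` J) = {v \<in> zspan (E ` I). \<Lambda> v = 0}"
    unfolding IJ[symmetric] span_d[symmetric]
  proof (rule zspan_kernel[of \<Lambda> o' I d, OF \<Lambda>_add \<open>o' \<in> I\<close>])
    show "\<Lambda> (d j) = 0" if "j \<in> I - {o'}" for j using that \<Lambda>_d[of j] unfolding IJ by blast
    show "\<Lambda> (d o') \<noteq> 0" using \<Lambda>_b[OF \<open>o' \<in> I\<close>] \<open>d o' = b o'\<close> by simp
  qed
  \<comment> \<open>Outside \<open>J\<close> the values of \<open>d\<close> are kept, since from now
    on only entries in \<open>J\<close> may change.\<close>
  define b' where "b' = (\<lambda>i. if i \<in> J then b i else d i)"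
  have "b' ` J = b ` J" by (simp add: b'_def)
  have "(elementary J)\<^sup>*\<^sup>* d b'"
  proof (rule els_complete[where \<phi> = "\<lambda>k c. c k" and R = I and \<epsilon> = 0])
    show "zspan (d ` J) = zspan (b' ` J)" using ker_b ker_d \<open>b' ` J = b ` J\<close> by simp
    \<comment> \<open>Elements of the span of \<open>E\<close> are supported on \<open>I\<close>, so
      the coordinates in \<open>I\<close> separate them; there is no torsion upstairs.\<close>
    show "v = 0 \<or> v = 0" if "v \<in> zspan (d ` J)" "\<And>r. r \<in> I \<Longrightarrow> v r = 0" for v
    proof -
      have "v r = 0" if "r \<notin> I" for r
      proof (rule additive_zspan_zero[of "\<lambda>c. c r" "E ` I"])
        show "v \<in> zspan (E ` I)" using \<open>v \<in> zspan (d ` J)\<close> ker_d by simp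
      qed (use that in \<open>auto simp: E_def\<close>)
      then have "v = 0" using that(2) by (auto simp: fun_eq_iff)
      then show ?thesis by simp
    qed
  qed (use \<open>finite I\<close> \<open>finite J\<close> in \<open>auto simp: b'_def\<close>)
  then have "(pos CC o' f J)\<^sup>*\<^sup>* d b'" by (rule pos_els[OF _ J(1)])
  with Ed have "(pos CC o' f J)\<^sup>*\<^sup>* E b'" by (rule rtranclp_trans)
  then obtain h where h: "(pos C o' f J)\<^sup>*\<^sup>* g h" "\<And>i. i \<in> insert o' J \<Longrightarrow> F (b' i) = h i"
    using poss_push[of F C o' f J E b' g] F_add F_E J(1) unfolding CC_def I_def by blast
  have "h i = g' i" if "i \<in> insert o' J" for i
  proof -
    have "b' i = b i" using that \<open>d o' = b o'\<close> J(2) by (auto simp: b'_def)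
    then show ?thesis using h(2)[OF that] b(2) that by (simp add: I_def)
  qed
  then show ?thesis using h(1) by blast
qed

section \<open>Exponent vectors\<close>

lemma supp_add: "supp (a + b) \<subseteq> supp a \<union> supp b"
  by (auto simp: supp_def)

lemma supp_uminus [simp]: "supp (- a) = supp a"
  by (auto simp: supp_def)

lemma supp_diff: "supp (a - b) \<subseteq> supp a \<union> supp b"
  by (auto simp: supp_def)

lemma supp_0 [simp]: "supp 0 = {}"
  by (auto simp: supp_def)

lemma eps_add_eps [simp]: "eps + eps = 0"
  by (simp add: eps_def prod_eq_iff)

lemma supp_eps [simp]: "supp eps = {}"
  by (auto simp: supp_def eps_def)

text \<open>The group of differences allowed between points of one family, when \<open>S\<close> is
  the quasi-conjugacy support.\<close>

definition asub :: "nat set \<Rightarrow> avec set" where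
  "asub S = {a. supp a \<subseteq> S}"

lemma asub_add: "a \<in> asub S \<Longrightarrow> b \<in> asub S \<Longrightarrow> a + b \<in> asub S"
  using supp_add[of a b] by (auto simp: asub_def)

lemma asub_diff: "a \<in> asub S \<Longrightarrow> b \<in> asub S \<Longrightarrow> a - b \<in> asub S"
  using supp_diff[of a b] by (auto simp: asub_def)

lemma asub_uminus: "a \<in> asub S \<Longrightarrow> - a \<in> asub S"
  by (simp add: asub_def)

lemma asub_0 [simp]: "0 \<in> asub S"
  by (simp add: asub_def)

lemma asub_eps [simp]: "eps \<in> asub S"
  by (simp add: asub_def)

lemma Apos_asub: "a \<in> Apos S \<Longrightarrow> a \<in> asub S"
  by (simp add: asub_def Apos_def)

lemma Apos_0 [simp]: "0 \<in> Apos S"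
  by (simp add: Apos_def)

lemma Apos_eps [simp]: "eps \<in> Apos S"
  by (simp add: Apos_def) (simp add: eps_def)

lemma Apos_add: "a \<in> Apos S \<Longrightarrow> b \<in> Apos S \<Longrightarrow> a + b \<in> Apos S"
  using supp_add[of a b] by (auto simp: Apos_def)

lemma Apos_mono: "S \<subseteq> P \<Longrightarrow> a \<in> Apos S \<Longrightarrow> a \<in> Apos P"
  by (auto simp: Apos_def)

lemma snd_zmult: "snd (zmult n (a :: avec)) r = n * snd a r"
  using additive_zmult[of "\<lambda>a :: avec. snd a r" n a] by simp

lemma nat_mult_zmult: "nat_mult k w = zmult (int k) w"
proof (induction k)
  case (Suc k)
  have "nat_mult (Suc k) w = nat_mult k w + w" by (simp add: nat_mult_def)
  also have "\<dots> = zmult (int k + 1) w" by (simp add: Suc zmult_succ)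
  finally show ?case by (simp add: add.commute)
qed (simp add: nat_mult_def)

lemma supp_zmult: "supp (zmult n a) \<subseteq> supp a"
  by (auto simp: supp_def snd_zmult)

lemma zmult_asub: "a \<in> asub S \<Longrightarrow> zmult n a \<in> asub S"
  using supp_zmult[of n a] by (auto simp: asub_def)

lemma zmult_Apos: "0 \<le> n \<Longrightarrow> a \<in> Apos S \<Longrightarrow> zmult n a \<in> Apos S"
  using supp_zmult[of n a] by (auto simp: Apos_def snd_zmult)

lemma zspan_asub: "v \<in> zspan A \<Longrightarrow> A \<subseteq> asub S \<Longrightarrow> v \<in> asub S"
  by (induction v rule: zmod.span_induct_alt) (auto intro: asub_add zmult_asub)

definition full :: "nat set \<Rightarrow> avec set" where
  "full S = {a \<in> Apos S. supp a = S}"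

lemma full_Apos: "a \<in> full S \<Longrightarrow> a \<in> Apos S"
  by (simp add: full_def)

lemma full_iff: "a \<in> full S \<longleftrightarrow> (\<forall>r. if r \<in> S then 0 < snd a r else snd a r = 0)"
  unfolding full_def Apos_def supp_def
  by (auto split: if_splits) (metis (mono_tags, lifting) le_less mem_Collect_eq)+

lemma cone_full:
  assumes "S \<noteq> {}"
  shows "cone (full S)"
  unfolding cone_def
proof (intro conjI ballI allI impI)
  show "0 \<notin> full S" using assms by (auto simp: full_def)
  fix u v z :: avec and n m :: int
  assume *: "u \<in> full S" "v \<in> full S" "0 < n" "0 \<le> m" "zmult n z = v + zmult m u"
  have eq: "n * snd z r = snd v r + m * snd u r" for r
    using arg_cong[OF *(5), of "\<lambda>a. snd a r"] by (simp add: snd_zmult)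
  show "z \<in> full S" unfolding full_iff
  proof (intro allI)
    fix r
    show "if r \<in> S then 0 < snd z r else snd z r = 0"
    proof (cases "r \<in> S")
      case True
      then have "0 < snd v r" "0 \<le> m * snd u r" using * by (auto simp: full_iff less_imp_le)
      then have "0 < n * snd z r" unfolding eq by linarith
      then show ?thesis using True *(3) by (simp add: zero_less_mult_iff)
    next
      case False
      then have "snd v r = 0" "snd u r = 0" using *(1,2) by (auto simp: full_iff)
      then show ?thesis using eq[of r] *(3) False by simp
    qed
  qed
qed

text \<open>The device behind all height arguments: each coordinate in \<open>S\<close> grows by at
  least 1 with every copy of \<open>w\<close>, so the sum of the absolute values of the coordinates
  of \<open>a\<close> is a sufficient threshold.\<close>

lemma raise_Apos:
  assumes "finite S" "w \<in> full S" "a \<in> asub S"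
  obtains N :: nat where "\<And>n. int N \<le> n \<Longrightarrow> a + zmult n w \<in> Apos S"
proof
  fix n assume n: "int (\<Sum>r\<in>S. nat \<bar>snd a r\<bar>) \<le> n"
  have "0 \<le> snd (a + zmult n w) r" for r
  proof (cases "r \<in> S")
    case True
    then have w: "1 \<le> snd w r" using assms(2) by (auto simp: full_iff int_one_le_iff_zero_less)
    have "nat \<bar>snd a r\<bar> \<le> (\<Sum>r\<in>S. nat \<bar>snd a r\<bar>)"
      using True assms(1) by (intro member_le_sum) auto
    then have "- snd a r \<le> n" using n by linarith
    moreover have "0 \<le> n" using order_trans[OF of_nat_0_le_iff n] .
    then have "n * 1 \<le> n * snd w r" using w by (intro mult_left_mono)
    ultimately show ?thesis by (simp add: snd_zmult)
  next
    case False
    then have "snd a r = 0" "snd w r = 0" using assms by (auto simp: asub_def supp_def full_iff)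
    then show ?thesis by (simp add: snd_zmult)
  qed
  moreover have "supp (a + zmult n w) \<subseteq> S"
    using asub_add[OF assms(3) zmult_asub[OF Apos_asub[OF full_Apos[OF assms(2)]], of n]]
    by (simp add: asub_def)
  ultimately show "a + zmult n w \<in> Apos S" by (simp add: Apos_def)
qed

lemma raise_full:
  assumes "finite S" "w \<in> full S" "a \<in> asub S"
  obtains N :: nat where "\<And>n. int N \<le> n \<Longrightarrow> a + zmult n w \<in> full S"
proof -
  obtain N where N: "\<And>n. int N \<le> n \<Longrightarrow> a + zmult n w \<in> Apos S" using raise_Apos[OF assms] by blast
  \<comment> \<open>One further copy of \<open>w\<close> makes the nonnegative coordinates in
    \<open>S\<close> strictly positive.\<close>
  have "a + zmult n w \<in> full S" if "int (Suc N) \<le> n" for n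
  proof -
    have A: "a + zmult (n - 1) w \<in> Apos S" using N that by simp
    have eq: "a + zmult n w = (a + zmult (n - 1) w) + w" using zmult_succ[of "n - 1" w] by (simp add: add.assoc)
    have "if r \<in> S then 0 < snd ((a + zmult (n - 1) w) + w) r else snd ((a + zmult (n - 1) w) + w) r = 0" for r
    proof -
      have "0 \<le> snd (a + zmult (n - 1) w) r" using A by (simp add: Apos_def)
      moreover have "snd (a + zmult (n - 1) w) r = 0" if "r \<notin> S" using A that by (auto simp: Apos_def supp_def)
      moreover have "if r \<in> S then 0 < snd w r else snd w r = 0" using assms(2) by (simp add: full_iff)
      ultimately show ?thesis by (auto simp del: snd_add simp: snd_add[of "a + zmult (n - 1) w" w] split: if_splits)
    qed
    then show ?thesis unfolding eq full_iff by blast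
  qed
  then show ?thesis using that by blast
qed

lemma shift_shift [simp]: "(p \<^bold>+ a) \<^bold>+ b = p \<^bold>+ (a + b)"
  by (simp add: shift_def add.assoc)

lemma shift_0 [simp]: "p \<^bold>+ 0 = p"
  by (simp add: shift_def)

lemma fst_shift [simp]: "fst (p \<^bold>+ a) = fst p"
  by (simp add: shift_def)

lemma snd_shift [simp]: "snd (p \<^bold>+ a) = snd p + a"
  by (simp add: shift_def)

lemma shift_eq_iff [simp]: "p \<^bold>+ a = p \<^bold>+ b \<longleftrightarrow> a = b"
  by (simp add: shift_def)

lemma shift_eqI: "fst p = fst q \<Longrightarrow> snd p = snd q + a \<Longrightarrow> p = q \<^bold>+ a"
  by (simp add: shift_def prod_eq_iff)

section \<open>Graphs as families of endpoint pairs\<close>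

text \<open>The first two steps only change the orientation or the label of an edge, so the represented
  graph stays the same.\<close>

inductive st :: "nat set \<Rightarrow> 'i set \<Rightarrow> ('i \<Rightarrow> 'v point \<times> 'v point) \<Rightarrow> ('i \<Rightarrow> 'v point \<times> 'v point) \<Rightarrow> bool"
  for P D where
  st_flip: "\<lbrakk>d \<in> D; s' = s(d := (snd (s d), fst (s d)))\<rbrakk> \<Longrightarrow> st P D s s'"
| st_exchange: "\<lbrakk>d \<in> D; e \<in> D; s' = s(d := s e, e := s d)\<rbrakk> \<Longrightarrow> st P D s s'"
| st_sign: "\<lbrakk>d \<in> D; s' = s(d := (fst (s d) \<^bold>+ eps, snd (s d) \<^bold>+ eps))\<rbrakk> \<Longrightarrow> st P D s s'"
| st_slide: "\<lbrakk>d \<in> D; e \<in> D; d \<noteq> e; s d = (p, q); s e = (r, p \<^bold>+ a); a \<in> Apos P;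
    s' = s(e := (r, q \<^bold>+ a))\<rbrakk> \<Longrightarrow> st P D s s'"
| st_swap: "\<lbrakk>d \<in> D; e \<in> D; d \<noteq> e; s d = (p, p \<^bold>+ w\<^sub>1); s e = (q, q \<^bold>+ w\<^sub>2);
    w\<^sub>1 \<in> Apos P; w\<^sub>2 \<in> Apos P; point_le P p q; point_le P q (p \<^bold>+ nat_mult k\<^sub>1 w\<^sub>1);
    point_le P q (p \<^bold>+ nat_mult k\<^sub>2 w\<^sub>2); s' = s(d := (q, q \<^bold>+ w\<^sub>1), e := (p, p \<^bold>+ w\<^sub>2))\<rbrakk>
    \<Longrightarrow> st P D s s'"

text \<open>\<open>\<theta>\<close> selects one orientation of each geometric edge and labels it by
  an element of \<open>D\<close>. Working with endpoint families on a fixed label set separates the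
  combinatorics of the moves from the edge names and orientations of a particular graph.\<close>

definition rep ::
  "'v point set \<Rightarrow> 'i set \<Rightarrow> ('v point, 'e) sgraph \<Rightarrow> ('i \<Rightarrow> 'e) \<Rightarrow> ('i \<Rightarrow> 'v point \<times> 'v point) \<Rightarrow> bool" where
  "rep V D L \<theta> s \<longleftrightarrow> Verts L = V \<and>
     (\<forall>e\<in>Edges L. bar L e \<in> Edges L \<and> bar L (bar L e) = e \<and> bar L e \<noteq> e) \<and>
     (\<forall>d\<in>D. \<theta> d \<in> Edges L \<and> init L (\<theta> d) = fst (s d) \<and> init L (bar L (\<theta> d)) = snd (s d)) \<and>
     (\<forall>d\<in>D. \<forall>d'\<in>D. d \<noteq> d' \<longrightarrow> \<theta> d \<noteq> \<theta> d' \<and> \<theta> d \<noteq> bar L (\<theta> d')) \<and>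
     (\<forall>e\<in>Edges L. \<exists>d\<in>D. e = \<theta> d \<or> e = bar L (\<theta> d))"

lemma rep_set_ends:
  assumes "rep V D L \<theta> s" "e \<in> D"
  shows "rep V D (set_ends (\<theta> e) p q L) \<theta> (s(e := (p, q)))"
proof -
  have "bar L (\<theta> d) \<noteq> \<theta> d" "bar L (bar L (\<theta> d)) = \<theta> d" if "d \<in> D" for d
    using assms(1) that by (auto simp: rep_def)
  moreover have "bar L (\<theta> d) \<noteq> bar L (\<theta> d')" if "d \<in> D" "d' \<in> D" "d \<noteq> d'" for d d'
    using assms(1) that calculation by (metis rep_def)
  moreover have "bar L (\<theta> d) \<noteq> \<theta> d'" if "d \<in> D" "d' \<in> D" "d \<noteq> d'" for d d'
    using assms(1) that calculation by (metis rep_def)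
  ultimately show ?thesis
    using assms unfolding rep_def set_ends_def by simp metis
qed

lemma rep_joins: "rep V D L \<theta> s \<Longrightarrow> d \<in> D \<Longrightarrow> s d = (p, q) \<Longrightarrow> joins L (\<theta> d) p q"
  by (auto simp: rep_def joins_def term_of_def)

lemma rep_distinct: "rep V D L \<theta> s \<Longrightarrow> d \<in> D \<Longrightarrow> e \<in> D \<Longrightarrow> d \<noteq> e \<Longrightarrow> distinct_edges L (\<theta> d) (\<theta> e)"
  by (auto simp: rep_def distinct_edges_def)

lemma rep_st:
  assumes rep: "rep V D L \<theta> s" and "st P D s s'"
  shows "\<exists>L' \<theta>'. (move P)\<^sup>*\<^sup>* L L' \<and> rep V D L' \<theta>' s'"
proof -
  have bb: "bar L (\<theta> x) \<noteq> \<theta> x" "bar L (bar L (\<theta> x)) = \<theta> x" if "x \<in> D" for x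
    using rep that by (auto simp: rep_def)
  have ne: "\<theta> x \<noteq> \<theta> y" "\<theta> x \<noteq> bar L (\<theta> y)" if "x \<in> D" "y \<in> D" "x \<noteq> y" for x y
    using rep that unfolding rep_def by blast+
  have cover: "\<exists>x\<in>D. e = \<theta> x \<or> e = bar L (\<theta> x)" if "e \<in> Edges L" for e
    using rep that unfolding rep_def by blast
  have ed: "\<theta> x \<in> Edges L" "bar L (\<theta> x) \<in> Edges L" if "x \<in> D" for x
    using rep that unfolding rep_def by blast+
  show ?thesis
    using assms(2)
  proof cases
    case (st_flip d)
    have "rep V D L (\<theta>(d := bar L (\<theta> d))) s'"
      unfolding rep_def
    proof (intro conjI ballI impI)
      fix x y assume xy: "x \<in> D" "y \<in> D" "x \<noteq> y"
      show "(\<theta>(d := bar L (\<theta> d))) x \<noteq> (\<theta>(d := bar L (\<theta> d))) y"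
        "(\<theta>(d := bar L (\<theta> d))) x \<noteq> bar L ((\<theta>(d := bar L (\<theta> d))) y)"
        using bb[OF xy(1)] bb[OF xy(2)] ne[OF xy] ne[OF xy(2,1) xy(3)[symmetric]] xy(3) by auto
    next
      fix e assume "e \<in> Edges L"
      then obtain x where x: "x \<in> D" "e = \<theta> x \<or> e = bar L (\<theta> x)" using cover by blast
      then show "\<exists>x\<in>D. e = (\<theta>(d := bar L (\<theta> d))) x \<or> e = bar L ((\<theta>(d := bar L (\<theta> d))) x)"
        using bb[OF x(1)] by (intro bexI[of _ x]) auto
    qed (use rep st_flip bb ed in \<open>auto simp: rep_def\<close>)
    then show ?thesis by blast
  next
    case (st_exchange d e)
    have "rep V D L (\<theta>(d := \<theta> e, e := \<theta> d)) s'"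
      unfolding rep_def
    proof (intro conjI ballI impI)
      fix x y assume xy: "x \<in> D" "y \<in> D" "x \<noteq> y"
      define \<pi> where "\<pi> = id(d := e, e := d)"
      have "\<pi> x \<in> D" "\<pi> y \<in> D" "\<pi> x \<noteq> \<pi> y" using xy st_exchange by (auto simp: \<pi>_def)
      note ne[OF this]
      moreover have "(\<theta>(d := \<theta> e, e := \<theta> d)) z = \<theta> (\<pi> z)" for z by (simp add: \<pi>_def)
      ultimately show "(\<theta>(d := \<theta> e, e := \<theta> d)) x \<noteq> (\<theta>(d := \<theta> e, e := \<theta> d)) y"
        "(\<theta>(d := \<theta> e, e := \<theta> d)) x \<noteq> bar L ((\<theta>(d := \<theta> e, e := \<theta> d)) y)" by simp_all
    next
      fix z assume "z \<in> Edges L"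
      then obtain x where x: "x \<in> D" "z = \<theta> x \<or> z = bar L (\<theta> x)" using cover by blast
      then show "\<exists>x\<in>D. z = (\<theta>(d := \<theta> e, e := \<theta> d)) x \<or> z = bar L ((\<theta>(d := \<theta> e, e := \<theta> d)) x)"
        using st_exchange by (intro bexI[of _ "(id(d := e, e := d)) x"]) auto
    qed (use rep st_exchange in \<open>auto simp: rep_def\<close>)
    then show ?thesis by blast
  next
    case (st_sign d)
    have "move P L (set_ends (\<theta> d) (fst (s d) \<^bold>+ eps) (snd (s d) \<^bold>+ eps) L)"
      using sign_change.intros[OF rep_joins[OF rep st_sign(1) prod.collapse[symmetric]]]
      by (simp add: move_def)
    then show ?thesis using rep_set_ends[OF rep st_sign(1)] st_sign(2) by blast
  next
    case (st_slide d e p q r a)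
    have "move P L (set_ends (\<theta> e) r (q \<^bold>+ a) L)"
      unfolding move_def
      using slide.intros[OF rep_distinct[OF rep st_slide(1-3)] rep_joins[OF rep st_slide(1,4)]
          rep_joins[OF rep st_slide(2,5)] st_slide(6)] by blast
    then show ?thesis using rep_set_ends[OF rep st_slide(2)] st_slide(7) by blast
  next
    case (st_swap d e p w\<^sub>1 q w\<^sub>2 k\<^sub>1 k\<^sub>2)
    define L1 where "L1 = set_ends (\<theta> e) p (p \<^bold>+ w\<^sub>2) L"
    have "move P L (set_ends (\<theta> d) q (q \<^bold>+ w\<^sub>1) L1)"
      unfolding move_def L1_def
      using swap.intros[OF rep_distinct[OF rep st_swap(1-3)] rep_joins[OF rep st_swap(1,4)]
          rep_joins[OF rep st_swap(2,5)] st_swap(6-10)] by blast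
    moreover have "rep V D L1 \<theta> (s(e := (p, p \<^bold>+ w\<^sub>2)))"
      unfolding L1_def by (rule rep_set_ends[OF rep st_swap(2)])
    from rep_set_ends[OF this st_swap(1)]
    have "rep V D (set_ends (\<theta> d) q (q \<^bold>+ w\<^sub>1) L1) \<theta> s'"
      using st_swap(3,11) by (simp add: fun_upd_twist)
    ultimately show ?thesis by blast
  qed
qed

lemma rep_sts:
  assumes "rep V D L \<theta> s" and "(st P D)\<^sup>*\<^sup>* s s'"
  shows "\<exists>L' \<theta>'. (move P)\<^sup>*\<^sup>* L L' \<and> rep V D L' \<theta>' s'"
  using assms(2)
proof (induction rule: rtranclp_induct)
  case base
  then show ?case using assms(1) by blast
next
  case (step t u)
  then obtain L1 \<theta>1 where L1: "(move P)\<^sup>*\<^sup>* L L1" "rep V D L1 \<theta>1 t" by blast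
  then obtain L2 \<theta>2 where L2: "(move P)\<^sup>*\<^sup>* L1 L2" "rep V D L2 \<theta>2 u" using rep_st step(2) by blast
  show ?case using rtranclp_trans[OF L1(1) L2(1)] L2(2) by blast
qed

text \<open>The isomorphism matches \<open>\<theta> d\<close> with \<open>\<eta> d\<close> and their
  reverses accordingly.\<close>

lemma rep_same_graph:
  assumes L: "rep V D L \<theta> s" and M: "rep V D M \<eta> s"
  shows "same_graph L M"
proof -
  define f where "f e = (if \<exists>d\<in>D. e = \<theta> d then \<eta> (THE d. d \<in> D \<and> e = \<theta> d)
    else bar M (\<eta> (THE d. d \<in> D \<and> e = bar L (\<theta> d))))" for e
  have barL: "bar L (\<theta> d) \<noteq> \<theta> d" "bar L (bar L (\<theta> d)) = \<theta> d" "bar L (\<theta> d) \<in> Edges L" "\<theta> d \<in> Edges L"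
    if "d \<in> D" for d using L that by (auto simp: rep_def)
  have barM: "bar M (\<eta> d) \<noteq> \<eta> d" "bar M (bar M (\<eta> d)) = \<eta> d" "bar M (\<eta> d) \<in> Edges M" "\<eta> d \<in> Edges M"
    if "d \<in> D" for d using M that by (auto simp: rep_def)
  have neqL: "\<theta> d \<noteq> bar L (\<theta> d')" if "d \<in> D" "d' \<in> D" for d d'
    using L that barL(1)[OF that(1)] unfolding rep_def by metis
  have neqM: "\<eta> d \<noteq> bar M (\<eta> d')" if "d \<in> D" "d' \<in> D" for d d'
    using M that barM(1)[OF that(1)] unfolding rep_def by metis
  have injL: "d = d'" if "d \<in> D" "d' \<in> D" "\<theta> d = \<theta> d'" for d d' using L that unfolding rep_def by blast
  have injM: "d = d'" if "d \<in> D" "d' \<in> D" "\<eta> d = \<eta> d'" for d d' using M that unfolding rep_def by blast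
  have f1: "f (\<theta> d) = \<eta> d" if "d \<in> D" for d
  proof -
    have "(THE d'. d' \<in> D \<and> \<theta> d = \<theta> d') = d"
    proof (rule the_equality)
      fix d' assume "d' \<in> D \<and> \<theta> d = \<theta> d'"
      then show "d' = d" using injL[of d d'] that by simp
    qed (use that in simp)
    moreover have "\<exists>d'\<in>D. \<theta> d = \<theta> d'" using that by blast
    ultimately show ?thesis by (simp add: f_def)
  qed
  have f2: "f (bar L (\<theta> d)) = bar M (\<eta> d)" if "d \<in> D" for d
  proof -
    have "(THE d'. d' \<in> D \<and> bar L (\<theta> d) = bar L (\<theta> d')) = d"
    proof (rule the_equality)
      fix d' assume d': "d' \<in> D \<and> bar L (\<theta> d) = bar L (\<theta> d')"
      then have "bar L (\<theta> d) = bar L (\<theta> d')" and D: "d' \<in> D" by blast+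
      from arg_cong[OF this(1), of "bar L"] have "\<theta> d = \<theta> d'"
        unfolding barL(2)[OF that] barL(2)[OF D] .
      then show "d' = d" using injL[OF that D] by blast
    qed (use that in simp)
    moreover have "\<not> (\<exists>d'\<in>D. bar L (\<theta> d) = \<theta> d')" using neqL[OF _ that] by fastforce
    ultimately show ?thesis by (simp add: f_def)
  qed
  have eL: "(\<exists>d\<in>D. e = \<theta> d) \<or> (\<exists>d\<in>D. e = bar L (\<theta> d))" if "e \<in> Edges L" for e
    using L that unfolding rep_def by blast
  have eM: "(\<exists>d\<in>D. e = \<eta> d) \<or> (\<exists>d\<in>D. e = bar M (\<eta> d))" if "e \<in> Edges M" for e
    using M that unfolding rep_def by blast
  have "inj_on f (Edges L)"
  proof (rule inj_onI)
    fix x y assume xy: "x \<in> Edges L" "y \<in> Edges L" "f x = f y"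
    from eL[OF xy(1)] eL[OF xy(2)] show "x = y"
    proof (elim disjE bexE)
      fix d d' assume d: "d \<in> D" "d' \<in> D" "x = \<theta> d" "y = \<theta> d'"
      then have "\<eta> d = \<eta> d'" using xy(3) f1 by simp
      then show ?thesis using injM[OF d(1,2)] d by blast
    next
      fix d d' assume d: "d \<in> D" "d' \<in> D" "x = \<theta> d" "y = bar L (\<theta> d')"
      then show ?thesis using xy(3) f1 f2 neqM[OF d(1,2)] by simp
    next
      fix d d' assume d: "d \<in> D" "d' \<in> D" "x = bar L (\<theta> d)" "y = \<theta> d'"
      then show ?thesis using xy(3) f1 f2 neqM[OF d(2,1)] by simp
    next
      fix d d' assume d: "d \<in> D" "d' \<in> D" "x = bar L (\<theta> d)" "y = bar L (\<theta> d')"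
      then have "bar M (\<eta> d) = bar M (\<eta> d')" using xy(3) f2 by simp
      from arg_cong[OF this, of "bar M"] have "\<eta> d = \<eta> d'"
        unfolding barM(2)[OF d(1)] barM(2)[OF d(2)] .
      then show ?thesis using injM[OF d(1,2)] d by blast
    qed
  qed
  moreover have "f ` Edges L = Edges M"
  proof (intro equalityI subsetI)
    fix y assume "y \<in> f ` Edges L"
    then obtain x where "x \<in> Edges L" "y = f x" by blast
    then show "y \<in> Edges M" using eL[of x] f1 f2 barM(3,4) by auto
  next
    fix y assume "y \<in> Edges M"
    from eM[OF this] show "y \<in> f ` Edges L"
    proof (elim disjE bexE)
      fix d assume d: "d \<in> D" "y = \<eta> d"
      then show ?thesis using f1[OF d(1)] barL(4)[OF d(1)] by (intro image_eqI) auto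
    next
      fix d assume d: "d \<in> D" "y = bar M (\<eta> d)"
      then show ?thesis using f2[OF d(1)] barL(3)[OF d(1)] by (intro image_eqI) auto
    qed
  qed
  moreover have "f (bar L e) = bar M (f e) \<and> init M (f e) = init L e" if "e \<in> Edges L" for e
    using eL[OF that]
  proof (elim disjE bexE)
    fix d assume d: "d \<in> D" "e = \<theta> d"
    then show ?thesis using f1 f2 L M by (simp add: rep_def)
  next
    fix d assume d: "d \<in> D" "e = bar L (\<theta> d)"
    then show ?thesis using f1 f2 L M barL(2) barM(2) by (simp add: rep_def)
  qed
  moreover have "Verts L = Verts M" using L M by (simp add: rep_def)
  ultimately show ?thesis unfolding same_graph_def bij_betw_def by blast
qed

declare split_paired_Ex [simp del] split_paired_All [simp del]

section \<open>Moves on normal forms\<close>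

text \<open>A step of conjugacy along an edge labelled in \<open>D\<close>, in either direction. The
  label set is explicit because a path of slides of an edge may not use that edge.\<close>

definition istep :: "nat set \<Rightarrow> 'i set \<Rightarrow> ('i \<Rightarrow> 'v point \<times> 'v point) \<Rightarrow> 'v point \<Rightarrow> 'v point \<Rightarrow> bool" where
  "istep P D s p q \<longleftrightarrow> (\<exists>d\<in>D. \<exists>a\<in>Apos P. (p = fst (s d) \<^bold>+ a \<and> q = snd (s d) \<^bold>+ a) \<or>
     (p = snd (s d) \<^bold>+ a \<and> q = fst (s d) \<^bold>+ a))"

abbreviation iconj :: "nat set \<Rightarrow> 'i set \<Rightarrow> ('i \<Rightarrow> 'v point \<times> 'v point) \<Rightarrow> 'v point \<Rightarrow> 'v point \<Rightarrow> bool" where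
  "iconj P D s \<equiv> (istep P D s)\<^sup>*\<^sup>*"

lemma iconj_sym: "iconj P D s p q \<Longrightarrow> iconj P D s q p"
proof (induction rule: rtranclp_induct)
  case (step q r)
  have "istep P D s r q" using step(2) by (auto simp: istep_def)
  then show ?case using step(3) by (rule converse_rtranclp_into_rtranclp[of "istep P D s"])
qed simp

lemma iconj_shift: "iconj P D s p q \<Longrightarrow> a \<in> Apos P \<Longrightarrow> iconj P D s (p \<^bold>+ a) (q \<^bold>+ a)"
proof (induction rule: rtranclp_induct)
  case (step q r)
  obtain d b where d: "d \<in> D" "b \<in> Apos P" "(q = fst (s d) \<^bold>+ b \<and> r = snd (s d) \<^bold>+ b) \<or>
     (q = snd (s d) \<^bold>+ b \<and> r = fst (s d) \<^bold>+ b)" using step(2) unfolding istep_def by blast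
  have "istep P D s (q \<^bold>+ a) (r \<^bold>+ a)"
    unfolding istep_def using d Apos_add[OF d(2) step.prems] by (intro bexI[of _ d] bexI[of _ "b + a"]) auto
  with step(3)[OF step.prems] show ?case by (rule rtranclp.rtrancl_into_rtrancl[of "istep P D s"])
qed simp

lemma iconj_edge: "d \<in> D \<Longrightarrow> a \<in> Apos P \<Longrightarrow> iconj P D s (fst (s d) \<^bold>+ a) (snd (s d) \<^bold>+ a)"
  by (rule r_into_rtranclp[of "istep P D s"]) (auto simp: istep_def)

text \<open>A conjugacy step along another edge \<open>d\<close> is a slide of \<open>e\<close> over
  \<open>d\<close>; a step against the orientation of \<open>d\<close> is bracketed by two reversals
  of \<open>d\<close>.\<close>

lemma iconj_slide_term:
  assumes "iconj P D s q q'" "D \<subseteq> O' - {e}" "e \<in> O'"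
  shows "(st P O')\<^sup>*\<^sup>* (s(e := (r, q))) (s(e := (r, q')))"
  using assms(1)
proof (induction rule: rtranclp_induct)
  case (step p q)
  let ?s = "\<lambda>q. s(e := (r, q))"
  obtain d a where d: "d \<in> D" "a \<in> Apos P" "(p = fst (s d) \<^bold>+ a \<and> q = snd (s d) \<^bold>+ a) \<or>
     (p = snd (s d) \<^bold>+ a \<and> q = fst (s d) \<^bold>+ a)" using step(2) by (auto simp: istep_def)
  have de: "d \<in> O'" "d \<noteq> e" using d(1) assms(2) by auto
  from d(3) have "(st P O')\<^sup>*\<^sup>* (?s p) (?s q)"
  proof
    assume pq: "p = fst (s d) \<^bold>+ a \<and> q = snd (s d) \<^bold>+ a"
    have "st P O' (?s p) (?s q)"
      by (rule st_slide[of d _ e _ "fst (s d)" "snd (s d)" r a]) (use de assms(3) d(2) pq in auto)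
    then show ?thesis by (rule r_into_rtranclp[of "st P O'"])
  next
    assume pq: "p = snd (s d) \<^bold>+ a \<and> q = fst (s d) \<^bold>+ a"
    define u where "u = (?s p)(d := (snd (s d), fst (s d)))"
    define v where "v = (?s q)(d := (snd (s d), fst (s d)))"
    have "st P O' (?s p) u" by (rule st_flip[of d]) (use de in \<open>auto simp: u_def\<close>)
    moreover have "st P O' u v"
      by (rule st_slide[of d _ e _ "snd (s d)" "fst (s d)" r a])
        (use de assms(3) d(2) pq in \<open>auto simp: u_def v_def fun_upd_twist\<close>)
    moreover have "st P O' v (?s q)"
      by (rule st_flip[of d]) (use de in \<open>auto simp: v_def fun_eq_iff\<close>)
    ultimately show ?thesis
      by (meson r_into_rtranclp rtranclp.rtrancl_into_rtrancl)
  qed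
  with step(3) show ?case by (rule rtranclp_trans)
qed simp

lemma iconj_slide_init:
  assumes "iconj P D s q q'" "D \<subseteq> O' - {e}" "e \<in> O'"
  shows "(st P O')\<^sup>*\<^sup>* (s(e := (q, r))) (s(e := (q', r)))"
proof -
  have "st P O' (s(e := (q, r))) (s(e := (r, q)))" by (rule st_flip[of e]) (use assms(3) in auto)
  moreover have "(st P O')\<^sup>*\<^sup>* (s(e := (r, q))) (s(e := (r, q')))" by (rule iconj_slide_term[OF assms])
  moreover have "st P O' (s(e := (r, q'))) (s(e := (q', r)))" by (rule st_flip[of e]) (use assms(3) in auto)
  ultimately show ?thesis
    by (meson converse_rtranclp_into_rtranclp rtranclp.rtrancl_into_rtrancl)
qed

text \<open>The translation of an edge. It has a meaning only when both ends lie in the same family,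
  hence not for the edges of \<open>K\<close> below.\<close>

definition gen :: "('i \<Rightarrow> 'v point \<times> 'v point) \<Rightarrow> 'i \<Rightarrow> avec" where
  "gen s d = snd (snd (s d)) - snd (fst (s d))"

definition up :: "nat set \<Rightarrow> 'v point \<Rightarrow> 'v point set" where
  "up S p = {p \<^bold>+ w | w. w \<in> Apos S}"

lemma upI: "w \<in> Apos S \<Longrightarrow> p \<^bold>+ w \<in> up S p"
  unfolding up_def by blast

lemma up_shift [simp]: "p \<^bold>+ w \<in> up S p \<longleftrightarrow> w \<in> Apos S"
  unfolding up_def by (simp add: shift_def)

text \<open>In a normal form, \<open>e\<^sub>0\<close> is the edge at one minimal point of \<open>F\<^sub>0\<close>, \<open>K\<close> consists of the edges
  at the points \<open>m\<^sub>F\<close>, \<open>J\<close> of all other edges, and \<open>Fl\<close> of the floating ones among them. Edges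
  outside \<open>Fl\<close> start at the fixed minimal point \<open>\<beta>\<close>, and \<open>anc j\<close> is the edge of
  \<open>insert e\<^sub>0 K\<close> that starts in the same family as \<open>j\<close>.\<close>

locale config =
  fixes P S :: "nat set" and e\<^sub>0 :: 'i and K J Fl :: "'i set"
    and \<beta> :: "'i \<Rightarrow> 'v point" and anc :: "'i \<Rightarrow> 'i"
  assumes S: "finite S" "S \<subseteq> P" "S \<noteq> {}" and fin: "finite K" "finite J"
    and e0: "e\<^sub>0 \<notin> K" "e\<^sub>0 \<notin> J" and KJ: "K \<inter> J = {}" and Fl: "Fl \<subseteq> J"
    and anc: "\<And>j. j \<in> J \<Longrightarrow> anc j \<in> insert e\<^sub>0 K" "\<And>f. f \<in> Fl \<Longrightarrow> anc f = e\<^sub>0"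
    and \<beta>_anc: "\<And>j. j \<in> J - Fl \<Longrightarrow> \<exists>a\<in>asub S. \<beta> j = \<beta> (anc j) \<^bold>+ a"
begin

abbreviation "Ed \<equiv> insert e\<^sub>0 (K \<union> J)"
abbreviation "I \<equiv> insert e\<^sub>0 J"
abbreviation "\<beta>\<^sub>0 \<equiv> \<beta> e\<^sub>0"
abbreviation sts (infix "\<leadsto>" 50) where "s \<leadsto> s' \<equiv> (st P Ed)\<^sup>*\<^sup>* s s'"

text \<open>A relaxed normal form that survives the moves: only the loop at \<open>e\<^sub>0\<close>
  must have full support, and movable endpoints need only be above one reference point of their
  family instead of above all its minimal points with full gap.\<close>

definition valid :: "('i \<Rightarrow> 'v point \<times> 'v point) \<Rightarrow> bool" where
  "valid s \<longleftrightarrow> (\<exists>w\<in>full S. s e\<^sub>0 = (\<beta>\<^sub>0, \<beta>\<^sub>0 \<^bold>+ w)) \<and>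
     (\<forall>k\<in>K. fst (s k) = \<beta> k \<and> snd (s k) \<in> up S \<beta>\<^sub>0) \<and>
     (\<forall>j\<in>J. snd (s j) \<in> up S (\<beta> (anc j)) \<and> (if j \<in> Fl then fst (s j) \<in> up S \<beta>\<^sub>0 else fst (s j) = \<beta> j))"

lemma Apos_P: "a \<in> Apos S \<Longrightarrow> a \<in> Apos P"
  using Apos_mono S(2) by blast

lemma valid_e0:
  assumes "valid s"
  shows "gen s e\<^sub>0 \<in> full S" "s e\<^sub>0 = (\<beta>\<^sub>0, \<beta>\<^sub>0 \<^bold>+ gen s e\<^sub>0)"
  using assms by (auto simp: valid_def gen_def)

lemma valid_K:
  assumes "valid s" "k \<in> K"
  obtains t where "t \<in> Apos S" "s k = (\<beta> k, \<beta>\<^sub>0 \<^bold>+ t)"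
proof -
  have "fst (s k) = \<beta> k" "snd (s k) \<in> up S \<beta>\<^sub>0" using assms by (auto simp: valid_def)
  moreover from this obtain t where "t \<in> Apos S" "snd (s k) = \<beta>\<^sub>0 \<^bold>+ t" unfolding up_def by blast
  ultimately show ?thesis using that[of t] by (simp add: prod_eq_iff)
qed

lemma valid_J:
  assumes "valid s" "j \<in> J"
  obtains d y where "d \<in> asub S" "y \<in> Apos S" "s j = (\<beta> (anc j) \<^bold>+ d, \<beta> (anc j) \<^bold>+ y)" "gen s j = y - d"
    "j \<in> Fl \<longrightarrow> d \<in> Apos S"
proof -
  have "snd (s j) \<in> up S (\<beta> (anc j))" using assms by (simp add: valid_def)
  then obtain y where y: "y \<in> Apos S" "snd (s j) = \<beta> (anc j) \<^bold>+ y" unfolding up_def by blast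
  obtain d where d: "d \<in> asub S" "fst (s j) = \<beta> (anc j) \<^bold>+ d" "j \<in> Fl \<longrightarrow> d \<in> Apos S"
  proof (cases "j \<in> Fl")
    case True
    then have "fst (s j) \<in> up S \<beta>\<^sub>0" "anc j = e\<^sub>0" using assms anc by (auto simp: valid_def)
    then obtain d where "d \<in> Apos S" "fst (s j) = \<beta>\<^sub>0 \<^bold>+ d" unfolding up_def by blast
    then show ?thesis using that[of d] \<open>anc j = e\<^sub>0\<close> by (simp add: Apos_asub)
  next
    case False
    then have "fst (s j) = \<beta> j" using assms by (auto simp: valid_def)
    moreover obtain d where "d \<in> asub S" "\<beta> j = \<beta> (anc j) \<^bold>+ d" using \<beta>_anc[of j] assms(2) False by blast
    ultimately show ?thesis using that[of d] False by simp
  qed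
  have "s j = (\<beta> (anc j) \<^bold>+ d, \<beta> (anc j) \<^bold>+ y)" using y d by (simp add: prod_eq_iff)
  then show ?thesis using that[of d y] y d by (simp add: gen_def)
qed

lemma valid_Fl:
  assumes "valid s" "f \<in> Fl"
  obtains x y where "x \<in> Apos S" "y \<in> Apos S" "s f = (\<beta>\<^sub>0 \<^bold>+ x, \<beta>\<^sub>0 \<^bold>+ y)" "gen s f = y - x"
proof -
  obtain d y where "d \<in> asub S" "y \<in> Apos S" "s f = (\<beta> (anc f) \<^bold>+ d, \<beta> (anc f) \<^bold>+ y)" "gen s f = y - d"
    "f \<in> Fl \<longrightarrow> d \<in> Apos S" using valid_J[OF assms(1), of f] assms(2) Fl by blast
  then show ?thesis using that[of d y] anc(2)[OF assms(2)] assms(2) by simp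
qed

lemma gen_asub: "valid s \<Longrightarrow> i \<in> I \<Longrightarrow> gen s i \<in> asub S"
  using Apos_asub[OF full_Apos[OF valid_e0(1)]] valid_J[of s i] by (metis Apos_asub asub_diff insertE)

lemma zspan_gen_asub: "valid s \<Longrightarrow> A \<subseteq> I \<Longrightarrow> v \<in> zspan (gen s ` A) \<Longrightarrow> v \<in> asub S"
  using gen_asub by (intro zspan_asub[of v "gen s ` A"]) auto

lemma iconj_raise_nat:
  assumes "valid s" "e\<^sub>0 \<in> D" "z \<in> Apos S"
  shows "iconj P D s (\<beta>\<^sub>0 \<^bold>+ z) (\<beta>\<^sub>0 \<^bold>+ (z + zmult (int n) (gen s e\<^sub>0)))"
proof (induction n)
  case (Suc n)
  let ?a = "z + zmult (int n) (gen s e\<^sub>0)"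
  have "?a \<in> Apos P"
    using assms(3) full_Apos[OF valid_e0(1)[OF assms(1)]] by (intro Apos_P Apos_add zmult_Apos) auto
  from iconj_edge[OF assms(2) this, of s]
  have "iconj P D s (\<beta>\<^sub>0 \<^bold>+ ?a) (\<beta>\<^sub>0 \<^bold>+ (gen s e\<^sub>0 + ?a))"
    by (simp add: valid_e0(2)[OF assms(1)])
  also have "gen s e\<^sub>0 + ?a = z + zmult (int (Suc n)) (gen s e\<^sub>0)"
    using zmult_succ[of "int n" "gen s e\<^sub>0"] by (simp add: ac_simps)
  finally show ?case by (rule rtranclp_trans[OF Suc])
qed simp

text \<open>Asking for all positions \<open>z\<close> at once makes this a group, although a
  particular translation is visible only high above the base point; thus it contains the span of any
  translations in it.\<close>

definition transl :: "'i set \<Rightarrow> ('i \<Rightarrow> 'v point \<times> 'v point) \<Rightarrow> avec set" where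
  "transl D s = {v \<in> asub S. \<forall>z\<in>Apos S. z + v \<in> Apos S \<longrightarrow> iconj P D s (\<beta>\<^sub>0 \<^bold>+ z) (\<beta>\<^sub>0 \<^bold>+ (z + v))}"

lemma translD:
  "\<lbrakk>v \<in> transl D s; z \<in> Apos S; z + v \<in> Apos S\<rbrakk> \<Longrightarrow> iconj P D s (\<beta>\<^sub>0 \<^bold>+ z) (\<beta>\<^sub>0 \<^bold>+ (z + v))"
  unfolding transl_def by blast

text \<open>Climb along the loop \<open>e\<^sub>0\<close>, translate high up, and descend
  again.\<close>

lemma translI:
  assumes "valid s" "e\<^sub>0 \<in> D" "v \<in> asub S"
    and high: "\<And>z. z \<in> Apos S \<Longrightarrow> \<exists>N::nat. \<forall>n\<ge>int N. z + v + zmult n (gen s e\<^sub>0) \<in> Apos S \<longrightarrow>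
      iconj P D s (\<beta>\<^sub>0 \<^bold>+ (z + zmult n (gen s e\<^sub>0))) (\<beta>\<^sub>0 \<^bold>+ (z + v + zmult n (gen s e\<^sub>0)))"
  shows "v \<in> transl D s"
  unfolding transl_def
proof (intro CollectI conjI ballI impI assms(3))
  fix z assume z: "z \<in> Apos S" "z + v \<in> Apos S"
  let ?w = "gen s e\<^sub>0"
  have w: "?w \<in> full S" using valid_e0 assms(1) by blast
  obtain N where N: "\<forall>n\<ge>int N. z + v + zmult n ?w \<in> Apos S \<longrightarrow>
      iconj P D s (\<beta>\<^sub>0 \<^bold>+ (z + zmult n ?w)) (\<beta>\<^sub>0 \<^bold>+ (z + v + zmult n ?w))" using high[OF z(1)] by blast
  have up: "zmult (int N) ?w \<in> Apos S" by (rule zmult_Apos) (use w full_Apos in auto)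
  have 1: "iconj P D s (\<beta>\<^sub>0 \<^bold>+ z) (\<beta>\<^sub>0 \<^bold>+ (z + zmult (int N) ?w))"
    by (rule iconj_raise_nat[OF assms(1,2) z(1)])
  have 2: "iconj P D s (\<beta>\<^sub>0 \<^bold>+ (z + v)) (\<beta>\<^sub>0 \<^bold>+ (z + v + zmult (int N) ?w))"
    by (rule iconj_raise_nat[OF assms(1,2) z(2)])
  have 3: "iconj P D s (\<beta>\<^sub>0 \<^bold>+ (z + zmult (int N) ?w)) (\<beta>\<^sub>0 \<^bold>+ (z + v + zmult (int N) ?w))"
    using N Apos_add[OF z(2) up] by blast
  show "iconj P D s (\<beta>\<^sub>0 \<^bold>+ z) (\<beta>\<^sub>0 \<^bold>+ (z + v))"
    by (rule rtranclp_trans[OF rtranclp_trans[OF 1 3] iconj_sym[OF 2]])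
qed

text \<open>The intermediate point \<open>z + v\<close> may leave the cone; raised by enough copies
  of the loop it does not.\<close>

lemma transl_add:
  assumes "valid s" "e\<^sub>0 \<in> D" "v \<in> transl D s" "v' \<in> transl D s"
  shows "v + v' \<in> transl D s"
proof (rule translI[OF assms(1,2)])
  have v: "v \<in> asub S" "v' \<in> asub S" using assms by (auto simp: transl_def)
  then show "v + v' \<in> asub S" by (rule asub_add)
  fix z assume z: "z \<in> Apos S"
  let ?w = "gen s e\<^sub>0"
  have w: "?w \<in> full S" using valid_e0 assms(1) by blast
  obtain N where N: "\<And>n. int N \<le> n \<Longrightarrow> z + v + zmult n ?w \<in> Apos S"
    using raise_Apos[OF S(1) w asub_add[OF Apos_asub[OF z] v(1)]] by blast
  have "iconj P D s (\<beta>\<^sub>0 \<^bold>+ (z + zmult n ?w)) (\<beta>\<^sub>0 \<^bold>+ (z + (v + v') + zmult n ?w))"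
    if n: "int N \<le> n" "z + (v + v') + zmult n ?w \<in> Apos S" for n
  proof -
    have zn: "z + zmult n ?w \<in> Apos S"
      using z n(1) w full_Apos by (intro Apos_add zmult_Apos) auto
    have "z + zmult n ?w + v = z + v + zmult n ?w"
      "z + v + zmult n ?w + v' = z + (v + v') + zmult n ?w" by (simp_all add: ac_simps)
    moreover have "iconj P D s (\<beta>\<^sub>0 \<^bold>+ (z + zmult n ?w)) (\<beta>\<^sub>0 \<^bold>+ (z + zmult n ?w + v))"
      by (rule translD[OF assms(3) zn]) (simp only: calculation N[OF n(1)])
    moreover have "iconj P D s (\<beta>\<^sub>0 \<^bold>+ (z + v + zmult n ?w)) (\<beta>\<^sub>0 \<^bold>+ (z + v + zmult n ?w + v'))"
      by (rule translD[OF assms(4) N[OF n(1)]]) (simp only: calculation n(2))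
    ultimately show ?thesis by (simp only: rtranclp_trans)
  qed
  then show "\<exists>N::nat. \<forall>n\<ge>int N. z + (v + v') + zmult n ?w \<in> Apos S \<longrightarrow>
      iconj P D s (\<beta>\<^sub>0 \<^bold>+ (z + zmult n ?w)) (\<beta>\<^sub>0 \<^bold>+ (z + (v + v') + zmult n ?w))" by blast
qed

lemma transl_uminus:
  assumes "v \<in> transl D s"
  shows "- v \<in> transl D s"
  unfolding transl_def
proof (intro CollectI conjI ballI impI)
  show "- v \<in> asub S" using assms asub_uminus by (simp add: transl_def)
  fix z assume z: "z \<in> Apos S" "z + - v \<in> Apos S"
  have "iconj P D s (\<beta>\<^sub>0 \<^bold>+ y) (\<beta>\<^sub>0 \<^bold>+ (y + v))" if "y \<in> Apos S" "y + v \<in> Apos S" for y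
    using assms that unfolding transl_def by blast
  from this[of "z + - v"] z have "iconj P D s (\<beta>\<^sub>0 \<^bold>+ (z + - v)) (\<beta>\<^sub>0 \<^bold>+ z)" by simp
  then show "iconj P D s (\<beta>\<^sub>0 \<^bold>+ z) (\<beta>\<^sub>0 \<^bold>+ (z + - v))" by (rule iconj_sym)
qed

lemma zspan_transl:
  assumes "valid s" "e\<^sub>0 \<in> D" "A \<subseteq> transl D s" "v \<in> zspan A"
  shows "v \<in> transl D s"
  using assms(4)
proof (induction v rule: zmod.span_induct_alt)
  case base
  show ?case by (simp add: transl_def)
next
  case (step c x y)
  have x: "x \<in> transl D s" "- x \<in> transl D s"
    using step(1) assms(3) transl_uminus by blast+
  have "zmult c x + y \<in> transl D s"
  proof (induction c rule: int_induct[where k = 0])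
    case base
    then show ?case using step by simp
  next
    case (step1 i)
    have "zmult (i + 1) x + y = (zmult i x + y) + x" using zmult_succ[of i x] by (simp add: algebra_simps)
    then show ?case using transl_add[OF assms(1,2) step1(2) x(1)] by (simp only:)
  next
    case (step2 i)
    have "zmult (i - 1) x + y = (zmult i x + y) + - x" using zmult_pred[of i x] by (simp add: algebra_simps)
    then show ?case using transl_add[OF assms(1,2) step2(2) x(2)] by (simp only:)
  qed
  then show ?case .
qed

lemma gen_e0_transl:
  assumes "valid s" "e\<^sub>0 \<in> D"
  shows "gen s e\<^sub>0 \<in> transl D s"
  using iconj_raise_nat[OF assms, of _ 1] Apos_asub[OF full_Apos[OF valid_e0(1)[OF assms(1)]]]
  by (auto simp: transl_def)

text \<open>If the loop \<open>j\<close> lies in another family, the path runs backwards along its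
  anchor into that family, once along \<open>j\<close>, and forward along the anchor again; the
  three thresholds keep the shifts of these three steps nonnegative.\<close>

lemma gen_transl:
  assumes "valid s" "e\<^sub>0 \<in> D" "j \<in> J" "j \<in> D" "anc j \<in> D"
  shows "gen s j \<in> transl D s"
proof (rule translI[OF assms(1,2)])
  show g: "gen s j \<in> asub S" using gen_asub assms by auto
  fix z assume z: "z \<in> Apos S"
  let ?w = "gen s e\<^sub>0" and ?g = "gen s j"
  have w: "?w \<in> full S" using valid_e0 assms(1) by blast
  obtain d y where dy: "d \<in> asub S" "s j = (\<beta> (anc j) \<^bold>+ d, \<beta> (anc j) \<^bold>+ y)" "?g = y - d"
    using valid_J[OF assms(1,3)] by metis
  show "\<exists>N::nat. \<forall>n\<ge>int N. z + ?g + zmult n ?w \<in> Apos S \<longrightarrow>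
      iconj P D s (\<beta>\<^sub>0 \<^bold>+ (z + zmult n ?w)) (\<beta>\<^sub>0 \<^bold>+ (z + ?g + zmult n ?w))"
  proof (cases "anc j = e\<^sub>0")
    case True
    obtain N where N: "\<And>n. int N \<le> n \<Longrightarrow> z - d + zmult n ?w \<in> Apos S"
      using raise_Apos[OF S(1) w asub_diff[OF Apos_asub[OF z] dy(1)]] by blast
    have "iconj P D s (\<beta>\<^sub>0 \<^bold>+ (z + zmult n ?w)) (\<beta>\<^sub>0 \<^bold>+ (z + ?g + zmult n ?w))" if "int N \<le> n" for n
      using iconj_edge[OF assms(4) Apos_P[OF N[OF that]], of s] unfolding dy(2,3) True
      by (simp add: algebra_simps)
    then show ?thesis by blast
  next
    case False
    then have k: "anc j \<in> K" using anc(1) assms(3) by auto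
    obtain t where t: "t \<in> Apos S" "s (anc j) = (\<beta> (anc j), \<beta>\<^sub>0 \<^bold>+ t)" using valid_K[OF assms(1) k] by blast
    have zt: "z - t \<in> asub S" using z t(1) by (intro asub_diff Apos_asub)
    obtain N1 where N1: "\<And>n. int N1 \<le> n \<Longrightarrow> z - t + zmult n ?w \<in> Apos S"
      using raise_Apos[OF S(1) w zt] by blast
    obtain N2 where N2: "\<And>n. int N2 \<le> n \<Longrightarrow> z - t - d + zmult n ?w \<in> Apos S"
      using raise_Apos[OF S(1) w asub_diff[OF zt dy(1)]] by blast
    obtain N3 where N3: "\<And>n. int N3 \<le> n \<Longrightarrow> z - t + ?g + zmult n ?w \<in> Apos S"
      using raise_Apos[OF S(1) w asub_add[OF zt g]] by blast
    have "iconj P D s (\<beta>\<^sub>0 \<^bold>+ (z + zmult n ?w)) (\<beta>\<^sub>0 \<^bold>+ (z + ?g + zmult n ?w))"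
      if n: "int (N1 + N2 + N3) \<le> n" for n
    proof -
      have 1: "iconj P D s (\<beta> (anc j) \<^bold>+ (z - t + zmult n ?w)) (\<beta>\<^sub>0 \<^bold>+ (z + zmult n ?w))"
        using iconj_edge[OF assms(5) Apos_P[OF N1], of n s] n unfolding t(2) by (simp add: algebra_simps)
      have 2: "iconj P D s (\<beta> (anc j) \<^bold>+ (z - t + zmult n ?w)) (\<beta> (anc j) \<^bold>+ (z - t + ?g + zmult n ?w))"
        using iconj_edge[OF assms(4) Apos_P[OF N2], of n s] n unfolding dy(2,3) by (simp add: algebra_simps)
      have 3: "iconj P D s (\<beta> (anc j) \<^bold>+ (z - t + ?g + zmult n ?w)) (\<beta>\<^sub>0 \<^bold>+ (z + ?g + zmult n ?w))"
        using iconj_edge[OF assms(5) Apos_P[OF N3], of n s] n unfolding t(2) by (simp add: algebra_simps)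
      show ?thesis by (rule rtranclp_trans[OF rtranclp_trans[OF iconj_sym[OF 1] 2] 3])
    qed
    then show ?thesis by blast
  qed
qed

end

section \<open>Changing single endpoints, swapping and reversing floating edges\<close>

context config
begin

lemma valid_upd_J:
  "valid s \<Longrightarrow> j \<in> J \<Longrightarrow> q \<in> up S (\<beta> (anc j)) \<Longrightarrow> valid (s(j := (fst (s j), q)))"
  using e0 KJ unfolding valid_def by (auto simp del: up_shift)

lemma valid_upd_Fl:
  "valid s \<Longrightarrow> f \<in> Fl \<Longrightarrow> p \<in> up S \<beta>\<^sub>0 \<Longrightarrow> q \<in> up S \<beta>\<^sub>0 \<Longrightarrow> valid (s(f := (p, q)))"
  using e0 KJ Fl anc(2) unfolding valid_def by (auto simp del: up_shift)

lemma valid_upd_K: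
  "valid s \<Longrightarrow> k \<in> K \<Longrightarrow> q \<in> up S \<beta>\<^sub>0 \<Longrightarrow> valid (s(k := (\<beta> k, q)))"
  using e0 KJ unfolding valid_def by (auto simp del: up_shift)

lemma valid_upd_e0:
  "valid s \<Longrightarrow> w \<in> full S \<Longrightarrow> valid (s(e\<^sub>0 := (\<beta>\<^sub>0, \<beta>\<^sub>0 \<^bold>+ w)))"
  using e0 unfolding valid_def by (auto simp del: up_shift)

lemma gen_upd: "gen (s(d := (p, q))) i = (if i = d then snd q - snd p else gen s i)"
  by (simp add: gen_def)

text \<open>Without \<open>d\<close> the loops anchored at \<open>d\<close> are out of reach as
  well. For \<open>d\<close> in \<open>J\<close> there are none (\<open>gen_others\<close>), but for
  \<open>d\<close> in \<open>K\<close> this excludes the loops of its own family.\<close>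

lemma span_others_transl:
  assumes "valid s" "d \<in> K \<union> J" "v \<in> zspan (gen s ` insert e\<^sub>0 {j \<in> J - {d}. anc j \<noteq> d})"
  shows "v \<in> transl (Ed - {d}) s"
proof (rule zspan_transl[OF assms(1) _ _ assms(3)])
  show "e\<^sub>0 \<in> Ed - {d}" using assms(2) e0 by auto
  note e0D = this
  show "gen s ` insert e\<^sub>0 {j \<in> J - {d}. anc j \<noteq> d} \<subseteq> transl (Ed - {d}) s"
  proof (rule image_subsetI)
    fix i assume i: "i \<in> insert e\<^sub>0 {j \<in> J - {d}. anc j \<noteq> d}"
    show "gen s i \<in> transl (Ed - {d}) s"
    proof (cases "i = e\<^sub>0")
      case True
      then show ?thesis using gen_e0_transl[OF assms(1) e0D] by simp
    next
      case False
      then have iJ: "i \<in> J" "i \<in> Ed - {d}" "anc i \<noteq> d" using i by auto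
      then have "anc i \<in> Ed - {d}" using anc(1)[OF iJ(1)] by blast
      then show ?thesis by (rule gen_transl[OF assms(1) e0D iJ(1,2)])
    qed
  qed
qed

lemma gen_others: "d \<in> J \<Longrightarrow> {j \<in> J - {d}. anc j \<noteq> d} = J - {d}"
proof -
  assume d: "d \<in> J"
  have "anc j \<noteq> d" if "j \<in> J" for j using anc(1)[OF that] e0 KJ d by blast
  then show ?thesis by blast
qed

text \<open>Outside the family of \<open>e\<^sub>0\<close> the endpoint is carried along the anchor
  to that family, translated there and carried back.\<close>

lemma change_term:
  assumes s: "valid s" and j: "j \<in> J" and v: "v \<in> zspan (gen s ` insert e\<^sub>0 (J - {j}))"
    and q: "snd (s j) \<^bold>+ v \<in> up S (\<beta> (anc j))"
  shows "s \<leadsto> s(j := (fst (s j), snd (s j) \<^bold>+ v))"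
proof -
  let ?D = "Ed - {j}"
  have vT: "v \<in> transl ?D s" using span_others_transl[OF s, of j v] j v gen_others[OF j] by simp
  obtain y where y: "y \<in> Apos S" "snd (s j) = \<beta> (anc j) \<^bold>+ y" using valid_J[OF s j] by (metis snd_conv)
  have yv: "y + v \<in> Apos S" using q unfolding y(2) by simp
  have "iconj P ?D s (snd (s j)) (snd (s j) \<^bold>+ v)"
  proof (cases "anc j = e\<^sub>0")
    case True
    show ?thesis using translD[OF vT y(1) yv] unfolding y(2) True by simp
  next
    case False
    then have k: "anc j \<in> K" "anc j \<in> ?D" using anc(1)[OF j] j KJ by auto
    obtain t where t: "t \<in> Apos S" "s (anc j) = (\<beta> (anc j), \<beta>\<^sub>0 \<^bold>+ t)" using valid_K[OF s k(1)] by blast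
    have 1: "iconj P ?D s (\<beta> (anc j) \<^bold>+ y) (\<beta>\<^sub>0 \<^bold>+ (t + y))"
      using iconj_edge[OF k(2) Apos_P[OF y(1)], of s] unfolding t(2) by simp
    have 2: "iconj P ?D s (\<beta> (anc j) \<^bold>+ (y + v)) (\<beta>\<^sub>0 \<^bold>+ (t + (y + v)))"
      using iconj_edge[OF k(2) Apos_P[OF yv], of s] unfolding t(2) by simp
    have "t + y + v \<in> Apos S" using Apos_add[OF t(1) yv] by (simp add: add.assoc)
    from translD[OF vT Apos_add[OF t(1) y(1)] this]
    have 3: "iconj P ?D s (\<beta>\<^sub>0 \<^bold>+ (t + y)) (\<beta>\<^sub>0 \<^bold>+ (t + (y + v)))" by (simp add: add.assoc)
    show ?thesis using rtranclp_trans[OF rtranclp_trans[OF 1 3] iconj_sym[OF 2]] unfolding y(2) by simp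
  qed
  from iconj_slide_term[OF this, of Ed j "fst (s j)"] show ?thesis using j by simp
qed

lemma change_init:
  assumes s: "valid s" and f: "f \<in> Fl" and v: "v \<in> zspan (gen s ` insert e\<^sub>0 (J - {f}))"
    and q: "fst (s f) \<^bold>+ v \<in> up S \<beta>\<^sub>0"
  shows "s \<leadsto> s(f := (fst (s f) \<^bold>+ v, snd (s f)))"
proof -
  let ?D = "Ed - {f}"
  have j: "f \<in> J" using f Fl by blast
  have vT: "v \<in> transl ?D s" using span_others_transl[OF s, of f v] j v gen_others[OF j] by simp
  obtain x where x: "x \<in> Apos S" "fst (s f) = \<beta>\<^sub>0 \<^bold>+ x" using valid_Fl[OF s f] by (metis fst_conv)
  have "x + v \<in> Apos S" using q unfolding x(2) by simp
  from translD[OF vT x(1) this] have "iconj P ?D s (fst (s f)) (fst (s f) \<^bold>+ v)" unfolding x(2) by simp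
  from iconj_slide_init[OF this, of Ed f "snd (s f)"] show ?thesis using j by simp
qed

lemma change_K:
  assumes s: "valid s" and k: "k \<in> K" and v: "v \<in> zspan (gen s ` insert e\<^sub>0 {j \<in> J. anc j \<noteq> k})"
    and q: "snd (s k) \<^bold>+ v \<in> up S \<beta>\<^sub>0"
  shows "s \<leadsto> s(k := (\<beta> k, snd (s k) \<^bold>+ v))"
proof -
  let ?D = "Ed - {k}"
  have "J - {k} = J" using k KJ by auto
  then have vT: "v \<in> transl ?D s" using span_others_transl[OF s, of k v] k v by simp
  obtain t where t: "t \<in> Apos S" "s k = (\<beta> k, \<beta>\<^sub>0 \<^bold>+ t)" using valid_K[OF s k] by blast
  have "t + v \<in> Apos S" using q unfolding t(2) by simp
  from translD[OF vT t(1) this] have "iconj P ?D s (snd (s k)) (snd (s k) \<^bold>+ v)" unfolding t(2) by simp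
  from iconj_slide_term[OF this, of Ed k "\<beta> k"] show ?thesis using k fun_upd_triv[of s k] unfolding t(2)
    by simp
qed

lemma span_e0: "gen s e\<^sub>0 \<in> zspan (gen s ` insert e\<^sub>0 A)"
  by (rule zmod.span_base) blast

text \<open>The multiple \<open>n\<close> of the loop lifts the endpoint high enough; it is harmless
  because entries matter only modulo \<open>gen s e\<^sub>0\<close>.\<close>

lemma term_shift:
  assumes s: "valid s" and i: "i \<in> J" and v: "v \<in> zspan (gen s ` insert e\<^sub>0 (J - {i}))"
  shows "\<exists>n s'. s \<leadsto> s' \<and> valid s' \<and> s' = s(i := (fst (s i), snd (s i) \<^bold>+ (v + zmult n (gen s e\<^sub>0)))) \<and>
    gen s' i = gen s i + v + zmult n (gen s e\<^sub>0)"
proof -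
  let ?w = "gen s e\<^sub>0"
  obtain y where y: "y \<in> Apos S" "snd (s i) = \<beta> (anc i) \<^bold>+ y" using valid_J[OF s i] by (metis snd_conv)
  have vS: "v \<in> asub S" using zspan_gen_asub[OF s _ v] i by blast
  obtain N where "\<And>n. int N \<le> n \<Longrightarrow> y + v + zmult n ?w \<in> Apos S"
    using raise_Apos[OF S(1) valid_e0(1)[OF s] asub_add[OF Apos_asub[OF y(1)] vS]] by blast
  then have up: "y + v + zmult (int N) ?w \<in> Apos S" by blast
  define u where "u = v + zmult (int N) ?w"
  have u: "u \<in> zspan (gen s ` insert e\<^sub>0 (J - {i}))"
    unfolding u_def by (intro zmod.span_add v zmod.span_scale span_e0)
  have q: "snd (s i) \<^bold>+ u \<in> up S (\<beta> (anc i))" using up unfolding y(2) u_def by (simp add: add.assoc)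
  show ?thesis
    using change_term[OF s i u q] valid_upd_J[OF s i q]
    by (intro exI[of _ "int N"] exI[of _ "s(i := (fst (s i), snd (s i) \<^bold>+ u))"])
      (simp add: u_def gen_upd, simp add: gen_def)
qed

text \<open>The two ends are slid separately, with independent multiples of the loop. Sliding the
  first end leaves the translations of the other edges unchanged, so the same span is available for
  the second one.\<close>

lemma floating_shift:
  assumes s: "valid s" and f: "f \<in> Fl" and v: "v \<in> zspan (gen s ` insert e\<^sub>0 (J - {f}))"
    and x: "fst (s f) \<^bold>+ (v + zmult n (gen s e\<^sub>0)) \<in> up S \<beta>\<^sub>0"
    and y: "snd (s f) \<^bold>+ (v + zmult m (gen s e\<^sub>0)) \<in> up S \<beta>\<^sub>0"
  shows "s \<leadsto> s(f := (fst (s f) \<^bold>+ (v + zmult n (gen s e\<^sub>0)), snd (s f) \<^bold>+ (v + zmult m (gen s e\<^sub>0))))"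
proof -
  let ?w = "gen s e\<^sub>0"
  have j: "f \<in> J" "f \<noteq> e\<^sub>0" using f Fl e0 by auto
  have span: "v + zmult n ?w \<in> zspan (gen s ` insert e\<^sub>0 (J - {f}))" for n
    by (intro zmod.span_add v zmod.span_scale span_e0)
  define s1 where "s1 = s(f := (fst (s f) \<^bold>+ (v + zmult n ?w), snd (s f)))"
  have 1: "s \<leadsto> s1" unfolding s1_def by (rule change_init[OF s f span x])
  have "snd (s f) \<in> up S (\<beta> (anc f))" using s j(1) unfolding valid_def by blast
  then have sf: "snd (s f) \<in> up S \<beta>\<^sub>0" unfolding anc(2)[OF f] .
  have v1: "valid s1" unfolding s1_def by (rule valid_upd_Fl[OF s f x sf])
  have img: "gen s1 ` insert e\<^sub>0 (J - {f}) = gen s ` insert e\<^sub>0 (J - {f})"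
    by (rule image_cong) (use j in \<open>auto simp: s1_def gen_upd\<close>)
  have ss: "snd (s1 f) = snd (s f)" by (simp add: s1_def)
  have "s1 \<leadsto> s1(f := (fst (s1 f), snd (s1 f) \<^bold>+ (v + zmult m ?w)))"
    by (rule change_term[OF v1 j(1)]) (simp_all only: img span ss anc(2)[OF f] y)
  then have "s1 \<leadsto> s(f := (fst (s f) \<^bold>+ (v + zmult n ?w), snd (s f) \<^bold>+ (v + zmult m ?w)))"
    by (simp only: s1_def fun_upd_same fun_upd_upd fst_conv snd_conv)
  with 1 show ?thesis by (rule rtranclp_trans)
qed

text \<open>Both loops have full support, hence suitable multiples of either one rise above the
  position of \<open>f\<close>, as a swap requires.\<close>

lemma swap_floating:
  assumes s: "valid s" and f: "f \<in> Fl" and g: "gen s f \<in> full S"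
  defines "s' \<equiv> s(e\<^sub>0 := (\<beta>\<^sub>0, \<beta>\<^sub>0 \<^bold>+ gen s f), f := (fst (s f), fst (s f) \<^bold>+ gen s e\<^sub>0))"
  shows "s \<leadsto> s'" "valid s'" "gen s' e\<^sub>0 = gen s f" "gen s' f = gen s e\<^sub>0"
proof -
  let ?w = "gen s e\<^sub>0" and ?g = "gen s f"
  have fe: "f \<noteq> e\<^sub>0" "f \<in> Ed" using f Fl e0 by auto
  have w: "?w \<in> full S" using valid_e0(1)[OF s] .
  obtain x y where x: "x \<in> Apos S" "s f = (\<beta>\<^sub>0 \<^bold>+ x, \<beta>\<^sub>0 \<^bold>+ y)" "?g = y - x" using valid_Fl[OF s f] by metis
  have sf: "s f = (\<beta>\<^sub>0 \<^bold>+ x, \<beta>\<^sub>0 \<^bold>+ x \<^bold>+ ?g)" unfolding x(2) x(3) by simp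
  have reach: "\<exists>k. point_le P (\<beta>\<^sub>0 \<^bold>+ x) (\<beta>\<^sub>0 \<^bold>+ nat_mult k u)" if u: "u \<in> full S" for u
  proof -
    obtain N where "\<And>n. int N \<le> n \<Longrightarrow> - x + zmult n u \<in> Apos S"
      using raise_Apos[OF S(1) u asub_uminus[OF Apos_asub[OF x(1)]]] by blast
    then have "- x + zmult (int N) u \<in> Apos P" using Apos_P by blast
    then have "point_le P (\<beta>\<^sub>0 \<^bold>+ x) (\<beta>\<^sub>0 \<^bold>+ nat_mult N u)"
      unfolding point_le_def nat_mult_zmult by (rule bexI[rotated]) simp
    then show ?thesis by blast
  qed
  obtain k1 where k1: "point_le P (\<beta>\<^sub>0 \<^bold>+ x) (\<beta>\<^sub>0 \<^bold>+ nat_mult k1 ?w)" using reach[OF w] by blast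
  obtain k2 where k2: "point_le P (\<beta>\<^sub>0 \<^bold>+ x) (\<beta>\<^sub>0 \<^bold>+ nat_mult k2 ?g)" using reach[OF g] by blast
  have le: "point_le P \<beta>\<^sub>0 (\<beta>\<^sub>0 \<^bold>+ x)" unfolding point_le_def using Apos_P[OF x(1)] by blast
  define s1 where "s1 = s(e\<^sub>0 := (\<beta>\<^sub>0 \<^bold>+ x, \<beta>\<^sub>0 \<^bold>+ x \<^bold>+ ?w), f := (\<beta>\<^sub>0, \<beta>\<^sub>0 \<^bold>+ ?g))"
  have "st P Ed s s1"
    by (rule st_swap[OF insertI1 fe(2) fe(1)[symmetric] valid_e0(2)[OF s] sf
          Apos_P[OF full_Apos[OF w]] Apos_P[OF full_Apos[OF g]] le k1 k2 s1_def])
  \<comment> \<open>The swap puts the edge labelled \<open>e\<^sub>0\<close> at the position of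
    \<open>f\<close>; exchanging the labels restores the convention that \<open>e\<^sub>0\<close>
    starts at the base point.\<close>
  moreover have "st P Ed s1 s'"
    by (rule st_exchange[of e\<^sub>0 _ f]) (use fe in \<open>auto simp: s1_def s'_def x(2) fun_eq_iff\<close>)
  ultimately show "s \<leadsto> s'" by (rule rtranclp_two[of "st P Ed"])
  have "valid (s(e\<^sub>0 := (\<beta>\<^sub>0, \<beta>\<^sub>0 \<^bold>+ ?g)))" by (rule valid_upd_e0[OF s g])
  from valid_upd_Fl[OF this f, of "fst (s f)" "fst (s f) \<^bold>+ ?w"]
  show "valid s'" unfolding s'_def using Apos_add[OF x(1) full_Apos[OF w]] x(1) by (simp add: x(2))
  show "gen s' e\<^sub>0 = ?g" "gen s' f = ?w" using fe by (simp_all add: s'_def gen_def)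
qed

lemma flip_floating:
  assumes s: "valid s" and f: "f \<in> Fl"
  shows "s \<leadsto> s(f := (snd (s f), fst (s f)))" "valid (s(f := (snd (s f), fst (s f))))"
    "gen (s(f := (snd (s f), fst (s f)))) f = - gen s f"
proof -
  have "st P Ed s (s(f := (snd (s f), fst (s f))))" by (rule st_flip[of f]) (use f Fl in auto)
  then show "s \<leadsto> s(f := (snd (s f), fst (s f)))" by (rule r_into_rtranclp[of "st P Ed"])
  obtain x y where "x \<in> Apos S" "y \<in> Apos S" "s f = (\<beta>\<^sub>0 \<^bold>+ x, \<beta>\<^sub>0 \<^bold>+ y)" using valid_Fl[OF s f] by metis
  then show "valid (s(f := (snd (s f), fst (s f))))" by (intro valid_upd_Fl[OF s f]) simp_all
qed (simp add: gen_def)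

text \<open>The first entry is matched exactly since it is the modulus; modulo it the other entries
  can be controlled without regard to heights.\<close>

definition approx :: "('i \<Rightarrow> avec) \<Rightarrow> ('i \<Rightarrow> 'v point \<times> 'v point) \<Rightarrow> bool" where
  "approx g s \<longleftrightarrow> gen s e\<^sub>0 = g e\<^sub>0 \<and> (\<forall>j\<in>J. \<exists>n. gen s j = g j + zmult n (g e\<^sub>0))"

text \<open>A tuple does not record positions. This relation bounds the side effects of operations
  on tuples, so that the matching of endpoints modulo the span \<open>W\<close> survives
  them.\<close>

definition drift :: "avec set \<Rightarrow> ('i \<Rightarrow> 'v point \<times> 'v point) \<Rightarrow> ('i \<Rightarrow> 'v point \<times> 'v point) \<Rightarrow> bool" where
  "drift W s s' \<longleftrightarrow> (\<forall>k\<in>K. s' k = s k) \<and> (\<forall>f\<in>Fl. snd (fst (s' f)) - snd (fst (s f)) \<in> W)"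

text \<open>A swap replaces the modulus \<open>g e\<^sub>0\<close> by \<open>g f\<close>. In
  preparation, the entries in \<open>A\<close>, known up to multiples of the former, are changed one
  by one into entries known up to multiples of the latter.\<close>

lemma normalize_modulo:
  assumes s: "valid s" and g: "approx g s" and f: "f \<in> Fl" "g f \<in> full S" and A: "finite A" "A \<subseteq> J - {f}"
  shows "\<exists>s'. s \<leadsto> s' \<and> valid s' \<and> gen s' e\<^sub>0 = g e\<^sub>0 \<and> gen s' f = gen s f \<and>
    (\<forall>j\<in>A. \<exists>n. gen s' j = g j + zmult n (g f)) \<and> (\<forall>j\<in>J - A. \<exists>n. gen s' j = g j + zmult n (g e\<^sub>0)) \<and>
    (\<forall>k\<in>K. s' k = s k) \<and> (\<forall>j\<in>J. fst (s' j) = fst (s j))"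
  using A
proof (induction A rule: finite_induct)
  case empty
  then show ?case using s g by (intro exI[of _ s]) (simp add: approx_def)
next
  case (insert a A)
  then obtain s1 where s1: "s \<leadsto> s1" "valid s1" "gen s1 e\<^sub>0 = g e\<^sub>0" "gen s1 f = gen s f"
    "\<forall>j\<in>A. \<exists>n. gen s1 j = g j + zmult n (g f)" "\<forall>j\<in>J - A. \<exists>n. gen s1 j = g j + zmult n (g e\<^sub>0)"
    "\<forall>k\<in>K. s1 k = s k" "\<forall>j\<in>J. fst (s1 j) = fst (s j)" by blast
  have a: "a \<in> J" "a \<noteq> f" "a \<noteq> e\<^sub>0" "a \<notin> K" using insert.prems e0 KJ by auto
  have fJ: "f \<in> J" using f Fl by blast
  obtain n where n: "gen s1 a = g a + zmult n (g e\<^sub>0)" using s1(6) a insert.hyps by blast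
  obtain n0 where n0: "gen s1 f = g f + zmult n0 (g e\<^sub>0)" using g fJ s1(4) by (auto simp: approx_def)
  obtain y where y: "y \<in> Apos S" "snd (s1 a) = \<beta> (anc a) \<^bold>+ y" using valid_J[OF s1(2) a(1)] by (metis snd_conv)
  have w: "g e\<^sub>0 \<in> full S" using valid_e0(1)[OF s1(2)] s1(3) by simp
  have "y - zmult n (g e\<^sub>0) \<in> asub S"
    by (rule asub_diff[OF Apos_asub[OF y(1)] zmult_asub[OF Apos_asub[OF full_Apos[OF w]]]])
  then obtain N where "\<And>m. int N \<le> m \<Longrightarrow> y - zmult n (g e\<^sub>0) + zmult m (g f) \<in> Apos S"
    using raise_Apos[OF S(1) f(2)] by blast
  then have N: "y - zmult n (g e\<^sub>0) + zmult (int N) (g f) \<in> Apos S" by blast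
  \<comment> \<open>Remove the multiple of the old modulus and add enough copies of the new one to
    keep the endpoint above its reference point.\<close>
  define v where "v = zmult (int N) (g f) - zmult n (g e\<^sub>0)"
  have gf: "g f = gen s1 f - zmult n0 (gen s1 e\<^sub>0)" unfolding n0 s1(3) by simp
  have mem: "gen s1 f \<in> zspan (gen s1 ` insert e\<^sub>0 (J - {a}))" using a fJ by (intro zmod.span_base) blast
  have v: "v \<in> zspan (gen s1 ` insert e\<^sub>0 (J - {a}))"
    unfolding v_def gf s1(3)[symmetric] by (intro zmod.span_diff zmod.span_scale span_e0 mem)
  have q: "snd (s1 a) \<^bold>+ v \<in> up S (\<beta> (anc a))" using N unfolding y(2) v_def by (simp add: algebra_simps)
  define s2 where "s2 = s1(a := (fst (s1 a), snd (s1 a) \<^bold>+ v))"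
  have 2: "s1 \<leadsto> s2" "valid s2" unfolding s2_def
    by (rule change_term[OF s1(2) a(1) v q]) (rule valid_upd_J[OF s1(2) a(1) q])
  have other: "gen s2 d = gen s1 d" if "d \<noteq> a" for d using that by (simp add: s2_def gen_upd)
  have "gen s2 a = gen s1 a + v" by (simp add: s2_def gen_def)
  then have ga: "gen s2 a = g a + zmult (int N) (g f)" unfolding n v_def by simp
  show ?case
  proof (intro exI[of _ s2] conjI ballI)
    show "s \<leadsto> s2" by (rule rtranclp_trans[OF s1(1) 2(1)])
    show "valid s2" by (rule 2(2))
    show "gen s2 e\<^sub>0 = g e\<^sub>0" "gen s2 f = gen s f" using other a s1(3,4) by auto
    show "\<exists>n. gen s2 j = g j + zmult n (g f)" if "j \<in> insert a A" for j
      using that ga other[of j] s1(5) by (cases "j = a") auto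
    show "\<exists>n. gen s2 j = g j + zmult n (g e\<^sub>0)" if "j \<in> J - insert a A" for j
      using that other[of j] s1(6) by auto
    show "s2 k = s k" if "k \<in> K" for k using that s1(7) a by (auto simp: s2_def)
    show "fst (s2 j) = fst (s j)" if "j \<in> J" for j using that s1(8) by (auto simp: s2_def)
  qed
qed

end

section \<open>Realizing operations on tuples by moves\<close>

context config
begin

lemma approx_span:
  assumes "approx g s" "i \<in> I"
  shows "gen s i \<in> zspan (g ` I)"
proof (cases "i = e\<^sub>0")
  case True
  then show ?thesis using assms(1) by (auto simp: approx_def intro: zmod.span_base)
next
  case False
  then obtain n where "gen s i = g i + zmult n (g e\<^sub>0)" using assms by (auto simp: approx_def)
  moreover have "g i \<in> zspan (g ` I)" "g e\<^sub>0 \<in> zspan (g ` I)" using assms(2) by (auto intro: zmod.span_base)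
  ultimately show ?thesis by (simp add: zmod.span_add zmod.span_scale)
qed

lemma approx_upd:
  assumes "approx g s" "gen s' e\<^sub>0 = gen s e\<^sub>0" "\<And>j. j \<in> J \<Longrightarrow> j \<noteq> i \<Longrightarrow> gen s' j = gen s j"
    "gen s' i = v + zmult n (g e\<^sub>0)" "i \<in> J"
  shows "approx (g(i := v)) s'"
  unfolding approx_def
proof (intro conjI ballI)
  have i: "i \<noteq> e\<^sub>0" using assms(5) e0 by auto
  then show "gen s' e\<^sub>0 = (g(i := v)) e\<^sub>0" using assms(1,2) by (auto simp: approx_def)
  fix j assume j: "j \<in> J"
  show "\<exists>n. gen s' j = (g(i := v)) j + zmult n ((g(i := v)) e\<^sub>0)"
  proof (cases "j = i")
    case True
    then show ?thesis using assms(4) i by auto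
  next
    case False
    obtain m where "gen s j = g j + zmult m (g e\<^sub>0)" using assms(1) j by (auto simp: approx_def)
    then have "gen s' j = (g(i := v)) j + zmult m ((g(i := v)) e\<^sub>0)" using assms(3)[OF j False] False i by simp
    then show ?thesis by blast
  qed
qed

lemma drift_trans:
  assumes "drift (zspan A) s s'" "drift (zspan A) s' s''"
  shows "drift (zspan A) s s''"
proof -
  have "snd (fst (s'' f)) - snd (fst (s f)) \<in> zspan A" if "f \<in> Fl" for f
  proof -
    have "snd (fst (s'' f)) - snd (fst (s' f)) + (snd (fst (s' f)) - snd (fst (s f))) \<in> zspan A"
      using assms that unfolding drift_def by (intro zmod.span_add) blast+
    then show ?thesis by simp
  qed
  then show ?thesis using assms unfolding drift_def by simp
qed

lemma drift_same:
  assumes "\<And>k. k \<in> K \<Longrightarrow> s' k = s k" "\<And>f. f \<in> Fl \<Longrightarrow> fst (s' f) = fst (s f)"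
  shows "drift (zspan A) s s'"
  unfolding drift_def by (simp add: assms zmod.span_zero)

lemma realize_shift:
  assumes s: "valid s" and g: "approx g s" and i: "i \<in> J" and v: "v \<in> zspan (gen s ` insert e\<^sub>0 (J - {i}))"
    and h: "gen s i + v = h + zmult n (g e\<^sub>0)"
  shows "\<exists>s'. s \<leadsto> s' \<and> valid s' \<and> approx (g(i := h)) s' \<and> drift (zspan A) s s'"
proof -
  obtain m s' where s': "s \<leadsto> s'" "valid s'" "s' = s(i := (fst (s i), snd (s i) \<^bold>+ (v + zmult m (gen s e\<^sub>0))))"
    "gen s' i = gen s i + v + zmult m (gen s e\<^sub>0)" using term_shift[OF s i v] by blast
  have "i \<noteq> e\<^sub>0" using i e0 by auto
  have we: "gen s e\<^sub>0 = g e\<^sub>0" using g by (simp add: approx_def)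
  have "gen s' i = h + zmult (n + m) (g e\<^sub>0)" unfolding s'(4) h we by (simp add: zmod.scale_left_distrib add.assoc)
  moreover have "gen s' d = gen s d" if "d \<noteq> i" for d using that unfolding s'(3) gen_upd by simp
  ultimately have "approx (g(i := h)) s'"
    using approx_upd[OF g, of s' i h "n + m"] i \<open>i \<noteq> e\<^sub>0\<close> by simp
  moreover have "drift (zspan A) s s'"
    by (rule drift_same) (use s'(3) i KJ Fl in auto)
  ultimately show ?thesis using s'(1,2) by blast
qed

text \<open>After the other entries have been renormalized to the coming modulus \<open>g f\<close>,
  entry \<open>f\<close>, so far only congruent to \<open>g f\<close>, is made equal to it; this
  gives a positive loop that can be swapped with \<open>e\<^sub>0\<close>.\<close>

lemma realize_swap:
  assumes s: "valid s" and g: "approx g s" and f: "f \<in> Fl" "g f \<in> full S"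
  shows "\<exists>s'. s \<leadsto> s' \<and> valid s' \<and> approx (g(e\<^sub>0 := g f, f := g e\<^sub>0)) s' \<and> drift (zspan A) s s'"
proof -
  have fJ: "f \<in> J" "f \<noteq> e\<^sub>0" "f \<notin> K" using f Fl e0 KJ by auto
  obtain s1 where s1: "s \<leadsto> s1" "valid s1" "gen s1 e\<^sub>0 = g e\<^sub>0" "gen s1 f = gen s f"
    "\<And>j. j \<in> J - {f} \<Longrightarrow> \<exists>n. gen s1 j = g j + zmult n (g f)"
    "\<And>k. k \<in> K \<Longrightarrow> s1 k = s k" "\<And>j. j \<in> J \<Longrightarrow> fst (s1 j) = fst (s j)"
    using normalize_modulo[OF s g f, of "J - {f}"] fin(2) by auto
  obtain n where n: "gen s f = g f + zmult n (g e\<^sub>0)" using g fJ(1) by (auto simp: approx_def)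
  obtain x y where x: "x \<in> Apos S" "s1 f = (\<beta>\<^sub>0 \<^bold>+ x, \<beta>\<^sub>0 \<^bold>+ y)" "gen s1 f = y - x" using valid_Fl[OF s1(2) f(1)] by metis
  define v where "v = zmult (- n) (gen s1 e\<^sub>0)"
  have v: "v \<in> zspan (gen s1 ` insert e\<^sub>0 (J - {f}))" unfolding v_def by (intro zmod.span_scale span_e0)
  have "y + v = x + g f" using x(3) n unfolding v_def s1(3,4) by (simp add: algebra_simps)
  then have sf: "snd (s1 f) \<^bold>+ v = \<beta>\<^sub>0 \<^bold>+ (x + g f)" unfolding x(2) by simp
  then have q: "snd (s1 f) \<^bold>+ v \<in> up S (\<beta> (anc f))"
    unfolding anc(2)[OF f(1)] using Apos_add[OF x(1) full_Apos[OF f(2)]] by simp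
  define s2 where "s2 = s1(f := (fst (s1 f), snd (s1 f) \<^bold>+ v))"
  have 2: "s1 \<leadsto> s2" "valid s2" unfolding s2_def
    by (rule change_term[OF s1(2) fJ(1) v q]) (rule valid_upd_J[OF s1(2) fJ(1) q])
  have gf: "gen s2 f = g f" unfolding s2_def gen_upd sf unfolding x(2) by simp
  have g2: "gen s2 d = gen s1 d" if "d \<noteq> f" for d using that unfolding s2_def gen_upd by simp
  define s3 where "s3 = s2(e\<^sub>0 := (\<beta>\<^sub>0, \<beta>\<^sub>0 \<^bold>+ gen s2 f), f := (fst (s2 f), fst (s2 f) \<^bold>+ gen s2 e\<^sub>0))"
  have "gen s2 f \<in> full S" unfolding gf by (rule f(2))
  note 3 = swap_floating[OF 2(2) f(1) this, folded s3_def]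
  have g3: "gen s3 d = gen s2 d" if "d \<noteq> f" "d \<noteq> e\<^sub>0" for d
    using that unfolding s3_def by (simp add: gen_def)
  have "approx (g(e\<^sub>0 := g f, f := g e\<^sub>0)) s3"
    unfolding approx_def
  proof (intro conjI ballI)
    show "gen s3 e\<^sub>0 = (g(e\<^sub>0 := g f, f := g e\<^sub>0)) e\<^sub>0" using 3(3) gf fJ by simp
    fix j assume j: "j \<in> J"
    then have "j \<noteq> e\<^sub>0" using e0 by auto
    show "\<exists>n. gen s3 j = (g(e\<^sub>0 := g f, f := g e\<^sub>0)) j + zmult n ((g(e\<^sub>0 := g f, f := g e\<^sub>0)) e\<^sub>0)"
    proof (cases "j = f")
      case True
      have "gen s3 f = g e\<^sub>0 + zmult 0 (g f)" using 3(4) g2[of e\<^sub>0] s1(3) fJ by simp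
      then show ?thesis using True fJ by (intro exI[of _ 0]) simp
    next
      case False
      obtain m where "gen s1 j = g j + zmult m (g f)" using s1(5) j False by blast
      then have "gen s3 j = g j + zmult m (g f)" using g3[OF False \<open>j \<noteq> e\<^sub>0\<close>] g2[OF False] by simp
      then show ?thesis using False \<open>j \<noteq> e\<^sub>0\<close> fJ by (intro exI[of _ m]) simp
    qed
  qed
  moreover have "drift (zspan A) s s3"
  proof (rule drift_same)
    show "s3 k = s k" if "k \<in> K" for k
      using that s1(6)[OF that] fJ e0 by (auto simp: s3_def s2_def)
    show "fst (s3 h) = fst (s h)" if "h \<in> Fl" for h
    proof -
      have "h \<in> J" "h \<noteq> e\<^sub>0" using that Fl e0 by auto
      then show ?thesis using s1(7)[of h] by (cases "h = f") (simp_all add: s3_def s2_def)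
    qed
  qed
  moreover have "s \<leadsto> s3" by (rule rtranclp_trans[OF rtranclp_trans[OF s1(1) 2(1)] 3(1)])
  ultimately show ?thesis using 3(2) by blast
qed

text \<open>Raising and lowering by the first entry takes no move, since entries are recorded modulo
  it. Reversing \<open>f\<close> displaces its starting point by \<open>gen s f\<close>, which lies
  in the span.\<close>

lemma realize_step:
  assumes s: "valid s" and g: "approx g s" and f: "f \<in> Fl" and p: "pos (full S) e\<^sub>0 f J g h"
  shows "\<exists>s'. s \<leadsto> s' \<and> valid s' \<and> approx h s' \<and> drift (zspan (g ` I)) s s'"
  using p
proof cases
  case (pos_add i j)
  obtain n where n: "gen s i = g i + zmult n (g e\<^sub>0)" using g pos_add(1) by (auto simp: approx_def)
  obtain m where m: "gen s j = g j + zmult m (g e\<^sub>0)" using g pos_add(2) by (auto simp: approx_def)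
  have v: "gen s j \<in> zspan (gen s ` insert e\<^sub>0 (J - {i}))" using pos_add by (intro zmod.span_base) blast
  have "gen s i + gen s j = g i + g j + zmult (n + m) (g e\<^sub>0)"
    unfolding n m by (simp add: zmod.scale_left_distrib ac_simps)
  from realize_shift[OF s g pos_add(1) v this] show ?thesis unfolding pos_add(4) by blast
next
  case (pos_sub i j)
  obtain n where n: "gen s i = g i + zmult n (g e\<^sub>0)" using g pos_sub(1) by (auto simp: approx_def)
  obtain m where m: "gen s j = g j + zmult m (g e\<^sub>0)" using g pos_sub(2) by (auto simp: approx_def)
  have v: "- gen s j \<in> zspan (gen s ` insert e\<^sub>0 (J - {i}))"
    using pos_sub by (intro zmod.span_neg zmod.span_base) blast
  have "gen s i + - gen s j = g i - g j + zmult (n - m) (g e\<^sub>0)"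
    unfolding n m by (simp add: zmod.scale_left_diff_distrib algebra_simps)
  from realize_shift[OF s g pos_sub(1) v this] show ?thesis unfolding pos_sub(4) by blast
next
  case pos_neg
  have fJ: "f \<in> J" "f \<notin> K" using f Fl KJ by auto
  then have fe: "f \<noteq> e\<^sub>0" using e0 by auto
  obtain n where n: "gen s f = g f + zmult n (g e\<^sub>0)" using g fJ by (auto simp: approx_def)
  define s' where "s' = s(f := (snd (s f), fst (s f)))"
  note 1 = flip_floating[OF s f, folded s'_def]
  have g1: "gen s' d = gen s d" if "d \<noteq> f" for d using that unfolding s'_def gen_upd by simp
  have "approx h s'" unfolding pos_neg
    by (rule approx_upd[OF g g1 g1, of f _ "- n"]) (use fJ fe 1(3) n in auto)
  moreover have "drift (zspan (g ` I)) s s'"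
    unfolding drift_def
  proof (intro conjI ballI)
    show "s' k = s k" if "k \<in> K" for k using that fJ by (auto simp: s'_def)
    show "snd (fst (s' d)) - snd (fst (s d)) \<in> zspan (g ` I)" if "d \<in> Fl" for d
      using approx_span[OF g, of f] fJ by (cases "d = f") (simp_all add: s'_def gen_def zmod.span_zero)
  qed
  ultimately show ?thesis using 1(1,2) by blast
next
  case (pos_raise j)
  obtain n where "gen s j = g j + zmult n (g e\<^sub>0)" using g pos_raise(1) by (auto simp: approx_def)
  then have n: "gen s j = g j + g e\<^sub>0 + zmult (n - 1) (g e\<^sub>0)" by (simp add: zmult_pred)
  have "approx h s" unfolding pos_raise(2)
    by (rule approx_upd[OF g refl refl n pos_raise(1)])
  then show ?thesis using s drift_same[of s s] by blast
next
  case (pos_lower j)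
  obtain n where "gen s j = g j + zmult n (g e\<^sub>0)" using g pos_lower(1) by (auto simp: approx_def)
  then have n: "gen s j = g j - g e\<^sub>0 + zmult (n + 1) (g e\<^sub>0)" by (simp add: zmult_succ)
  have "approx h s" unfolding pos_lower(2)
    by (rule approx_upd[OF g refl refl n pos_lower(1)])
  then show ?thesis using s drift_same[of s s] by blast
next
  case pos_swap
  then show ?thesis using realize_swap[OF s g f pos_swap(2)] by blast
qed

lemma realize:
  assumes s: "valid s" and g: "approx g s" and f: "f \<in> Fl" and p: "(pos (full S) e\<^sub>0 f J)\<^sup>*\<^sup>* g h"
  shows "\<exists>s'. s \<leadsto> s' \<and> valid s' \<and> approx h s' \<and> drift (zspan (g ` I)) s s'"
  using p
proof (induction rule: rtranclp_induct)
  case base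
  then show ?case using s g drift_same[of s s] by blast
next
  case (step h k)
  then obtain s1 where s1: "s \<leadsto> s1" "valid s1" "approx h s1" "drift (zspan (g ` I)) s s1" by blast
  have "f \<in> J" using f Fl by blast
  then have sp: "zspan (h ` I) = zspan (g ` I)" using poss_span[OF step(1) _ e0(2)] by simp
  obtain s2 where s2: "s1 \<leadsto> s2" "valid s2" "approx k s2" "drift (zspan (h ` I)) s1 s2"
    using realize_step[OF s1(2,3) f step(2)] by blast
  then have "drift (zspan (g ` I)) s s2" using drift_trans[OF s1(4)] sp by simp
  then show ?case using rtranclp_trans[OF s1(1) s2(1)] s2(2,3) by blast
qed

text \<open>To move a floating loop along itself, exchange it with the loop at \<open>e\<^sub>0\<close>, slide along the latter,
  and exchange back.\<close>

lemma floating_shift_self: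
  assumes s: "valid s" and f: "f \<in> Fl"
    and p: "fst (s f) \<^bold>+ (gen s f + zmult n (gen s e\<^sub>0)) \<in> up S \<beta>\<^sub>0"
    and q: "snd (s f) \<^bold>+ (gen s f + zmult m (gen s e\<^sub>0)) \<in> up S \<beta>\<^sub>0"
  shows "s \<leadsto> s(f := (fst (s f) \<^bold>+ (gen s f + zmult n (gen s e\<^sub>0)), snd (s f) \<^bold>+ (gen s f + zmult m (gen s e\<^sub>0))))"
proof -
  let ?w = "gen s e\<^sub>0" and ?g = "gen s f"
  have fJ: "f \<in> J" "f \<noteq> e\<^sub>0" using f Fl e0 by auto
  have w: "?w \<in> full S" by (rule valid_e0(1)[OF s])
  obtain x y where x: "x \<in> Apos S" "y \<in> Apos S" "s f = (\<beta>\<^sub>0 \<^bold>+ x, \<beta>\<^sub>0 \<^bold>+ y)" "?g = y - x"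
    using valid_Fl[OF s f] by metis
  have g: "?g \<in> asub S" using gen_asub[OF s] fJ by simp
  \<comment> \<open>The translation is made full so that the swaps are admissible.\<close>
  obtain N where "\<And>n. int N \<le> n \<Longrightarrow> ?g + zmult n ?w \<in> full S" using raise_full[OF S(1) w g] by blast
  then have h: "?g + zmult (int N) ?w \<in> full S" by blast
  define h where "h = ?g + zmult (int N) ?w"
  have hA: "h \<in> Apos S" using full_Apos[OF h] by (simp add: h_def)
  define s1 where "s1 = s(f := (fst (s f), snd (s f) \<^bold>+ zmult (int N) ?w))"
  have yx: "y + zmult (int N) ?w = x + h" using x(4) by (simp add: h_def)
  have s1f: "s1 f = (\<beta>\<^sub>0 \<^bold>+ x, \<beta>\<^sub>0 \<^bold>+ (x + h))" unfolding s1_def using x(3) yx by simp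
  have q1: "snd (s f) \<^bold>+ zmult (int N) ?w \<in> up S (\<beta> (anc f))"
    unfolding anc(2)[OF f] x(3) using yx Apos_add[OF x(1) hA] by simp
  have 1: "s \<leadsto> s1" "valid s1" unfolding s1_def
    by (rule change_term[OF s fJ(1) _ q1], intro zmod.span_scale span_e0) (rule valid_upd_J[OF s fJ(1) q1])
  have g1: "gen s1 f = h" "gen s1 e\<^sub>0 = ?w" using fJ by (simp_all add: gen_def s1f) (simp add: s1_def)
  define s2 where "s2 = s1(e\<^sub>0 := (\<beta>\<^sub>0, \<beta>\<^sub>0 \<^bold>+ h), f := (\<beta>\<^sub>0 \<^bold>+ x, \<beta>\<^sub>0 \<^bold>+ (x + ?w)))"
  have s2': "s2 = s1(e\<^sub>0 := (\<beta>\<^sub>0, \<beta>\<^sub>0 \<^bold>+ gen s1 f), f := (fst (s1 f), fst (s1 f) \<^bold>+ gen s1 e\<^sub>0))"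
    unfolding s2_def g1 s1f by simp
  have "gen s1 f \<in> full S" unfolding g1 h_def by (rule h)
  note 2 = swap_floating[OF 1(2) f this, folded s2', unfolded g1]
  define s3 where "s3 = s2(f := (\<beta>\<^sub>0 \<^bold>+ (x + h), \<beta>\<^sub>0 \<^bold>+ (x + ?w + h)))"
  have s2f: "s2 f = (\<beta>\<^sub>0 \<^bold>+ x, \<beta>\<^sub>0 \<^bold>+ (x + ?w))" by (simp add: s2_def)
  have up3: "\<beta>\<^sub>0 \<^bold>+ (x + h) \<in> up S \<beta>\<^sub>0" "\<beta>\<^sub>0 \<^bold>+ (x + ?w + h) \<in> up S \<beta>\<^sub>0"
    using Apos_add[OF x(1) hA] Apos_add[OF Apos_add[OF x(1) full_Apos[OF w]] hA] by simp_all
  have 3: "s2 \<leadsto> s3" "valid s3" unfolding s3_def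
    using floating_shift[OF 2(2) f zmod.span_zero, of 1 1] up3 valid_upd_Fl[OF 2(2) f up3]
    unfolding s2f 2(3) by simp_all
  have g3: "gen s3 f = ?w" "gen s3 e\<^sub>0 = h"
    using 2(3) fJ by (simp_all add: s3_def gen_def)
  define s4 where "s4 = s3(e\<^sub>0 := (\<beta>\<^sub>0, \<beta>\<^sub>0 \<^bold>+ ?w), f := (\<beta>\<^sub>0 \<^bold>+ (x + h), \<beta>\<^sub>0 \<^bold>+ (x + h + h)))"
  have s4': "s4 = s3(e\<^sub>0 := (\<beta>\<^sub>0, \<beta>\<^sub>0 \<^bold>+ gen s3 f), f := (fst (s3 f), fst (s3 f) \<^bold>+ gen s3 e\<^sub>0))"
    unfolding s4_def g3 by (simp add: s3_def)
  have "gen s3 f \<in> full S" unfolding g3 by (rule w)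
  note 4 = swap_floating[OF 3(2) f this, folded s4', unfolded g3]
  have s4f: "s4 f = (\<beta>\<^sub>0 \<^bold>+ (x + h), \<beta>\<^sub>0 \<^bold>+ (x + h + h))" by (simp add: s4_def)
  have s4s: "s4(f := z) = s(f := z)" for z
  proof
    fix d show "(s4(f := z)) d = (s(f := z)) d"
      using valid_e0(2)[OF s] fJ by (cases "d = e\<^sub>0") (simp_all add: s4_def s3_def s2_def s1_def)
  qed
  \<comment> \<open>Since \<open>h\<close> contains \<open>N\<close> copies of the loop vector and
    the ends of \<open>s4 f\<close> are one and two copies of \<open>h\<close> above
    \<open>x\<close>, the corrections are \<open>N\<close> at the start and twice \<open>N\<close>
    at the end.\<close>
  have p5: "\<beta>\<^sub>0 \<^bold>+ (x + h) \<^bold>+ (0 + zmult (n - int N) ?w) = fst (s f) \<^bold>+ (?g + zmult n ?w)"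
    unfolding x(3) h_def by (simp add: zmod.scale_left_diff_distrib algebra_simps)
  have "x + h + h + (0 + zmult (m - int N - int N) ?w) = y + (?g + zmult m ?w)"
    unfolding h_def x(4) zmod.scale_left_diff_distrib by (simp add: algebra_simps)
  then have q5: "\<beta>\<^sub>0 \<^bold>+ (x + h + h) \<^bold>+ (0 + zmult (m - int N - int N) ?w) = snd (s f) \<^bold>+ (?g + zmult m ?w)"
    unfolding x(3) by simp
  have "s4 \<leadsto> s4(f := (\<beta>\<^sub>0 \<^bold>+ (x + h) \<^bold>+ (0 + zmult (n - int N) ?w), \<beta>\<^sub>0 \<^bold>+ (x + h + h) \<^bold>+ (0 + zmult (m - int N - int N) ?w)))"
    using floating_shift[OF 4(2) f zmod.span_zero, of "n - int N" "m - int N - int N"] p q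
    unfolding s4f 4(3) fst_conv snd_conv p5 q5 by blast
  then have 5: "s4 \<leadsto> s(f := (fst (s f) \<^bold>+ (?g + zmult n ?w), snd (s f) \<^bold>+ (?g + zmult m ?w)))"
    unfolding p5 q5 s4s .
  show ?thesis
    by (rule rtranclp_trans[OF rtranclp_trans[OF rtranclp_trans[OF rtranclp_trans[OF 1(1) 2(1)] 3(1)] 4(1)] 5])
qed

text \<open>Stated for all positions of \<open>f\<close> with the same translation modulo the loop,
  so that shifts can be composed: after one shift \<open>f\<close> is no longer where
  \<open>s\<close> has it.\<close>

definition shiftable :: "('i \<Rightarrow> 'v point \<times> 'v point) \<Rightarrow> 'i \<Rightarrow> avec \<Rightarrow> bool" where
  "shiftable s f v \<longleftrightarrow> v \<in> asub S \<and> (\<forall>x y c n m. x \<in> Apos S \<longrightarrow> y \<in> Apos S \<longrightarrow>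
     y - x = gen s f + zmult c (gen s e\<^sub>0) \<longrightarrow>
     x + (v + zmult n (gen s e\<^sub>0)) \<in> Apos S \<longrightarrow> y + (v + zmult m (gen s e\<^sub>0)) \<in> Apos S \<longrightarrow>
     s(f := (\<beta>\<^sub>0 \<^bold>+ x, \<beta>\<^sub>0 \<^bold>+ y)) \<leadsto>
     s(f := (\<beta>\<^sub>0 \<^bold>+ (x + (v + zmult n (gen s e\<^sub>0))), \<beta>\<^sub>0 \<^bold>+ (y + (v + zmult m (gen s e\<^sub>0))))))"

lemma shiftableD:
  assumes "shiftable s f v" "x \<in> Apos S" "y \<in> Apos S" "y - x = gen s f + zmult c (gen s e\<^sub>0)"
    "x + (v + zmult n (gen s e\<^sub>0)) \<in> Apos S" "y + (v + zmult m (gen s e\<^sub>0)) \<in> Apos S"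
  shows "s(f := (\<beta>\<^sub>0 \<^bold>+ x, \<beta>\<^sub>0 \<^bold>+ y)) \<leadsto>
     s(f := (\<beta>\<^sub>0 \<^bold>+ (x + (v + zmult n (gen s e\<^sub>0))), \<beta>\<^sub>0 \<^bold>+ (y + (v + zmult m (gen s e\<^sub>0)))))"
  using assms unfolding shiftable_def by blast

lemma shiftable_others:
  assumes s: "valid s" and f: "f \<in> Fl" and v: "v \<in> zspan (gen s ` insert e\<^sub>0 (J - {f}))"
  shows "shiftable s f v"
  unfolding shiftable_def
proof (intro conjI allI impI)
  have fJ: "f \<in> J" "f \<noteq> e\<^sub>0" using f Fl e0 by auto
  show "v \<in> asub S" by (rule zspan_gen_asub[OF s _ v]) auto
  fix x y c n m
  assume xy: "x \<in> Apos S" "y \<in> Apos S" "x + (v + zmult n (gen s e\<^sub>0)) \<in> Apos S" "y + (v + zmult m (gen s e\<^sub>0)) \<in> Apos S"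
  define t where "t = s(f := (\<beta>\<^sub>0 \<^bold>+ x, \<beta>\<^sub>0 \<^bold>+ y))"
  have t: "valid t" unfolding t_def by (rule valid_upd_Fl[OF s f]) (use xy in simp_all)
  have img: "gen t ` insert e\<^sub>0 (J - {f}) = gen s ` insert e\<^sub>0 (J - {f})"
    by (rule image_cong) (use fJ in \<open>auto simp: t_def gen_upd\<close>)
  have tf: "t f = (\<beta>\<^sub>0 \<^bold>+ x, \<beta>\<^sub>0 \<^bold>+ y)" "gen t e\<^sub>0 = gen s e\<^sub>0" using fJ by (simp_all add: t_def gen_upd)
  show "s(f := (\<beta>\<^sub>0 \<^bold>+ x, \<beta>\<^sub>0 \<^bold>+ y)) \<leadsto>
     s(f := (\<beta>\<^sub>0 \<^bold>+ (x + (v + zmult n (gen s e\<^sub>0))), \<beta>\<^sub>0 \<^bold>+ (y + (v + zmult m (gen s e\<^sub>0)))))"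
    using floating_shift[OF t f v[folded img], of n m] xy unfolding tf by (simp add: t_def)
qed

text \<open>Since \<open>v\<close> alone may leave the cone, both ends pass through a position
  raised by \<open>N\<close> copies of the loop.\<close>

lemma shiftable_add:
  assumes s: "valid s" and f: "f \<in> Fl" and v: "shiftable s f v" "shiftable s f v'"
  shows "shiftable s f (v + v')"
  unfolding shiftable_def
proof (intro conjI allI impI)
  have vS: "v \<in> asub S" "v' \<in> asub S" using v unfolding shiftable_def by blast+
  then show "v + v' \<in> asub S" by (rule asub_add)
  let ?w = "gen s e\<^sub>0"
  have w: "?w \<in> full S" by (rule valid_e0(1)[OF s])
  fix x y c n m
  assume xy: "x \<in> Apos S" "y \<in> Apos S" "y - x = gen s f + zmult c ?w"
    "x + (v + v' + zmult n ?w) \<in> Apos S" "y + (v + v' + zmult m ?w) \<in> Apos S"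
  obtain N1 where N1: "\<And>n. int N1 \<le> n \<Longrightarrow> x + v + zmult n ?w \<in> Apos S"
    using raise_Apos[OF S(1) w asub_add[OF Apos_asub[OF xy(1)] vS(1)]] by blast
  obtain N2 where N2: "\<And>n. int N2 \<le> n \<Longrightarrow> y + v + zmult n ?w \<in> Apos S"
    using raise_Apos[OF S(1) w asub_add[OF Apos_asub[OF xy(2)] vS(1)]] by blast
  define N where "N = int (N1 + N2)"
  have up: "x + (v + zmult N ?w) \<in> Apos S" "y + (v + zmult N ?w) \<in> Apos S"
    using N1[of N] N2[of N] by (simp_all add: N_def add.assoc)
  have 1: "s(f := (\<beta>\<^sub>0 \<^bold>+ x, \<beta>\<^sub>0 \<^bold>+ y)) \<leadsto>
      s(f := (\<beta>\<^sub>0 \<^bold>+ (x + (v + zmult N ?w)), \<beta>\<^sub>0 \<^bold>+ (y + (v + zmult N ?w))))"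
    by (rule shiftableD[OF v(1) xy(1-3) up])
  have e: "z + (v + zmult N ?w) + (v' + zmult (l - N) ?w) = z + (v + v' + zmult l ?w)" for z l
    by (simp add: zmod.scale_left_diff_distrib algebra_simps)
  have d: "y + (v + zmult N ?w) - (x + (v + zmult N ?w)) = gen s f + zmult c ?w" using xy(3) by simp
  have 2: "s(f := (\<beta>\<^sub>0 \<^bold>+ (x + (v + zmult N ?w)), \<beta>\<^sub>0 \<^bold>+ (y + (v + zmult N ?w)))) \<leadsto>
      s(f := (\<beta>\<^sub>0 \<^bold>+ (x + (v + v' + zmult n ?w)), \<beta>\<^sub>0 \<^bold>+ (y + (v + v' + zmult m ?w))))"
    using shiftableD[OF v(2) up d, of "n - N" "m - N"] xy(4,5) unfolding e by blast
  show "s(f := (\<beta>\<^sub>0 \<^bold>+ x, \<beta>\<^sub>0 \<^bold>+ y)) \<leadsto>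
      s(f := (\<beta>\<^sub>0 \<^bold>+ (x + (v + v' + zmult n ?w)), \<beta>\<^sub>0 \<^bold>+ (y + (v + v' + zmult m ?w))))"
    by (rule rtranclp_trans[OF 1 2])
qed

lemma shiftable_self:
  assumes s: "valid s" and f: "f \<in> Fl"
  shows "shiftable s f (gen s f)"
  unfolding shiftable_def
proof (intro conjI allI impI)
  have fJ: "f \<in> J" "f \<noteq> e\<^sub>0" using f Fl e0 by auto
  show "gen s f \<in> asub S" using gen_asub[OF s] fJ by simp
  let ?w = "gen s e\<^sub>0"
  fix x y c n m
  assume xy: "x \<in> Apos S" "y \<in> Apos S" "y - x = gen s f + zmult c ?w"
    "x + (gen s f + zmult n ?w) \<in> Apos S" "y + (gen s f + zmult m ?w) \<in> Apos S"
  define t where "t = s(f := (\<beta>\<^sub>0 \<^bold>+ x, \<beta>\<^sub>0 \<^bold>+ y))"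
  have t: "valid t" unfolding t_def by (rule valid_upd_Fl[OF s f]) (use xy in simp_all)
  have tf: "t f = (\<beta>\<^sub>0 \<^bold>+ x, \<beta>\<^sub>0 \<^bold>+ y)" "gen t e\<^sub>0 = ?w" using fJ by (simp_all add: t_def gen_upd)
  have gt: "gen t f = gen s f + zmult c ?w" unfolding xy(3)[symmetric] by (simp add: gen_def tf)
  have e: "z + (gen t f + zmult (l - c) ?w) = z + (gen s f + zmult l ?w)" for z l
    unfolding gt by (simp add: zmod.scale_left_diff_distrib algebra_simps)
  show "s(f := (\<beta>\<^sub>0 \<^bold>+ x, \<beta>\<^sub>0 \<^bold>+ y)) \<leadsto>
      s(f := (\<beta>\<^sub>0 \<^bold>+ (x + (gen s f + zmult n ?w)), \<beta>\<^sub>0 \<^bold>+ (y + (gen s f + zmult m ?w))))"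
    using floating_shift_self[OF t f, of "n - c" "m - c"] xy(4,5)
    unfolding tf fst_conv snd_conv shift_shift e by (simp add: t_def)
qed

text \<open>Reversing the edge turns its translation into the opposite one.\<close>

lemma shiftable_minus_self:
  assumes s: "valid s" and f: "f \<in> Fl"
  shows "shiftable s f (- gen s f)"
  unfolding shiftable_def
proof (intro conjI allI impI)
  have fJ: "f \<in> J" "f \<noteq> e\<^sub>0" using f Fl e0 by auto
  show "- gen s f \<in> asub S" using gen_asub[OF s, of f] fJ by (simp add: asub_uminus)
  let ?w = "gen s e\<^sub>0"
  fix x y c n m
  assume xy: "x \<in> Apos S" "y \<in> Apos S" "y - x = gen s f + zmult c ?w"
    "x + (- gen s f + zmult n ?w) \<in> Apos S" "y + (- gen s f + zmult m ?w) \<in> Apos S"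
  define t where "t = s(f := (\<beta>\<^sub>0 \<^bold>+ y, \<beta>\<^sub>0 \<^bold>+ x))"
  have t: "valid t" unfolding t_def by (rule valid_upd_Fl[OF s f]) (use xy in simp_all)
  have tf: "t f = (\<beta>\<^sub>0 \<^bold>+ y, \<beta>\<^sub>0 \<^bold>+ x)" "gen t e\<^sub>0 = ?w" using fJ by (simp_all add: t_def gen_upd)
  have "x - y = - (gen s f + zmult c ?w)" unfolding xy(3)[symmetric] by simp
  then have gt: "gen t f = - gen s f - zmult c ?w" by (simp add: gen_def tf)
  have e: "z + (gen t f + zmult (l + c) ?w) = z + (- gen s f + zmult l ?w)" for z l
    unfolding gt by (simp add: zmod.scale_left_distrib algebra_simps)
  let ?p = "\<beta>\<^sub>0 \<^bold>+ (x + (- gen s f + zmult n ?w))" and ?q = "\<beta>\<^sub>0 \<^bold>+ (y + (- gen s f + zmult m ?w))"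
  have 2: "t \<leadsto> s(f := (?q, ?p))"
    using floating_shift_self[OF t f, of "m + c" "n + c"] xy(4,5)
    unfolding tf fst_conv snd_conv shift_shift e by (simp add: t_def)
  have 1: "s(f := (\<beta>\<^sub>0 \<^bold>+ x, \<beta>\<^sub>0 \<^bold>+ y)) \<leadsto> t"
    by (rule r_into_rtranclp[of "st P Ed"], rule st_flip[of f]) (use fJ in \<open>simp_all add: t_def\<close>)
  have 3: "s(f := (?q, ?p)) \<leadsto> s(f := (?p, ?q))"
    by (rule r_into_rtranclp[of "st P Ed"], rule st_flip[of f]) (use fJ in simp_all)
  show "s(f := (\<beta>\<^sub>0 \<^bold>+ x, \<beta>\<^sub>0 \<^bold>+ y)) \<leadsto> s(f := (?p, ?q))"
    by (rule rtranclp_trans[OF rtranclp_trans[OF 1 2] 3])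
qed

lemma shiftable_span:
  assumes s: "valid s" and f: "f \<in> Fl" and v: "v \<in> zspan (gen s ` I)"
  shows "shiftable s f v"
proof -
  have fI: "f \<in> I" "I - {f} = insert e\<^sub>0 (J - {f})" using f Fl e0 by auto
  obtain c u where cu: "v = zmult c (gen s f) + u" "u \<in> zspan (gen s ` (I - {f}))"
    using zspan_split[OF fI(1) v] by blast
  have "shiftable s f (zmult c (gen s f))"
  proof (induction c rule: int_induct[where k = 0])
    case base
    show ?case using shiftable_others[OF s f zmod.span_zero] by simp
  next
    case (step1 i)
    show ?case unfolding zmult_succ by (rule shiftable_add[OF s f step1(2) shiftable_self[OF s f]])
  next
    case (step2 i)
    have "zmult (i - 1) (gen s f) = zmult i (gen s f) + - gen s f" by (simp add: zmult_pred)
    then show ?case using shiftable_add[OF s f step2(2) shiftable_minus_self[OF s f]] by simp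
  qed
  from shiftable_add[OF s f this shiftable_others[OF s f cu(2)[unfolded fI(2)]]]
  show ?thesis unfolding cu(1) .
qed

end

section \<open>Adjusting the edges of K and reaching the target\<close>

context config
begin

text \<open>The analogue of \<open>shiftable\<close> for the far end of an edge \<open>k\<close> in
  \<open>K\<close>.\<close>

definition connectable :: "('i \<Rightarrow> 'v point \<times> 'v point) \<Rightarrow> 'i \<Rightarrow> avec \<Rightarrow> bool" where
  "connectable s k v \<longleftrightarrow> v \<in> asub S \<and> (\<forall>t. t \<in> Apos S \<longrightarrow> t + v \<in> Apos S \<longrightarrow>
     s(k := (\<beta> k, \<beta>\<^sub>0 \<^bold>+ t)) \<leadsto> s(k := (\<beta> k, \<beta>\<^sub>0 \<^bold>+ (t + v))))"

lemma connectableD: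
  "\<lbrakk>connectable s k v; t \<in> Apos S; t + v \<in> Apos S\<rbrakk> \<Longrightarrow>
    s(k := (\<beta> k, \<beta>\<^sub>0 \<^bold>+ t)) \<leadsto> s(k := (\<beta> k, \<beta>\<^sub>0 \<^bold>+ (t + v)))"
  unfolding connectable_def by blast

lemma connectable_others:
  assumes s: "valid s" and k: "k \<in> K" and v: "v \<in> zspan (gen s ` insert e\<^sub>0 {j \<in> J. anc j \<noteq> k})"
  shows "connectable s k v"
  unfolding connectable_def
proof (intro conjI allI impI)
  show "v \<in> asub S" by (rule zspan_gen_asub[OF s _ v]) auto
  fix t assume t: "t \<in> Apos S" "t + v \<in> Apos S"
  define u where "u = s(k := (\<beta> k, \<beta>\<^sub>0 \<^bold>+ t))"
  have u: "valid u" unfolding u_def by (rule valid_upd_K[OF s k]) (use t in simp)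
  have img: "gen u ` insert e\<^sub>0 {j \<in> J. anc j \<noteq> k} = gen s ` insert e\<^sub>0 {j \<in> J. anc j \<noteq> k}"
    by (rule image_cong) (use k e0 KJ in \<open>auto simp: u_def gen_upd\<close>)
  have uk: "u k = (\<beta> k, \<beta>\<^sub>0 \<^bold>+ t)" by (simp add: u_def)
  show "s(k := (\<beta> k, \<beta>\<^sub>0 \<^bold>+ t)) \<leadsto> s(k := (\<beta> k, \<beta>\<^sub>0 \<^bold>+ (t + v)))"
    using change_K[OF u k v[folded img]] t(2) unfolding uk by (simp add: u_def)
qed

lemma connectable_add:
  assumes s: "valid s" and k: "k \<in> K" and v: "connectable s k v" "connectable s k v'"
  shows "connectable s k (v + v')"
  unfolding connectable_def
proof (intro conjI allI impI)
  have vS: "v \<in> asub S" "v' \<in> asub S" using v unfolding connectable_def by blast+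
  then show "v + v' \<in> asub S" by (rule asub_add)
  let ?w = "gen s e\<^sub>0"
  have w: "?w \<in> full S" by (rule valid_e0(1)[OF s])
  fix t assume t: "t \<in> Apos S" "t + (v + v') \<in> Apos S"
  obtain N where "\<And>n. int N \<le> n \<Longrightarrow> t + v + zmult n ?w \<in> Apos S"
    using raise_Apos[OF S(1) w asub_add[OF Apos_asub[OF t(1)] vS(1)]] by blast
  then have N: "t + v + zmult (int N) ?w \<in> Apos S" by blast
  define u where "u = zmult (int N) ?w"
  have u: "connectable s k u" "connectable s k (- u)" unfolding u_def
    by (rule connectable_others[OF s k], intro zmod.span_neg zmod.span_scale span_e0)+
  have up: "t + u \<in> Apos S" "t + u + v \<in> Apos S" "t + u + v + v' \<in> Apos S" "t + u + v + v' + - u = t + (v + v')"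
  proof -
    have uA: "u \<in> Apos S" unfolding u_def by (rule zmult_Apos) (use full_Apos[OF w] in auto)
    show "t + u \<in> Apos S" by (rule Apos_add[OF t(1) uA])
    show "t + u + v \<in> Apos S" using N by (simp add: u_def ac_simps)
    show "t + u + v + v' \<in> Apos S" using Apos_add[OF t(2) uA] by (simp add: ac_simps)
  qed (simp add: algebra_simps)
  have 1: "s(k := (\<beta> k, \<beta>\<^sub>0 \<^bold>+ t)) \<leadsto> s(k := (\<beta> k, \<beta>\<^sub>0 \<^bold>+ (t + u)))"
    by (rule connectableD[OF u(1) t(1) up(1)])
  have 2: "s(k := (\<beta> k, \<beta>\<^sub>0 \<^bold>+ (t + u))) \<leadsto> s(k := (\<beta> k, \<beta>\<^sub>0 \<^bold>+ (t + u + v)))"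
    by (rule connectableD[OF v(1) up(1,2)])
  have 3: "s(k := (\<beta> k, \<beta>\<^sub>0 \<^bold>+ (t + u + v))) \<leadsto> s(k := (\<beta> k, \<beta>\<^sub>0 \<^bold>+ (t + u + v + v')))"
    by (rule connectableD[OF v(2) up(2,3)])
  have 4: "s(k := (\<beta> k, \<beta>\<^sub>0 \<^bold>+ (t + u + v + v'))) \<leadsto> s(k := (\<beta> k, \<beta>\<^sub>0 \<^bold>+ (t + (v + v'))))"
    using connectableD[OF u(2) up(3)] t(2) unfolding up(4) by blast
  show "s(k := (\<beta> k, \<beta>\<^sub>0 \<^bold>+ t)) \<leadsto> s(k := (\<beta> k, \<beta>\<^sub>0 \<^bold>+ (t + (v + v'))))"
    by (rule rtranclp_trans[OF rtranclp_trans[OF rtranclp_trans[OF 1 2] 3] 4])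
qed

text \<open>The loops of the family of \<open>k\<close> cannot be reached from the far end of \<open>k\<close> without using \<open>k\<close>;
  a floating edge carries their translations over.\<close>

lemma connectable_own:
  assumes s: "valid s" and k: "k \<in> K" and m: "m \<in> J" "anc m = k" and f: "f \<in> Fl"
  shows "connectable s k (zmult c (gen s m))"
  unfolding connectable_def
proof (intro conjI allI impI)
  let ?v = "zmult c (gen s m)" and ?w = "gen s e\<^sub>0"
  have fJ: "f \<in> J" "f \<noteq> e\<^sub>0" "f \<noteq> k" "k \<noteq> e\<^sub>0" "k \<notin> J" using f Fl e0 KJ k by auto
  have fm: "f \<noteq> m" "anc f \<noteq> k" using anc(2)[OF f] m(2) fJ by auto
  show "?v \<in> asub S" by (intro zmult_asub gen_asub[OF s]) (use m in simp)
  fix t assume t: "t \<in> Apos S" "t + ?v \<in> Apos S"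
  define u where "u = s(k := (\<beta> k, \<beta>\<^sub>0 \<^bold>+ t))"
  have u: "valid u" unfolding u_def by (rule valid_upd_K[OF s k]) (use t in simp)
  have gu: "gen u i = gen s i" if "i \<noteq> k" for i using that unfolding u_def gen_upd by simp
  have mk: "m \<noteq> k" using m fJ by auto
  have v: "?v \<in> zspan (gen u ` insert e\<^sub>0 (J - {f}))"
    unfolding gu[OF mk, symmetric] using m fm by (intro zmod.span_scale zmod.span_base) blast
  \<comment> \<open>Load the translation of \<open>m\<close> onto \<open>f\<close>, up to a multiple
    of the loop.\<close>
  obtain n u1 where u1: "u \<leadsto> u1" "valid u1" "u1 = u(f := (fst (u f), snd (u f) \<^bold>+ (?v + zmult n (gen u e\<^sub>0))))"
    "gen u1 f = gen u f + ?v + zmult n (gen u e\<^sub>0)" using term_shift[OF u fJ(1) v] by blast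
  have g1: "gen u1 i = gen u i" if "i \<noteq> f" for i using that unfolding u1(3) gen_upd by simp
  have w: "gen u1 e\<^sub>0 = ?w" "gen u e\<^sub>0 = ?w" using g1 gu fJ by auto
  have w1: "?w \<in> full S" by (rule valid_e0(1)[OF s])
  have "gen u1 f \<in> asub S" using gen_asub[OF u1(2)] fJ by simp
  then obtain N where "\<And>n. int N \<le> n \<Longrightarrow> t + gen u1 f + zmult n ?w \<in> Apos S"
    using raise_Apos[OF S(1) w1 asub_add[OF Apos_asub[OF t(1)]]] by blast
  then have N: "t + gen u1 f + zmult (int N) ?w \<in> Apos S" by blast
  \<comment> \<open>Slide \<open>k\<close> along the loaded edge \<open>f\<close>, raised by
    \<open>N\<close> copies of the loop.\<close>
  define v2 where "v2 = gen u1 f + zmult (int N) ?w"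
  have tv2: "t + v2 \<in> Apos S" using N by (simp add: v2_def add.assoc)
  have "gen u1 f \<in> zspan (gen u1 ` insert e\<^sub>0 {j \<in> J. anc j \<noteq> k})"
    using fJ fm by (intro zmod.span_base) blast
  then have v2: "v2 \<in> zspan (gen u1 ` insert e\<^sub>0 {j \<in> J. anc j \<noteq> k})"
    unfolding v2_def w(1)[symmetric] by (intro zmod.span_add zmod.span_scale span_e0)
  have u1k: "u1 k = (\<beta> k, \<beta>\<^sub>0 \<^bold>+ t)" using fJ by (simp add: u1(3) u_def)
  define u2 where "u2 = u1(k := (\<beta> k, \<beta>\<^sub>0 \<^bold>+ (t + v2)))"
  have 2: "u1 \<leadsto> u2" "valid u2"
    using change_K[OF u1(2) k v2] valid_upd_K[OF u1(2) k, of "\<beta>\<^sub>0 \<^bold>+ (t + v2)"] tv2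
    unfolding u1k u2_def by simp_all
  have g2: "gen u2 i = gen u1 i" if "i \<noteq> k" for i using that unfolding u2_def gen_upd by simp
  define u3 where "u3 = u(k := (\<beta> k, \<beta>\<^sub>0 \<^bold>+ (t + v2)))"
  have v3: "valid u3" unfolding u3_def by (rule valid_upd_K[OF u k]) (use tv2 in simp)
  have g3: "gen u3 i = gen u i" if "i \<noteq> k" for i using that unfolding u3_def gen_upd by simp
  have img3: "gen u2 ` insert e\<^sub>0 (J - {f}) = gen u ` insert e\<^sub>0 (J - {f})"
  proof (rule image_cong)
    fix i assume "i \<in> insert e\<^sub>0 (J - {f})"
    then have "i \<noteq> f" "i \<noteq> k" using fJ by auto
    then show "gen u2 i = gen u i" using g1 g2 by simp
  qed simp
  \<comment> \<open>Unload \<open>f\<close>, which returns it to its original position.\<close>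
  define v3' where "v3' = - (?v + zmult n ?w)"
  have v3': "v3' \<in> zspan (gen u2 ` insert e\<^sub>0 (J - {f}))"
    unfolding img3 v3'_def w(2)[symmetric] by (intro zmod.span_neg zmod.span_add v zmod.span_scale span_e0)
  have u2f: "fst (u2 f) = fst (u f)" "snd (u2 f) = snd (u f) \<^bold>+ (?v + zmult n ?w)"
    using fJ by (simp_all add: u2_def u1(3) w)
  have restore: "snd (u2 f) \<^bold>+ v3' = snd (u f)" unfolding u2f v3'_def by simp
  have uf: "snd (u f) \<in> up S (\<beta> (anc f))" using u fJ(1) unfolding valid_def by blast
  have "u2 \<leadsto> u2(f := (fst (u2 f), snd (u2 f) \<^bold>+ v3'))"
    by (rule change_term[OF 2(2) fJ(1) v3']) (use uf in \<open>simp only: restore\<close>)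
  moreover have "u2(f := (fst (u2 f), snd (u2 f) \<^bold>+ v3')) = u3"
    unfolding restore u2f(1) using fJ by (auto simp: u2_def u1(3) u3_def fun_eq_iff)
  ultimately have 3: "u2 \<leadsto> u3" by simp
  have "gen u3 f \<in> zspan (gen u3 ` insert e\<^sub>0 {j \<in> J. anc j \<noteq> k})"
    using fJ fm by (intro zmod.span_base) blast
  moreover have w3: "gen u3 e\<^sub>0 = ?w" using g3 w fJ by auto
  \<comment> \<open>Slide \<open>k\<close> backwards along the unloaded \<open>f\<close>: the loaded
    translation remains, and the \<open>n + N\<close> copies of the loop are cancelled.\<close>
  ultimately have v4: "- gen u3 f - zmult (n + int N) ?w \<in> zspan (gen u3 ` insert e\<^sub>0 {j \<in> J. anc j \<noteq> k})"
    unfolding w3[symmetric] by (intro zmod.span_diff zmod.span_neg zmod.span_scale span_e0)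
  have gf: "gen u1 f = gen u3 f + ?v + zmult n ?w" using u1(4) w g3 fJ by simp
  have e: "t + v2 + (- gen u3 f - zmult (n + int N) ?w) = t + ?v"
    unfolding v2_def gf zmod.scale_left_distrib by (simp add: algebra_simps)
  have u3k: "u3 k = (\<beta> k, \<beta>\<^sub>0 \<^bold>+ (t + v2))" by (simp add: u3_def)
  have 4: "u3 \<leadsto> u3(k := (\<beta> k, \<beta>\<^sub>0 \<^bold>+ (t + ?v)))"
    using change_K[OF v3 k v4] t(2) unfolding u3k snd_conv shift_shift e by simp
  have "u3(k := (\<beta> k, \<beta>\<^sub>0 \<^bold>+ (t + ?v))) = s(k := (\<beta> k, \<beta>\<^sub>0 \<^bold>+ (t + ?v)))" by (simp add: u3_def u_def)
  with rtranclp_trans[OF rtranclp_trans[OF rtranclp_trans[OF u1(1) 2(1)] 3] 4]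
  show "s(k := (\<beta> k, \<beta>\<^sub>0 \<^bold>+ t)) \<leadsto> s(k := (\<beta> k, \<beta>\<^sub>0 \<^bold>+ (t + ?v)))" by (simp add: u_def)
qed

lemma connectable_span:
  assumes s: "valid s" and k: "k \<in> K" and f: "f \<in> Fl" and v: "v \<in> zspan (gen s ` I)"
  shows "connectable s k v"
  using v
proof (induction v rule: zmod.span_induct_alt)
  case base
  show ?case by (rule connectable_others[OF s k zmod.span_zero])
next
  case (step c x y)
  obtain i where i: "i \<in> I" "x = gen s i" using step(1) by blast
  have "connectable s k (zmult c x)"
  proof (cases "i \<in> J \<and> anc i = k")
    case True
    then show ?thesis unfolding i(2) using connectable_own[OF s k _ _ f] by blast
  next
    case False
    then have "x \<in> zspan (gen s ` insert e\<^sub>0 {j \<in> J. anc j \<noteq> k})"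
      unfolding i(2) using i(1) by (intro zmod.span_base) blast
    then show ?thesis by (intro connectable_others[OF s k] zmod.span_scale)
  qed
  then show ?case by (rule connectable_add[OF s k _ step(2)])
qed

text \<open>The invariant while edges are replaced one by one. Its span is that of the target
  \<open>t\<close> and so does not change on the way.\<close>

definition close_to :: "('i \<Rightarrow> 'v point \<times> 'v point) \<Rightarrow> ('i \<Rightarrow> 'v point \<times> 'v point) \<Rightarrow> bool" where
  "close_to t s \<longleftrightarrow> approx (gen t) s \<and> (\<forall>k\<in>K. snd (snd (t k)) - snd (snd (s k)) \<in> zspan (gen t ` I)) \<and>
     (\<forall>f\<in>Fl. snd (fst (t f)) - snd (fst (s f)) \<in> zspan (gen t ` I))"

lemma approx_span_eq:
  assumes "approx g s"
  shows "zspan (gen s ` I) = zspan (g ` I)"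
proof (rule subset_antisym)
  show "zspan (gen s ` I) \<subseteq> zspan (g ` I)"
    using approx_span[OF assms] by (intro zmod.span_minimal) auto
  have "g i \<in> zspan (gen s ` I)" if i: "i \<in> I" for i
  proof -
    have w: "g e\<^sub>0 = gen s e\<^sub>0" using assms by (simp add: approx_def)
    show ?thesis
    proof (cases "i = e\<^sub>0")
      case True
      show ?thesis unfolding True w by (rule span_e0)
    next
      case False
      then obtain n where n: "gen s i = g i + zmult n (g e\<^sub>0)" using assms i by (auto simp: approx_def)
      have "gen s i - zmult n (gen s e\<^sub>0) \<in> zspan (gen s ` I)"
        using i by (intro zmod.span_diff zmod.span_scale span_e0 zmod.span_base) blast
      then show ?thesis unfolding n w by simp
    qed
  qed
  then show "zspan (g ` I) \<subseteq> zspan (gen s ` I)" by (intro zmod.span_minimal) auto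
qed

lemma same_vertex:
  assumes "p \<in> up S b" "q \<in> up S b"
  shows "q = p \<^bold>+ (snd q - snd p)"
  using assms unfolding up_def by (auto simp: shift_def)

text \<open>Validity constrains each edge separately, so a mixture of valid configurations is
  valid.\<close>

lemma valid_pointwise:
  assumes "\<And>d. d \<in> Ed \<Longrightarrow> \<exists>s. valid s \<and> s' d = s d"
  shows "valid s'"
  unfolding valid_def
proof (intro conjI ballI)
  obtain s where "valid s" "s' e\<^sub>0 = s e\<^sub>0" using assms[of e\<^sub>0] by blast
  then show "\<exists>w\<in>full S. s' e\<^sub>0 = (\<beta>\<^sub>0, \<beta>\<^sub>0 \<^bold>+ w)" unfolding valid_def by simp
next
  fix k assume k: "k \<in> K"
  obtain s where s: "valid s" "s' k = s k" using assms[of k] k by blast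
  then show "fst (s' k) = \<beta> k" "snd (s' k) \<in> up S \<beta>\<^sub>0" using k unfolding s(2) valid_def by blast+
next
  fix j assume j: "j \<in> J"
  obtain s where s: "valid s" "s' j = s j" using assms[of j] j by blast
  then show "snd (s' j) \<in> up S (\<beta> (anc j))"
    "if j \<in> Fl then fst (s' j) \<in> up S \<beta>\<^sub>0 else fst (s' j) = \<beta> j"
    using j unfolding s(2) valid_def by blast+
qed

text \<open>The loop at \<open>e\<^sub>0\<close> already agrees. An edge of \<open>K\<close> is
  adjusted by \<open>connectable_span\<close>, a floating edge by \<open>shiftable_span\<close>, and
  any other edge differs from its target only by a multiple of the loop.\<close>

lemma close_to_step:
  assumes s: "valid s" and t: "valid t" and c: "close_to t s" and d: "d \<in> Ed" and f: "f \<in> Fl"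
  shows "s \<leadsto> s(d := t d)" "valid (s(d := t d))" "close_to t (s(d := t d))"
proof -
  have ap: "approx (gen t) s" using c by (simp add: close_to_def)
  have span: "zspan (gen s ` I) = zspan (gen t ` I)" by (rule approx_span_eq[OF ap])
  have w: "gen s e\<^sub>0 = gen t e\<^sub>0" using ap by (simp add: approx_def)
  show "valid (s(d := t d))"
  proof (rule valid_pointwise)
    show "\<exists>u. valid u \<and> (s(d := t d)) i = u i" for i
      using s t by (cases "i = d") auto
  qed
  have g: "gen (s(d := t d)) i = (if i = d then gen t i else gen s i)" for i by (simp add: gen_def)
  show "close_to t (s(d := t d))"
    unfolding close_to_def
  proof (intro conjI ballI)
    show "approx (gen t) (s(d := t d))" unfolding approx_def
    proof (intro conjI ballI)
      show "gen (s(d := t d)) e\<^sub>0 = gen t e\<^sub>0" using w g by simp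
      show "\<exists>n. gen (s(d := t d)) j = gen t j + zmult n (gen t e\<^sub>0)" if "j \<in> J" for j
      proof (cases "j = d")
        case True
        then show ?thesis using g by (intro exI[of _ 0]) simp
      next
        case False
        then show ?thesis using ap that unfolding g approx_def by simp
      qed
    qed
    show "snd (snd (t k)) - snd (snd ((s(d := t d)) k)) \<in> zspan (gen t ` I)" if "k \<in> K" for k
      using c that unfolding close_to_def by (cases "k = d") (simp_all add: zmod.span_zero)
    show "snd (fst (t h)) - snd (fst ((s(d := t d)) h)) \<in> zspan (gen t ` I)" if "h \<in> Fl" for h
      using c that unfolding close_to_def by (cases "h = d") (simp_all add: zmod.span_zero)
  qed
  show "s \<leadsto> s(d := t d)"
  proof -
    consider "d = e\<^sub>0" | "d \<in> K" | "d \<in> Fl" | "d \<in> J - Fl" using d by blast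
    then show ?thesis
    proof cases
      case 1
      have "t e\<^sub>0 = s e\<^sub>0" using valid_e0(2)[OF s] valid_e0(2)[OF t] w by simp
      then show ?thesis unfolding 1 by simp
    next
      case 2
      obtain a where a: "a \<in> Apos S" "s d = (\<beta> d, \<beta>\<^sub>0 \<^bold>+ a)" using valid_K[OF s 2] by blast
      obtain b where b: "b \<in> Apos S" "t d = (\<beta> d, \<beta>\<^sub>0 \<^bold>+ b)" using valid_K[OF t 2] by blast
      have "snd (snd (t d)) - snd (snd (s d)) \<in> zspan (gen t ` I)" using c 2 unfolding close_to_def by blast
      then have "b - a \<in> zspan (gen s ` I)" unfolding span a b by simp
      from connectableD[OF connectable_span[OF s 2 f this] a(1)] b(1)
      have "s(d := (\<beta> d, \<beta>\<^sub>0 \<^bold>+ a)) \<leadsto> s(d := (\<beta> d, \<beta>\<^sub>0 \<^bold>+ b))" by simp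
      then show ?thesis unfolding b(2) a(2)[symmetric] by simp
    next
      case 3
      obtain x y where x: "x \<in> Apos S" "y \<in> Apos S" "s d = (\<beta>\<^sub>0 \<^bold>+ x, \<beta>\<^sub>0 \<^bold>+ y)" "gen s d = y - x"
        using valid_Fl[OF s 3] by metis
      obtain x' y' where x': "x' \<in> Apos S" "y' \<in> Apos S" "t d = (\<beta>\<^sub>0 \<^bold>+ x', \<beta>\<^sub>0 \<^bold>+ y')" "gen t d = y' - x'"
        using valid_Fl[OF t 3] by metis
      have dJ: "d \<in> J" using 3 Fl by blast
      obtain n where n: "gen s d = gen t d + zmult n (gen s e\<^sub>0)" using ap dJ unfolding approx_def w by blast
      have "snd (fst (t d)) - snd (fst (s d)) \<in> zspan (gen t ` I)" using c 3 unfolding close_to_def by blast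
      then have "x' - x \<in> zspan (gen s ` I)" unfolding span x(3) x'(3) by simp
      \<comment> \<open>The multiple \<open>- n\<close> at the far end repairs the translation,
        which so far agrees with its target only modulo the loop.\<close>
      note sh = shiftableD[OF shiftable_span[OF s 3 this] x(1,2), of 0 0 "- n"]
      have ex: "x + (x' - x + zmult 0 (gen s e\<^sub>0)) = x'" by simp
      have "y - x = y' - x' + zmult n (gen s e\<^sub>0)" using n unfolding x(4) x'(4) .
      then have ey: "y + (x' - x + zmult (- n) (gen s e\<^sub>0)) = y'" by (simp add: algebra_simps)
      have "s(d := (\<beta>\<^sub>0 \<^bold>+ x, \<beta>\<^sub>0 \<^bold>+ y)) \<leadsto> s(d := (\<beta>\<^sub>0 \<^bold>+ x', \<beta>\<^sub>0 \<^bold>+ y'))"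
        using sh x(4) x'(1,2) unfolding ex ey by simp
      then show ?thesis unfolding x'(3) x(3)[symmetric] by simp
    next
      case 4
      then have dJ: "d \<in> J" "d \<notin> Fl" by auto
      obtain n where n: "gen s d = gen t d + zmult n (gen s e\<^sub>0)" using ap dJ unfolding approx_def w by blast
      have fs: "fst (s d) = \<beta> d" "fst (t d) = \<beta> d" using s t dJ by (auto simp: valid_def)
      have up: "snd (s d) \<in> up S (\<beta> (anc d))" "snd (t d) \<in> up S (\<beta> (anc d))"
        using s t dJ(1) unfolding valid_def by blast+
      define v where "v = zmult (- n) (gen s e\<^sub>0)"
      have "snd (snd (t d)) - snd (snd (s d)) = gen t d - gen s d" by (simp add: gen_def fs)
      also have "\<dots> = v" unfolding n v_def by simp
      finally have td: "snd (t d) = snd (s d) \<^bold>+ v" using same_vertex[OF up] by simp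
      have v: "v \<in> zspan (gen s ` insert e\<^sub>0 (J - {d}))" unfolding v_def by (intro zmod.span_scale span_e0)
      have "(fst (s d), snd (s d) \<^bold>+ v) = t d" using fs td by (simp add: prod_eq_iff)
      then show ?thesis using change_term[OF s dJ(1) v] up(2) unfolding td by simp
    qed
  qed
qed

lemma close_to_reach:
  assumes s: "valid s" and t: "valid t" and c: "close_to t s" and f: "f \<in> Fl"
  shows "\<exists>s'. s \<leadsto> s' \<and> (\<forall>d\<in>Ed. s' d = t d)"
proof -
  have "\<exists>s'. s \<leadsto> s' \<and> valid s' \<and> close_to t s' \<and> (\<forall>d\<in>A. s' d = t d)" if "finite A" "A \<subseteq> Ed" for A
    using that
  proof (induction A rule: finite_induct)
    case empty
    then show ?case using s c by blast
  next
    case (insert d A)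
    then obtain s1 where s1: "s \<leadsto> s1" "valid s1" "close_to t s1" "\<forall>d\<in>A. s1 d = t d" by blast
    have "d \<in> Ed" using insert.prems by blast
    note 1 = close_to_step[OF s1(2) t s1(3) this f]
    have "\<forall>i\<in>insert d A. (s1(d := t d)) i = t i" using s1(4) by simp
    then show ?case using rtranclp_trans[OF s1(1) 1(1)] 1(2,3) by blast
  qed
  from this[of Ed] show ?thesis using fin by blast
qed

text \<open>Equality of the spans lets the tuple of \<open>s\<close> be transformed into that of
  \<open>t\<close>. The drift meanwhile stays in the span, so the hypotheses on positions survive,
  and the edges can be replaced individually.\<close>

theorem reach:
  assumes s: "valid s" and t: "valid t" and f: "f \<in> Fl" and span: "zspan (gen s ` I) = zspan (gen t ` I)"
    and K: "\<And>k. k \<in> K \<Longrightarrow> snd (snd (t k)) - snd (snd (s k)) \<in> zspan (gen t ` I)"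
    and Fl': "\<And>h. h \<in> Fl \<Longrightarrow> snd (fst (t h)) - snd (fst (s h)) \<in> zspan (gen t ` I)"
  shows "\<exists>s'. s \<leadsto> s' \<and> (\<forall>d\<in>Ed. s' d = t d)"
proof -
  \<comment> \<open>Outside \<open>I\<close> the values of \<open>gen s\<close> are kept, because
    \<open>els_complete\<close> compares tuples that agree there.\<close>
  define g where "g i = (if i \<in> I then gen t i else gen s i)" for i
  have gI: "g i = gen t i" if "i \<in> I" for i using that by (simp add: g_def)
  have img: "g ` I = gen t ` I" by (rule image_cong) (simp_all add: g_def)
  have els: "(elementary I)\<^sup>*\<^sup>* (gen s) g"
  proof (rule els_complete[where \<phi> = "\<lambda>r a. snd a r" and R = S and \<epsilon> = eps])
    show "zspan (gen s ` I) = zspan (g ` I)" unfolding img by (rule span)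
    fix v assume v: "v \<in> zspan (gen s ` I)" "\<And>r. r \<in> S \<Longrightarrow> snd v r = 0"
    have "v \<in> asub S" by (rule zspan_gen_asub[OF s subset_refl v(1)])
    then have "snd v r = 0" for r using v(2)[of r] by (cases "r \<in> S") (auto simp: asub_def supp_def)
    then have "snd v = 0" by (simp add: fun_eq_iff)
    then show "v = 0 \<or> v = eps" by (cases "fst v") (auto simp: eps_def prod_eq_iff)
  qed (use S(1) fin in \<open>auto simp: g_def\<close>)
  have gC: "g e\<^sub>0 \<in> full S" using valid_e0(1)[OF t] gI by simp
  have fJ: "f \<in> J" using f Fl by blast
  obtain h where h: "(pos (full S) e\<^sub>0 f J)\<^sup>*\<^sup>* (gen s) h" "\<And>i. i \<in> I \<Longrightarrow> h i = g i"
    using poss_complete[of J f e\<^sub>0 "gen s" g "full S"] fin(2) fJ e0(2) els cone_full[OF S(3)] valid_e0(1)[OF s] gC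
    by blast
  have "approx (gen s) s" unfolding approx_def by (auto intro: exI[of _ 0])
  from realize[OF s this f h(1)] obtain s1 where s1: "s \<leadsto> s1" "valid s1" "approx h s1"
    "drift (zspan (gen s ` I)) s s1" by blast
  have "approx (gen t) s1" using s1(3) h(2) gI unfolding approx_def by simp
  moreover have "snd (snd (t k)) - snd (snd (s1 k)) \<in> zspan (gen t ` I)" if "k \<in> K" for k
    using s1(4) K that unfolding drift_def by simp
  moreover have "snd (fst (t d)) - snd (fst (s1 d)) \<in> zspan (gen t ` I)" if "d \<in> Fl" for d
  proof -
    have "snd (fst (s1 d)) - snd (fst (s d)) \<in> zspan (gen t ` I)"
      using s1(4) that unfolding drift_def span by blast
    from zmod.span_diff[OF Fl'[OF that] this] show ?thesis by simp
  qed
  ultimately have "close_to t s1" unfolding close_to_def by blast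
  from close_to_reach[OF s1(2) t this f] obtain s2 where "s1 \<leadsto> s2" "\<forall>d\<in>Ed. s2 d = t d" by blast
  then show ?thesis using rtranclp_trans[OF s1(1)] by blast
qed

end

section \<open>Conjugacy and families in the affine representation\<close>

definition ends :: "('v point, 'e) sgraph \<Rightarrow> 'e \<Rightarrow> 'v point \<times> 'v point" where
  "ends L e = (init L e, term_of L e)"

lemma fst_ends [simp]: "fst (ends L e) = init L e" and snd_ends [simp]: "snd (ends L e) = term_of L e"
  by (simp_all add: ends_def)

text \<open>Any graph on \<open>V \<times> Apos P\<close> rather than an affine representation, so
  that graphs obtained by sign-changes are covered too.\<close>

locale agraph =
  fixes P :: "nat set" and L :: "('v point, 'e) sgraph" and V :: "'v set"
  assumes finP: "finite P" and finE: "finite (Edges L)" and VL: "Verts L = V \<times> Apos P"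
    and edge: "\<And>e. e \<in> Edges L \<Longrightarrow> init L e \<in> Verts L \<and> bar L e \<in> Edges L \<and> bar L (bar L e) = e \<and> bar L e \<noteq> e"
begin

abbreviation "conn \<equiv> iconj P (Edges L) (ends L)"
abbreviation "cj \<equiv> conjugate P L"

lemma term_bar: "e \<in> Edges L \<Longrightarrow> term_of L (bar L e) = init L e"
  using edge[of e] by (simp add: term_of_def)

lemma init_bar: "init L (bar L e) = term_of L e"
  by (simp add: term_of_def)

lemma term_Verts: "e \<in> Edges L \<Longrightarrow> term_of L e \<in> Verts L"
  using edge[of e] edge[of "bar L e"] by (simp add: term_of_def)

lemma shift_Verts: "p \<in> Verts L \<Longrightarrow> a \<in> Apos P \<Longrightarrow> p \<^bold>+ a \<in> Verts L"
  unfolding VL shift_def by (cases p) (auto intro: Apos_add)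

lemma istepE:
  assumes "istep P (Edges L) (ends L) p q"
  obtains e a where "e \<in> Edges L" "a \<in> Apos P" "p = init L e \<^bold>+ a" "q = term_of L e \<^bold>+ a"
proof -
  obtain e a where e: "e \<in> Edges L" "a \<in> Apos P" "(p = init L e \<^bold>+ a \<and> q = term_of L e \<^bold>+ a) \<or>
     (p = term_of L e \<^bold>+ a \<and> q = init L e \<^bold>+ a)"
    using assms unfolding istep_def by auto
  from e(3) show ?thesis
  proof
    assume "p = init L e \<^bold>+ a \<and> q = term_of L e \<^bold>+ a"
    then show ?thesis using that e by blast
  next
    assume "p = term_of L e \<^bold>+ a \<and> q = init L e \<^bold>+ a"
    then show ?thesis using that[of "bar L e" a] e edge[OF e(1)] term_bar[OF e(1)] by (simp add: init_bar)
  qed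
qed

lemma affine_path_conn: "affine_path P L p es q \<Longrightarrow> p \<in> Verts L \<and> q \<in> Verts L \<and> conn p q"
proof (induction es arbitrary: p)
  case Nil
  then show ?case by auto
next
  case (Cons e es)
  then obtain w where w: "e \<in> Edges L" "w \<in> Apos P" "p = init L e \<^bold>+ w" "affine_path P L (term_of L e \<^bold>+ w) es q"
    by auto
  have 1: "conn p (term_of L e \<^bold>+ w)" using iconj_edge[OF w(1,2), of "ends L"] unfolding w(3) by simp
  have 2: "q \<in> Verts L" "conn (term_of L e \<^bold>+ w) q" using Cons.IH[OF w(4)] by blast+
  have "p \<in> Verts L" unfolding w(3) using shift_Verts[OF _ w(2)] edge[OF w(1)] by blast
  then show ?case using rtranclp_trans[OF 1 2(2)] 2(1) by simp
qed

lemma conn_affine_path: "conn p q \<Longrightarrow> p \<in> Verts L \<Longrightarrow> \<exists>es. affine_path P L p es q"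
proof (induction rule: converse_rtranclp_induct)
  case base
  then show ?case by (intro exI[of _ "[]"]) simp
next
  case (step p r)
  from step(1) obtain e a where e: "e \<in> Edges L" "a \<in> Apos P" "p = init L e \<^bold>+ a" "r = term_of L e \<^bold>+ a"
    by (rule istepE)
  have "r \<in> Verts L" unfolding e(4) by (rule shift_Verts[OF term_Verts[OF e(1)] e(2)])
  then obtain es where "affine_path P L r es q" using step by blast
  then have "affine_path P L p (e # es) q" using e by auto
  then show ?case by blast
qed

lemma conjugate_iff: "cj p q \<longleftrightarrow> p \<in> Verts L \<and> conn p q"
  unfolding conjugate_def using affine_path_conn[of p _ q] conn_affine_path[of p q] by blast

lemma conjugate_Verts: "cj p q \<Longrightarrow> p \<in> Verts L \<and> q \<in> Verts L"
  unfolding conjugate_def using affine_path_conn[of p _ q] by blast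

lemma cj_sym: "cj p q \<Longrightarrow> cj q p"
  using conjugate_Verts[of p q] iconj_sym[of P "Edges L" "ends L" p q] conjugate_iff by blast

lemma cj_trans: "cj p q \<Longrightarrow> cj q r \<Longrightarrow> cj p r"
  unfolding conjugate_iff using rtranclp_trans[of "istep P (Edges L) (ends L)" p q r] by blast

lemma cj_refl: "p \<in> Verts L \<Longrightarrow> cj p p"
  unfolding conjugate_iff by simp

lemma cj_shift: "cj p q \<Longrightarrow> a \<in> Apos P \<Longrightarrow> cj (p \<^bold>+ a) (q \<^bold>+ a)"
  unfolding conjugate_iff using iconj_shift[of P "Edges L" "ends L" p q a] shift_Verts[of p a] by blast

lemma cj_edge: "e \<in> Edges L \<Longrightarrow> cj (init L e) (term_of L e)"
  using iconj_edge[of e "Edges L" 0 P "ends L"] edge[of e] unfolding conjugate_iff by simp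

abbreviation "cle \<equiv> conj_le P L"
abbreviation "qc \<equiv> qconj P L"

lemma leI: "p \<in> Verts L \<Longrightarrow> a \<in> Apos P \<Longrightarrow> cj (p \<^bold>+ a) q \<Longrightarrow> cle p q"
  unfolding conj_le_def point_le_def by blast

lemma leE:
  assumes "cle p q"
  obtains a where "a \<in> Apos P" "cj (p \<^bold>+ a) q" "p \<in> Verts L"
  using assms unfolding conj_le_def point_le_def by blast

lemma le_trans: "cle p q \<Longrightarrow> cle q r \<Longrightarrow> cle p r"
proof -
  assume "cle p q" "cle q r"
  obtain a where a: "a \<in> Apos P" "cj (p \<^bold>+ a) q" "p \<in> Verts L" using leE[OF \<open>cle p q\<close>] .
  obtain b where b: "b \<in> Apos P" "cj (q \<^bold>+ b) r" using leE[OF \<open>cle q r\<close>] by metis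
  have "cj (p \<^bold>+ (a + b)) r" using cj_trans[OF cj_shift[OF a(2) b(1)] b(2)] by simp
  then show ?thesis by (rule leI[OF a(3) Apos_add[OF a(1) b(1)]])
qed

lemma cj_le: "cj p q \<Longrightarrow> cle p q"
  using leI[of p 0 q] conjugate_Verts[of p q] by simp

lemma cj_qc: "cj p q \<Longrightarrow> qc p q"
  unfolding qconj_def using cj_le cj_sym by blast

lemma qc_sym: "qc p q \<Longrightarrow> qc q p"
  by (simp add: qconj_def)

lemma qc_trans: "qc p q \<Longrightarrow> qc q r \<Longrightarrow> qc p r"
  unfolding qconj_def using le_trans by blast

end

section \<open>The quasi-conjugacy class of a clean normal form\<close>

locale qgraph = agraph P L V
  for P :: "nat set" and L :: "('v point, 'e) sgraph" and V :: "'v set" +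
  fixes Q F\<^sub>0 :: "'v point set" and mF :: "'v point set \<Rightarrow> 'v point"
  assumes one: "one_qc_class P L Q" and clean: "clean P L Q" and nf: "normal_form P L Q F\<^sub>0 mF"
    and S0: "supp_qc P L Q \<noteq> {}"
begin

definition "S \<equiv> supp_qc P L Q"
abbreviation "minpts \<equiv> min_qc P Q"

lemma Q_class: obtains p\<^sub>0 where "p\<^sub>0 \<in> Verts L" "Q = {q. qc p\<^sub>0 q}"
  using one unfolding one_qc_class_def qc_classes_def by blast

lemma Q_qc: "p \<in> Q \<Longrightarrow> q \<in> Q \<Longrightarrow> qc p q"
proof -
  assume pq: "p \<in> Q" "q \<in> Q"
  obtain p\<^sub>0 where "Q = {q. qc p\<^sub>0 q}" using Q_class .
  then have "qc p\<^sub>0 p" "qc p\<^sub>0 q" using pq by auto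
  then show ?thesis using qc_trans[OF qc_sym] by blast
qed

lemma qc_Q: "p \<in> Q \<Longrightarrow> qc p q \<Longrightarrow> q \<in> Q"
proof -
  assume pq: "p \<in> Q" "qc p q"
  obtain p\<^sub>0 where Q: "Q = {q. qc p\<^sub>0 q}" using Q_class .
  then have "qc p\<^sub>0 p" using pq by auto
  then show ?thesis using qc_trans[OF _ pq(2)] unfolding Q by blast
qed

lemma Q_Verts: "p \<in> Q \<Longrightarrow> p \<in> Verts L"
  using Q_qc[of p p] unfolding qconj_def conj_le_def by blast

lemma cj_Q: "p \<in> Q \<Longrightarrow> cj p q \<Longrightarrow> q \<in> Q"
  using cj_qc qc_Q by blast

lemma init_Q: "e \<in> Edges L \<Longrightarrow> init L e \<in> Q"
  using one unfolding one_qc_class_def by blast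

lemma term_Q: "e \<in> Edges L \<Longrightarrow> term_of L e \<in> Q"
  using cj_Q[OF init_Q cj_edge] by blast

lemma S_P: "S \<subseteq> P"
  unfolding S_def supp_qc_def by (auto simp: Apos_def)

lemma finS: "finite S"
  using S_P finP finite_subset by blast

lemma Apos_SP: "a \<in> Apos S \<Longrightarrow> a \<in> Apos P"
  using Apos_mono S_P by blast

lemma gap_S: "p \<in> Q \<Longrightarrow> w \<in> Apos P \<Longrightarrow> p \<^bold>+ w \<in> Q \<Longrightarrow> w \<in> Apos S"
proof -
  assume "p \<in> Q" "w \<in> Apos P" "p \<^bold>+ w \<in> Q"
  then have "supp w \<subseteq> S" unfolding S_def supp_qc_def using Q_qc by blast
  then show ?thesis using \<open>w \<in> Apos P\<close> by (simp add: Apos_def)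
qed

lemma eps_Q: "p \<in> Q \<Longrightarrow> p \<^bold>+ eps \<in> Q"
proof (rule qc_Q)
  assume p: "p \<in> Q"
  have pe: "p \<^bold>+ eps \<in> Verts L" using shift_Verts[OF Q_Verts[OF p] Apos_eps] .
  have "cle p (p \<^bold>+ eps)" by (rule leI[OF Q_Verts[OF p] Apos_eps cj_refl[OF pe]])
  moreover have "cle (p \<^bold>+ eps) p"
    by (rule leI[OF pe Apos_eps]) (simp add: cj_refl[OF Q_Verts[OF p]])
  ultimately show "qc p (p \<^bold>+ eps)" by (simp add: qconj_def)
qed

lemma Min_Q: "m \<in> minpts \<Longrightarrow> m \<in> Q"
  by (simp add: min_qc_def)

text \<open>The shifts from \<open>q\<close> to \<open>m\<close> and back are nonnegative and add up
  to 0, so only the sign can differ.\<close>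

lemma Min_le:
  assumes "m \<in> minpts" "q \<in> Q" "w \<in> Apos P" "m = q \<^bold>+ w"
  shows "w = 0 \<or> w = eps"
proof -
  have "point_le P q m" using assms(3,4) unfolding point_le_def by blast
  then have "point_le P m q" using assms(1,2) by (simp add: min_qc_def)
  then obtain v where v: "v \<in> Apos P" "q = m \<^bold>+ v" unfolding point_le_def by blast
  then have "q \<^bold>+ (w + v) = q \<^bold>+ 0" using assms(4) by simp
  then have "w + v = 0" by (simp only: shift_eq_iff)
  then have "snd (w + v) r = 0" for r by simp
  then have "snd w r + snd v r = 0" for r by (simp only: snd_add plus_fun_apply)
  moreover have "0 \<le> snd w r" "0 \<le> snd v r" for r using assms(3) v(1) by (simp_all add: Apos_def)
  ultimately have "snd w r = 0" for r by (smt (verit))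
  then have "snd w = 0" by (simp add: fun_eq_iff)
  then show ?thesis by (cases "fst w") (simp_all add: eps_def prod_eq_iff)
qed

lemma Min_eps: "m \<in> minpts \<Longrightarrow> m \<^bold>+ eps \<in> minpts"
proof -
  assume m: "m \<in> minpts"
  have "point_le P (m \<^bold>+ eps) q" if t: "q \<in> Q" "point_le P q (m \<^bold>+ eps)" for q
  proof -
    obtain w where w: "w \<in> Apos P" "m \<^bold>+ eps = q \<^bold>+ w" using t(2) unfolding point_le_def by blast
    then have "m \<^bold>+ eps \<^bold>+ eps = q \<^bold>+ w \<^bold>+ eps" by (simp only: w(2))
    then have mq: "m = q \<^bold>+ (w + eps)" by simp
    then have "w + eps = 0 \<or> w + eps = eps"
      by (rule Min_le[OF m t(1) Apos_add[OF w(1) Apos_eps]])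
    then show ?thesis
    proof
      assume "w + eps = 0"
      then have "q = m \<^bold>+ eps \<^bold>+ eps" using mq by simp
      then show ?thesis unfolding point_le_def using Apos_eps by blast
    next
      assume "w + eps = eps"
      then have "q = m \<^bold>+ eps \<^bold>+ 0" using mq by simp
      then show ?thesis unfolding point_le_def using Apos_0 by blast
    qed
  qed
  then show ?thesis using eps_Q[OF Min_Q[OF m]] by (simp add: min_qc_def)
qed

lemma at_point_sym: "at_point m p \<Longrightarrow> at_point p m"
  unfolding at_point_def by auto

lemma at_point_trans: "at_point m p \<Longrightarrow> at_point p q \<Longrightarrow> at_point m q"
  unfolding at_point_def by auto

lemma at_point_Min: "m \<in> minpts \<Longrightarrow> at_point m p \<Longrightarrow> p \<in> minpts"
  unfolding at_point_def using Min_eps by blast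

text \<open>Among the points of \<open>Q\<close> below \<open>q\<close>, one of least total exponent
  is minimal: a point below it must have the same exponents and differs at most in sign.\<close>

lemma Min_below:
  assumes "q \<in> Q"
  obtains m w where "m \<in> minpts" "w \<in> Apos S" "q = m \<^bold>+ w"
proof -
  define wt where "wt p = (\<Sum>r\<in>P. nat (snd (snd p) r))" for p :: "'v point"
  define A where "A = {p \<in> Q. point_le P p q}"
  have "q \<in> A" using assms unfolding A_def point_le_def by (auto intro: bexI[of _ 0])
  then obtain m where m: "m \<in> A" "\<And>p. p \<in> A \<Longrightarrow> wt m \<le> wt p"
    using arg_min_nat_lemma[of "\<lambda>p. p \<in> A" q wt] by blast
  then obtain w where w: "w \<in> Apos P" "q = m \<^bold>+ w" unfolding A_def point_le_def by blast
  have mQ: "m \<in> Q" using m by (simp add: A_def)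
  have "point_le P m p" if p: "p \<in> Q" "point_le P p m" for p
  proof -
    obtain v where v: "v \<in> Apos P" "m = p \<^bold>+ v" using p(2) unfolding point_le_def by blast
    have "p \<in> A" unfolding A_def point_le_def using p(1) w v Apos_add[OF v(1) w(1)] by auto
    then have le: "wt m \<le> wt p" by (rule m(2))
    have pos: "0 \<le> snd (snd p) r" "0 \<le> snd v r" for r
      using Q_Verts[OF p(1)] v(1) unfolding VL by (auto simp: Apos_def mem_Times_iff)
    have vr: "snd v r = 0" if "r \<in> P" for r
    proof (rule ccontr)
      assume "snd v r \<noteq> 0"
      then have "0 < snd v r" using pos(2)[of r] by simp
      then have "nat (snd (snd p) r) < nat (snd (snd m) r)" using pos(1)[of r] unfolding v(2) by simp
      moreover have "nat (snd (snd p) x) \<le> nat (snd (snd m) x)" for x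
        using pos(2)[of x] unfolding v(2) by simp
      ultimately have "wt p < wt m" unfolding wt_def
        using \<open>r \<in> P\<close> by (intro sum_strict_mono_ex1[OF finP]) blast+
      then show False using le by simp
    qed
    have "snd v r = 0" for r using vr v(1) by (cases "r \<in> P") (auto simp: Apos_def supp_def)
    then have "snd v = 0" by (simp add: fun_eq_iff)
    then have "v = 0 \<or> v = eps" by (cases "fst v") (simp_all add: eps_def prod_eq_iff)
    then have "v + v = 0" by auto
    then have "p = m \<^bold>+ v" unfolding v(2) by simp
    then show ?thesis unfolding point_le_def using v(1) by blast
  qed
  then have "m \<in> minpts" using mQ by (simp add: min_qc_def)
  then show ?thesis using that gap_S[OF mQ w(1)] assms w(2) by blast
qed

definition fam :: "'v point \<Rightarrow> 'v point set" where
  "fam p = {q \<in> Q. same_family S p q}"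

lemma same_family_iff: "same_family S p q \<longleftrightarrow> fst p = fst q \<and> snd q - snd p \<in> asub S"
  by (simp add: same_family_def asub_def)

lemma same_family_sym: "same_family S p q \<Longrightarrow> same_family S q p"
  unfolding same_family_iff using asub_uminus[of "snd q - snd p" S] by simp

lemma same_family_trans: "same_family S p q \<Longrightarrow> same_family S q r \<Longrightarrow> same_family S p r"
  unfolding same_family_iff using asub_add[of "snd q - snd p" S "snd r - snd q"] by simp

lemma same_family_refl: "same_family S p p"
  by (simp add: same_family_iff)

lemma same_family_shift: "a \<in> asub S \<Longrightarrow> same_family S p (p \<^bold>+ a)"
  by (simp add: same_family_iff)

lemma families_iff: "F \<in> families P L Q \<longleftrightarrow> (\<exists>p\<in>Q. F = fam p)"
  unfolding families_def fam_def S_def by blast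

lemma fam_in: "p \<in> Q \<Longrightarrow> p \<in> fam p"
  by (simp add: fam_def same_family_refl)

lemma fam_eq: "q \<in> fam p \<Longrightarrow> fam q = fam p"
  unfolding fam_def using same_family_sym same_family_trans by blast

lemma families_fam: "F \<in> families P L Q \<Longrightarrow> p \<in> F \<Longrightarrow> F = fam p"
  unfolding families_iff using fam_eq by blast

lemma fam_families: "p \<in> Q \<Longrightarrow> fam p \<in> families P L Q"
  unfolding families_iff by blast

lemma families_Q: "F \<in> families P L Q \<Longrightarrow> F \<subseteq> Q"
  unfolding families_iff fam_def by blast

lemma same_fam: "F \<in> families P L Q \<Longrightarrow> p \<in> F \<Longrightarrow> q \<in> F \<Longrightarrow> same_family S p q"
  using families_fam[of F p] unfolding fam_def by blast

lemma fam_at_point: "F \<in> families P L Q \<Longrightarrow> p \<in> F \<Longrightarrow> at_point p q \<Longrightarrow> q \<in> F"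
proof -
  assume F: "F \<in> families P L Q" "p \<in> F" "at_point p q"
  have "p \<in> Q" using F families_Q by blast
  then have "q \<in> Q" "same_family S p q"
    using F(3) eps_Q[of p] same_family_shift[of eps p] same_family_refl[of p] asub_eps
    unfolding at_point_def by blast+
  then show ?thesis using families_fam[OF F(1,2)] by (simp add: fam_def)
qed

lemma family_min:
  assumes "F \<in> families P L Q"
  obtains m where "m \<in> minpts" "m \<in> F"
proof -
  obtain p where p: "p \<in> Q" "F = fam p" using assms unfolding families_iff by blast
  obtain m w where m: "m \<in> minpts" "w \<in> Apos S" "p = m \<^bold>+ w" using Min_below[OF p(1)] .
  have "same_family S m p" unfolding m(3) by (rule same_family_shift[OF Apos_asub[OF m(2)]])
  then have "m \<in> F" unfolding p(2) fam_def using same_family_sym Min_Q[OF m(1)] by blast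
  then show ?thesis using that m(1) by blast
qed

lemma full_gap: "full_gap_above P L Q m p \<Longrightarrow> \<exists>w\<in>full S. p = m \<^bold>+ w"
  unfolding full_gap_above_def full_def S_def[symmetric] by (auto simp: Apos_def)

lemma F0: "F\<^sub>0 \<in> families P L Q"
  using nf by (simp add: normal_form_def)

lemma mF: "F \<in> families P L Q \<Longrightarrow> F \<noteq> F\<^sub>0 \<Longrightarrow> mF F \<in> minpts \<and> mF F \<in> F"
  using nf by (simp add: normal_form_def)

lemma nf_connector:
  "\<lbrakk>F \<in> families P L Q; F \<noteq> F\<^sub>0; e \<in> Edges L; at_point (mF F) (init L e); m \<in> minpts; m \<in> F\<^sub>0\<rbrakk>
    \<Longrightarrow> \<exists>w\<in>full S. term_of L e = m \<^bold>+ w"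
  using nf unfolding normal_form_def well_inside_def by (intro full_gap) blast

lemma nf_loop:
  "\<lbrakk>F \<in> families P L Q; e \<in> Edges L; init L e \<in> minpts; init L e \<in> F; F = F\<^sub>0 \<or> \<not> at_point (mF F) (init L e);
    m \<in> minpts; m \<in> F\<rbrakk> \<Longrightarrow> \<exists>w\<in>full S. term_of L e = m \<^bold>+ w"
proof (intro full_gap)
  assume a: "F \<in> families P L Q" "e \<in> Edges L" "init L e \<in> minpts" "init L e \<in> F"
    "F = F\<^sub>0 \<or> \<not> at_point (mF F) (init L e)" "m \<in> minpts" "m \<in> F"
  have "at_point (init L e) (init L e)" by (simp add: at_point_def)
  then have "well_inside P L Q F (term_of L e)" using nf a unfolding normal_form_def by blast
  then show "full_gap_above P L Q m (term_of L e)" using a(6,7) unfolding well_inside_def by blast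
qed

lemma nf_floating:
  "\<lbrakk>floating_edge P L Q e; m \<in> minpts; m \<in> F\<^sub>0\<rbrakk>
    \<Longrightarrow> (\<exists>w\<in>full S. init L e = m \<^bold>+ w) \<and> (\<exists>w\<in>full S. term_of L e = m \<^bold>+ w)"
  using nf unfolding normal_form_def well_inside_def by (intro conjI full_gap) blast+

lemma edge_at: "m \<in> minpts \<Longrightarrow> \<exists>!e. e \<in> Edges L \<and> at_point m (init L e)"
  using clean by (simp add: clean_def)

lemma not_both_Min: "e \<in> Edges L \<Longrightarrow> init L e \<in> minpts \<Longrightarrow> term_of L e \<notin> minpts"
  using clean by (simp add: clean_def)

lemma Min_edge_unique:
  "\<lbrakk>e \<in> Edges L; e' \<in> Edges L; m \<in> minpts; at_point m (init L e); at_point m (init L e')\<rbrakk> \<Longrightarrow> e = e'"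
  using edge_at by blast

text \<open>The loop at a minimal point of \<open>F\<^sub>0\<close> has full support. Going round it
  often enough stays in the conjugacy class and rises above any given shift in the directions of
  \<open>S\<close>.\<close>

lemma up_Q:
  assumes p: "p \<in> Q" and w: "w \<in> Apos S"
  shows "p \<^bold>+ w \<in> Q"
proof -
  obtain m where m: "m \<in> minpts" "m \<in> F\<^sub>0" using family_min[OF F0] .
  obtain e where e: "e \<in> Edges L" "at_point m (init L e)" using edge_at[OF m(1)] by blast
  define b where "b = init L e"
  have b: "b \<in> minpts" "b \<in> F\<^sub>0" "b \<in> Q"
    using at_point_Min[OF m(1) e(2)] fam_at_point[OF F0 m(2) e(2)] Min_Q by (simp_all add: b_def)
  obtain u where u: "u \<in> full S" "term_of L e = b \<^bold>+ u" using nf_loop[OF F0 e(1)] b b_def by blast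
  have loop: "cj b (b \<^bold>+ zmult (int n) u)" for n
  proof (induction n)
    case 0
    then show ?case using cj_refl[OF Q_Verts[OF b(3)]] by simp
  next
    case (Suc n)
    have "zmult (int n) u \<in> Apos P" by (intro zmult_Apos Apos_SP full_Apos[OF u(1)]) simp
    then have "cj (b \<^bold>+ zmult (int n) u) (b \<^bold>+ (u + zmult (int n) u))"
      using cj_shift[OF cj_edge[OF e(1)]] unfolding u(2) b_def[symmetric] by simp
    moreover have "u + zmult (int n) u = zmult (int (Suc n)) u"
      using zmult_succ[of "int n" u] by (simp add: add.commute)
    ultimately show ?case using cj_trans[OF Suc] by simp
  qed
  obtain a where a: "a \<in> Apos P" "cj (p \<^bold>+ a) b" using Q_qc[OF p b(3)] unfolding qconj_def by (metis leE)
  obtain N where "\<And>n. int N \<le> n \<Longrightarrow> - w + zmult n u \<in> Apos S"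
    using raise_Apos[OF finS u(1) asub_uminus[OF Apos_asub[OF w]]] by blast
  then have N: "- w + zmult (int N) u \<in> Apos P" using Apos_SP by blast
  have uP: "zmult (int N) u \<in> Apos P" by (intro zmult_Apos Apos_SP full_Apos[OF u(1)]) simp
  have "cj (p \<^bold>+ (a + zmult (int N) u)) b"
    using cj_trans[OF cj_shift[OF a(2) uP] cj_sym[OF loop]] by simp
  moreover have "p \<^bold>+ w \<^bold>+ (a + (- w + zmult (int N) u)) = p \<^bold>+ (a + zmult (int N) u)"
    by (simp add: algebra_simps)
  moreover have pw: "p \<^bold>+ w \<in> Verts L" by (rule shift_Verts[OF Q_Verts[OF p] Apos_SP[OF w]])
  ultimately have "cle (p \<^bold>+ w) b" using leI[OF pw Apos_add[OF a(1) N]] by simp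
  moreover have "cle b p" using Q_qc[OF b(3) p] by (simp add: qconj_def)
  ultimately have "cle (p \<^bold>+ w) p" by (rule le_trans)
  moreover have "cle p (p \<^bold>+ w)" by (rule leI[OF Q_Verts[OF p] Apos_SP[OF w] cj_refl[OF pw]])
  ultimately have "qc p (p \<^bold>+ w)" by (simp add: qconj_def)
  then show ?thesis by (rule qc_Q[OF p])
qed

text \<open>Recovers \<open>Q\<close> from its minimal points and its support, so that two graphs
  sharing these data share \<open>Q\<close>.\<close>

lemma Q_eq: "Q = {m \<^bold>+ w | m w. m \<in> minpts \<and> w \<in> Apos S}"
proof (intro equalityI subsetI)
  fix q assume "q \<in> Q"
  then show "q \<in> {m \<^bold>+ w | m w. m \<in> minpts \<and> w \<in> Apos S}" using Min_below[of q] by blast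
next
  fix q assume "q \<in> {m \<^bold>+ w | m w. m \<in> minpts \<and> w \<in> Apos S}"
  then show "q \<in> Q" using up_Q Min_Q by blast
qed

end
section \<open>A conjugacy invariant\<close>

text \<open>Distinct edges of \<open>insert e\<^sub>0 K\<close> start in distinct families; hence a
  point determines its anchor, and its transported position is unique.\<close>

locale tagged = config P S e\<^sub>0 K J Fl \<beta> anc
  for P S :: "nat set" and e\<^sub>0 :: 'i and K J Fl :: "'i set"
    and \<beta> :: "'i \<Rightarrow> 'v point" and anc :: "'i \<Rightarrow> 'i" +
  assumes sep: "\<lbrakk>k \<in> insert e\<^sub>0 K; k' \<in> insert e\<^sub>0 K; fst (\<beta> k) = fst (\<beta> k'); snd (\<beta> k) - snd (\<beta> k') \<in> asub S\<rbrakk>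
    \<Longrightarrow> k = k'"
begin

text \<open>The position of a point of \<open>Q\<close> after transport to the family of \<open>e\<^sub>0\<close>; modulo the span of the
  translations it is invariant under conjugacy.\<close>

definition Pot :: "('i \<Rightarrow> 'v point \<times> 'v point) \<Rightarrow> 'v point \<Rightarrow> avec \<Rightarrow> bool" where
  "Pot s p v \<longleftrightarrow> (\<exists>k\<in>insert e\<^sub>0 K. fst p = fst (\<beta> k) \<and> snd p - snd (\<beta> k) \<in> asub S \<and>
     v = snd p - snd (\<beta> k) + (if k = e\<^sub>0 then 0 else snd (snd (s k)) - snd \<beta>\<^sub>0))"

lemma PotI:
  "\<lbrakk>k \<in> insert e\<^sub>0 K; a \<in> asub S\<rbrakk> \<Longrightarrow>
    Pot s (\<beta> k \<^bold>+ a) (a + (if k = e\<^sub>0 then 0 else snd (snd (s k)) - snd \<beta>\<^sub>0))"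
  unfolding Pot_def by (intro bexI[of _ k]) simp_all

lemma PotE:
  assumes "Pot s p v"
  obtains k a where "k \<in> insert e\<^sub>0 K" "a \<in> asub S" "p = \<beta> k \<^bold>+ a"
    "v = a + (if k = e\<^sub>0 then 0 else snd (snd (s k)) - snd \<beta>\<^sub>0)"
proof -
  obtain k where k: "k \<in> insert e\<^sub>0 K" "fst p = fst (\<beta> k)" "snd p - snd (\<beta> k) \<in> asub S"
    "v = snd p - snd (\<beta> k) + (if k = e\<^sub>0 then 0 else snd (snd (s k)) - snd \<beta>\<^sub>0)"
    using assms unfolding Pot_def by blast
  have "p = \<beta> k \<^bold>+ (snd p - snd (\<beta> k))" by (rule shift_eqI) (simp_all add: k(2))
  then show ?thesis using that[OF k(1,3) _ k(4)] by blast
qed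

lemma Pot_unique:
  assumes "Pot s p v" "Pot s p v'"
  shows "v = v'"
proof -
  obtain k a where k: "k \<in> insert e\<^sub>0 K" "a \<in> asub S" "p = \<beta> k \<^bold>+ a"
    "v = a + (if k = e\<^sub>0 then 0 else snd (snd (s k)) - snd \<beta>\<^sub>0)" using PotE[OF assms(1)] .
  obtain k' a' where k': "k' \<in> insert e\<^sub>0 K" "a' \<in> asub S" "p = \<beta> k' \<^bold>+ a'"
    "v' = a' + (if k' = e\<^sub>0 then 0 else snd (snd (s k')) - snd \<beta>\<^sub>0)" using PotE[OF assms(2)] .
  have fs: "fst (\<beta> k) = fst (\<beta> k')" using arg_cong[OF trans[OF k(3)[symmetric] k'(3)], of fst] by simp
  have "snd (\<beta> k) + a = snd (\<beta> k') + a'" using arg_cong[OF trans[OF k(3)[symmetric] k'(3)], of snd] by simp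
  then have "snd (\<beta> k) - snd (\<beta> k') = a' - a" by (simp add: algebra_simps)
  then have "k = k'" using sep[OF k(1) k'(1) fs] asub_diff[OF k'(2) k(2)] by simp
  moreover from this have "a = a'" using k(3) k'(3) by (simp only: shift_eq_iff)
  ultimately show ?thesis using k(4) k'(4) by simp
qed

lemma Pot_shift:
  assumes "Pot s p v" "a \<in> asub S"
  shows "Pot s (p \<^bold>+ a) (v + a)"
proof -
  obtain k b where k: "k \<in> insert e\<^sub>0 K" "b \<in> asub S" "p = \<beta> k \<^bold>+ b"
    "v = b + (if k = e\<^sub>0 then 0 else snd (snd (s k)) - snd \<beta>\<^sub>0)" using PotE[OF assms(1)] .
  from PotI[OF k(1) asub_add[OF k(2) assms(2)], of s] show ?thesis unfolding k(3,4) by (simp add: ac_simps)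
qed

text \<open>Both ends of an edge of \<open>K\<close> have the same position, because transport is
  defined along that very edge; any other edge changes the position by its translation.\<close>

lemma Pot_edge:
  assumes s: "valid s" and d: "d \<in> Ed"
  shows "\<exists>a b. Pot s (fst (s d)) a \<and> Pot s (snd (s d)) b \<and> b - a \<in> zspan (gen s ` I)"
proof -
  consider "d = e\<^sub>0" | "d \<in> K" | "d \<in> J" using d by blast
  then show ?thesis
  proof cases
    case 1
    have w: "gen s e\<^sub>0 \<in> asub S" by (rule Apos_asub[OF full_Apos[OF valid_e0(1)[OF s]]])
    have "Pot s \<beta>\<^sub>0 0" using PotI[of e\<^sub>0 0 s] by simp
    moreover have "Pot s (\<beta>\<^sub>0 \<^bold>+ gen s e\<^sub>0) (gen s e\<^sub>0)" using PotI[of e\<^sub>0 _ s, OF _ w] by simp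
    moreover have "gen s e\<^sub>0 - 0 \<in> zspan (gen s ` I)" using span_e0 by simp
    ultimately show ?thesis unfolding 1 using valid_e0(2)[OF s] by (metis fst_conv snd_conv)
  next
    case 2
    obtain t where t: "t \<in> Apos S" "s d = (\<beta> d, \<beta>\<^sub>0 \<^bold>+ t)" using valid_K[OF s 2] .
    have ne: "d \<noteq> e\<^sub>0" using 2 e0 by auto
    have "Pot s (\<beta> d) t" using PotI[of d 0 s] 2 ne t(2) by simp
    moreover have "Pot s (\<beta>\<^sub>0 \<^bold>+ t) t" using PotI[of e\<^sub>0 t s, OF _ Apos_asub[OF t(1)]] by simp
    moreover have "t - t \<in> zspan (gen s ` I)" by (simp add: zmod.span_zero)
    ultimately show ?thesis unfolding t(2) fst_conv snd_conv by blast
  next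
    case 3
    obtain x y where x: "x \<in> asub S" "y \<in> Apos S" "s d = (\<beta> (anc d) \<^bold>+ x, \<beta> (anc d) \<^bold>+ y)" "gen s d = y - x"
      using valid_J[OF s 3] by metis
    define \<tau> where "\<tau> = (if anc d = e\<^sub>0 then 0 else snd (snd (s (anc d))) - snd \<beta>\<^sub>0)"
    have "Pot s (\<beta> (anc d) \<^bold>+ x) (x + \<tau>)" unfolding \<tau>_def by (rule PotI[OF anc(1)[OF 3] x(1)])
    moreover have "Pot s (\<beta> (anc d) \<^bold>+ y) (y + \<tau>)" unfolding \<tau>_def by (rule PotI[OF anc(1)[OF 3] Apos_asub[OF x(2)]])
    moreover have "y + \<tau> - (x + \<tau>) = gen s d" unfolding x(4) by simp
    then have "y + \<tau> - (x + \<tau>) \<in> zspan (gen s ` I)" using 3 by (simp add: zmod.span_base)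
    ultimately show ?thesis unfolding x(3) fst_conv snd_conv by blast
  qed
qed

text \<open>At points of \<open>Q\<close> all gaps point in the directions of \<open>S\<close>, so a
  path starting in \<open>Q\<close> never leaves the domain of \<open>Pot\<close>.\<close>

lemma Pot_iconj:
  assumes s: "valid s"
    and gap: "\<And>d w. d \<in> Ed \<Longrightarrow> w \<in> Apos P \<Longrightarrow> fst (s d) \<^bold>+ w \<in> Q \<or> snd (s d) \<^bold>+ w \<in> Q \<Longrightarrow> w \<in> Apos S"
    and closed: "\<And>d w. d \<in> Ed \<Longrightarrow> w \<in> Apos S \<Longrightarrow> fst (s d) \<^bold>+ w \<in> Q \<and> snd (s d) \<^bold>+ w \<in> Q"
    and pq: "iconj P Ed s p q" "p \<in> Q" "Pot s p a"
  shows "q \<in> Q \<and> (\<exists>b. Pot s q b \<and> b - a \<in> zspan (gen s ` I))"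
  using pq(1)
proof (induction rule: rtranclp_induct)
  case base
  have "a - a \<in> zspan (gen s ` I)" by (simp add: zmod.span_zero)
  then show ?case using pq(2,3) by blast
next
  case (step q r)
  then obtain b where b: "q \<in> Q" "Pot s q b" "b - a \<in> zspan (gen s ` I)" by blast
  obtain d w where d: "d \<in> Ed" "w \<in> Apos P" "(q = fst (s d) \<^bold>+ w \<and> r = snd (s d) \<^bold>+ w) \<or>
     (q = snd (s d) \<^bold>+ w \<and> r = fst (s d) \<^bold>+ w)" using step(2) unfolding istep_def by blast
  have w: "w \<in> Apos S" using gap[OF d(1,2)] d(3) b(1) by blast
  obtain x y where xy: "Pot s (fst (s d)) x" "Pot s (snd (s d)) y" "y - x \<in> zspan (gen s ` I)"
    using Pot_edge[OF s d(1)] by blast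
  have X: "Pot s (fst (s d) \<^bold>+ w) (x + w)" "Pot s (snd (s d) \<^bold>+ w) (y + w)"
    by (rule Pot_shift[OF xy(1) Apos_asub[OF w]], rule Pot_shift[OF xy(2) Apos_asub[OF w]])
  from d(3) show ?case
  proof
    assume e: "q = fst (s d) \<^bold>+ w \<and> r = snd (s d) \<^bold>+ w"
    have "b = x + w" using Pot_unique[OF b(2)] X(1) e by simp
    then have eq: "y + w - a = (y - x) + (b - a)" by simp
    have "y + w - a \<in> zspan (gen s ` I)" unfolding eq by (rule zmod.span_add[OF xy(3) b(3)])
    then show ?thesis using e X(2) closed[OF d(1) w] by blast
  next
    assume e: "q = snd (s d) \<^bold>+ w \<and> r = fst (s d) \<^bold>+ w"
    have "b = y + w" using Pot_unique[OF b(2)] X(2) e by simp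
    then have eq: "x + w - a = (b - a) - (y - x)" by simp
    have "x + w - a \<in> zspan (gen s ` I)" unfolding eq by (rule zmod.span_diff[OF b(3) xy(3)])
    then show ?thesis using e X(1) closed[OF d(1) w] by blast
  qed
qed

text \<open>A high multiple of the loop serves as \<open>a\<close>; it yields both conjugacies
  demanded by \<open>lin_qc\<close>, the one with the base point and the one that translates by
  \<open>v\<close>.\<close>

lemma translation_conj:
  assumes s: "valid s" and v: "v \<in> zspan (gen s ` I)"
  shows "\<exists>a\<in>Apos S. a + v \<in> Apos S \<and> iconj P Ed s \<beta>\<^sub>0 (\<beta>\<^sub>0 \<^bold>+ a) \<and> iconj P Ed s (\<beta>\<^sub>0 \<^bold>+ a) (\<beta>\<^sub>0 \<^bold>+ (a + v))"
proof -
  let ?w = "gen s e\<^sub>0"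
  have w: "?w \<in> full S" by (rule valid_e0(1)[OF s])
  have e0D: "e\<^sub>0 \<in> Ed" by simp
  have "gen s ` I \<subseteq> transl Ed s"
  proof (rule image_subsetI)
    fix i assume i: "i \<in> I"
    show "gen s i \<in> transl Ed s"
    proof (cases "i = e\<^sub>0")
      case True
      then show ?thesis using gen_e0_transl[OF s e0D] by simp
    next
      case False
      then have j: "i \<in> J" using i by simp
      have "i \<in> Ed" "anc i \<in> Ed" using j anc(1)[OF j] by auto
      then show ?thesis by (rule gen_transl[OF s e0D j])
    qed
  qed
  then have vT: "v \<in> transl Ed s" by (rule zspan_transl[OF s e0D _ v])
  have "v \<in> asub S" using vT by (simp add: transl_def)
  then obtain N where "\<And>n. int N \<le> n \<Longrightarrow> v + zmult n ?w \<in> Apos S" using raise_Apos[OF S(1) w] by blast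
  then have N: "zmult (int N) ?w + v \<in> Apos S" by (simp add: add.commute)
  have a: "zmult (int N) ?w \<in> Apos S" by (rule zmult_Apos[OF _ full_Apos[OF w]]) simp
  have "iconj P Ed s \<beta>\<^sub>0 (\<beta>\<^sub>0 \<^bold>+ zmult (int N) ?w)" using iconj_raise_nat[OF s e0D Apos_0, of N] by simp
  then show ?thesis using translD[OF vT a N] a N by blast
qed

end

text \<open>One inclusion is the invariance of \<open>Pot\<close>, the other is
  \<open>translation_conj\<close>. The configuration \<open>s\<close> is tied to \<open>L\<close>
  only through the conjugacy relation, so it may differ from \<open>L\<close> in labels,
  orientations and signs.\<close>

lemma lin_qc_eq_zspan:
  assumes q: "qgraph P L V Q F\<^sub>0 mF" and c: "tagged P (supp_qc P L Q) e\<^sub>0 K J Fl \<beta> anc"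
    and s: "config.valid (supp_qc P L Q) e\<^sub>0 K J Fl \<beta> anc s"
    and conn: "\<And>p q. iconj P (Edges L) (ends L) p q = iconj P (insert e\<^sub>0 (K \<union> J)) s p q"
    and ends: "\<And>d. d \<in> insert e\<^sub>0 (K \<union> J) \<Longrightarrow> fst (s d) \<in> Q \<and> snd (s d) \<in> Q"
    and cover: "\<And>p. p \<in> Q \<Longrightarrow> \<exists>k\<in>insert e\<^sub>0 K. same_family (supp_qc P L Q) (\<beta> k) p"
  shows "lin_qc P L Q = zspan (gen s ` insert e\<^sub>0 J)"
proof -
  interpret qgraph P L V Q F\<^sub>0 mF by (rule q)
  interpret tagged P S e\<^sub>0 K J Fl \<beta> anc using c unfolding S_def .
  have s: "valid s" using s unfolding S_def .
  have gap: "w \<in> Apos S" if "d \<in> Ed" "w \<in> Apos P" "fst (s d) \<^bold>+ w \<in> Q \<or> snd (s d) \<^bold>+ w \<in> Q" for d w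
    using that ends[OF that(1)] gap_S by blast
  have closed: "fst (s d) \<^bold>+ w \<in> Q \<and> snd (s d) \<^bold>+ w \<in> Q" if "d \<in> Ed" "w \<in> Apos S" for d w
    using that ends[OF that(1)] up_Q by blast
  have PotQ: "\<exists>v. Pot s p v" if p: "p \<in> Q" for p
  proof -
    obtain k where k: "k \<in> insert e\<^sub>0 K" "same_family S (\<beta> k) p" using cover[OF p] unfolding S_def by blast
    then have "snd p - snd (\<beta> k) \<in> asub S" "fst (\<beta> k) = fst p" unfolding same_family_iff by auto
    moreover from this have "p = \<beta> k \<^bold>+ (snd p - snd (\<beta> k))" by (intro shift_eqI) simp_all
    ultimately show ?thesis using PotI[OF k(1), of "snd p - snd (\<beta> k)" s] by metis
  qed
  show ?thesis
  proof (intro equalityI subsetI)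
    fix v assume "v \<in> lin_qc P L Q"
    then obtain w w' p where v: "v = w - w'" "p \<in> Q" "w \<in> Apos P" "w' \<in> Apos P"
      "cj (p \<^bold>+ w) (p \<^bold>+ w')" "cj (p \<^bold>+ w') p" unfolding lin_qc_def by blast
    have Q': "p \<^bold>+ w' \<in> Q" using cj_Q[OF v(2) cj_sym[OF v(6)]] .
    then have Q: "p \<^bold>+ w \<in> Q" using cj_Q[OF _ cj_sym[OF v(5)]] by blast
    have wS: "w \<in> asub S" "w' \<in> asub S" using gap_S[OF v(2)] v(3,4) Q Q' Apos_asub by blast+
    obtain u where u: "Pot s p u" using PotQ[OF v(2)] by blast
    have P1: "Pot s (p \<^bold>+ w) (u + w)" "Pot s (p \<^bold>+ w') (u + w')"
      using Pot_shift[OF u] wS by blast+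
    have ic: "iconj P Ed s (p \<^bold>+ w') (p \<^bold>+ w)" using cj_sym[OF v(5)] unfolding conjugate_iff conn by blast
    have "p \<^bold>+ w \<in> Q \<and> (\<exists>b. Pot s (p \<^bold>+ w) b \<and> b - (u + w') \<in> zspan (gen s ` I))"
      by (rule Pot_iconj[OF s _ _ ic Q' P1(2)]) (use gap closed in blast)+
    then obtain b where b: "Pot s (p \<^bold>+ w) b" "b - (u + w') \<in> zspan (gen s ` I)" by blast
    have "b = u + w" by (rule Pot_unique[OF b(1) P1(1)])
    then show "v \<in> zspan (gen s ` I)" using b(2) unfolding v(1) by simp
  next
    fix v assume v: "v \<in> zspan (gen s ` I)"
    obtain a where a: "a \<in> Apos S" "a + v \<in> Apos S" "iconj P Ed s \<beta>\<^sub>0 (\<beta>\<^sub>0 \<^bold>+ a)"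
      "iconj P Ed s (\<beta>\<^sub>0 \<^bold>+ a) (\<beta>\<^sub>0 \<^bold>+ (a + v))" using translation_conj[OF s v] by blast
    have b: "\<beta>\<^sub>0 \<in> Q" using ends[of e\<^sub>0] valid_e0(2)[OF s] by (metis fst_conv insertI1)
    have 1: "cj (\<beta>\<^sub>0 \<^bold>+ a) \<beta>\<^sub>0" using cj_sym[of \<beta>\<^sub>0 "\<beta>\<^sub>0 \<^bold>+ a"] a(3) Q_Verts[OF b] unfolding conjugate_iff conn by blast
    have "\<beta>\<^sub>0 \<^bold>+ a \<in> Verts L" using conjugate_Verts[OF 1] by blast
    then have "cj (\<beta>\<^sub>0 \<^bold>+ a) (\<beta>\<^sub>0 \<^bold>+ (a + v))" using a(4) unfolding conjugate_iff conn by blast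
    then have 2: "cj (\<beta>\<^sub>0 \<^bold>+ (a + v)) (\<beta>\<^sub>0 \<^bold>+ a)" by (rule cj_sym)
    have "v = a + v - a" by simp
    then show "v \<in> lin_qc P L Q" unfolding lin_qc_def
      using b 1 2 Apos_SP[OF a(1)] Apos_SP[OF a(2)] by blast
  qed
qed

section \<open>Labelling the edges of a normal form\<close>

context qgraph
begin

definition "Nf \<equiv> {e \<in> Edges L. init L e \<in> minpts}"
definition "e\<^sub>0 \<equiv> SOME e. e \<in> Nf \<and> init L e \<in> F\<^sub>0"
definition "K \<equiv> {e \<in> Nf. \<exists>F\<in>families P L Q - {F\<^sub>0}. at_point (mF F) (init L e)}"
text \<open>The choice depends only on the unordered pair of an edge and its reverse, so it selects
  exactly one orientation of each floating edge.\<close>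

definition "Fl \<equiv> {e. floating_edge P L Q e \<and> (SOME x. x \<in> {e, bar L e}) = e}"
definition "J \<equiv> (Nf - {e\<^sub>0} - K) \<union> Fl"
definition "anc e \<equiv> (if e \<in> Fl \<or> init L e \<in> F\<^sub>0 then e\<^sub>0
  else (THE c. c \<in> K \<and> at_point (mF (fam (init L e))) (init L c)))"

lemma e0: "e\<^sub>0 \<in> Nf" "init L e\<^sub>0 \<in> F\<^sub>0"
proof -
  obtain m where m: "m \<in> minpts" "m \<in> F\<^sub>0" using family_min[OF F0] .
  obtain e where e: "e \<in> Edges L" "at_point m (init L e)" using edge_at[OF m(1)] by blast
  then have "e \<in> Nf \<and> init L e \<in> F\<^sub>0"
    using at_point_Min[OF m(1) e(2)] fam_at_point[OF F0 m(2) e(2)] by (simp add: Nf_def)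
  then have "e\<^sub>0 \<in> Nf \<and> init L e\<^sub>0 \<in> F\<^sub>0" unfolding e\<^sub>0_def by (rule someI)
  then show "e\<^sub>0 \<in> Nf" "init L e\<^sub>0 \<in> F\<^sub>0" by blast+
qed

lemma NfD: "e \<in> Nf \<Longrightarrow> e \<in> Edges L \<and> init L e \<in> minpts \<and> bar L e \<notin> Nf"
  unfolding Nf_def using not_both_Min[of e] by (simp add: init_bar)

lemma FlD: "e \<in> Fl \<Longrightarrow> floating_edge P L Q e \<and> e \<in> Edges L \<and> e \<notin> Nf \<and> bar L e \<notin> Nf"
  unfolding Fl_def floating_edge_def Nf_def by (simp add: init_bar)

lemma floating_bar: "floating_edge P L Q e \<Longrightarrow> floating_edge P L Q (bar L e)"
  unfolding floating_edge_def using edge[of e] term_bar[of e] by (simp add: init_bar)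

lemma Fl_bar: "floating_edge P L Q e \<Longrightarrow> e \<in> Fl \<longleftrightarrow> bar L e \<notin> Fl"
proof -
  assume e: "floating_edge P L Q e"
  then have ed: "bar L (bar L e) = e" "bar L e \<noteq> e" using edge[of e] by (auto simp: floating_edge_def)
  have pick: "(SOME x. x \<in> {e, bar L e}) \<in> {e, bar L e}" by (rule someI[of _ e]) simp
  have swap: "{bar L e, bar L (bar L e)} = {e, bar L e}" unfolding ed(1) by blast
  have "bar L e \<in> Fl \<longleftrightarrow> (SOME x. x \<in> {e, bar L e}) = bar L e"
    unfolding Fl_def mem_Collect_eq swap using floating_bar[OF e] by blast
  moreover have "e \<in> Fl \<longleftrightarrow> (SOME x. x \<in> {e, bar L e}) = e" unfolding Fl_def using e by blast
  ultimately show ?thesis using pick ed(2) by auto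
qed

lemma edge_cases:
  assumes "e \<in> Edges L"
  shows "e \<in> Nf \<or> bar L e \<in> Nf \<or> floating_edge P L Q e"
  using assms edge[OF assms] by (auto simp: Nf_def floating_edge_def init_bar)

lemma K_Nf: "K \<subseteq> Nf"
  by (auto simp: K_def)

lemma Ed_eq: "insert e\<^sub>0 (K \<union> J) = Nf \<union> Fl"
  using e0 K_Nf by (auto simp: J_def)

lemma e0_K: "e\<^sub>0 \<notin> K"
proof
  assume "e\<^sub>0 \<in> K"
  then obtain F where F: "F \<in> families P L Q" "F \<noteq> F\<^sub>0" "at_point (mF F) (init L e\<^sub>0)" by (auto simp: K_def)
  have "init L e\<^sub>0 \<in> F" using fam_at_point[OF F(1) _ F(3)] mF[OF F(1,2)] by blast
  then show False using families_fam[OF F(1)] families_fam[OF F0 e0(2)] F(2) by blast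
qed

lemma K_family:
  assumes "k \<in> K"
  obtains F where "F \<in> families P L Q" "F \<noteq> F\<^sub>0" "at_point (mF F) (init L k)" "init L k \<in> F" "F = fam (init L k)"
proof -
  obtain F where F: "F \<in> families P L Q" "F \<noteq> F\<^sub>0" "at_point (mF F) (init L k)" using assms by (auto simp: K_def)
  have "init L k \<in> F" using fam_at_point[OF F(1) _ F(3)] mF[OF F(1,2)] by blast
  then show ?thesis using that F families_fam[OF F(1)] by blast
qed

lemma anchor:
  assumes "F \<in> families P L Q" "F \<noteq> F\<^sub>0"
  shows "\<exists>!c. c \<in> K \<and> at_point (mF F) (init L c)"
proof -
  have m: "mF F \<in> minpts" using mF[OF assms] by blast
  obtain c where c: "c \<in> Edges L" "at_point (mF F) (init L c)" using edge_at[OF m] by blast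
  have "c \<in> K" using c assms at_point_Min[OF m c(2)] by (auto simp: K_def Nf_def)
  then show ?thesis using c Min_edge_unique[OF _ _ m] K_Nf NfD by blast
qed

lemma anc_F0: "init L e \<in> F\<^sub>0 \<or> e \<in> Fl \<Longrightarrow> anc e = e\<^sub>0"
  by (auto simp: anc_def)

lemma anc_other:
  assumes "e \<in> Nf" "init L e \<notin> F\<^sub>0"
  shows "anc e \<in> K \<and> at_point (mF (fam (init L e))) (init L (anc e)) \<and> init L (anc e) \<in> fam (init L e)
    \<and> fam (init L e) \<in> families P L Q \<and> fam (init L e) \<noteq> F\<^sub>0"
proof -
  have eQ: "init L e \<in> Q" using assms NfD init_Q by blast
  have F: "fam (init L e) \<in> families P L Q" "fam (init L e) \<noteq> F\<^sub>0"
    using fam_families[OF eQ] fam_in[OF eQ] assms(2) by auto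
  have "e \<notin> Fl" using assms(1) FlD by blast
  then have "anc e = (THE c. c \<in> K \<and> at_point (mF (fam (init L e))) (init L c))"
    using assms(2) by (simp add: anc_def)
  then have a: "anc e \<in> K" "at_point (mF (fam (init L e))) (init L (anc e))"
    using theI'[OF anchor[OF F]] by auto
  have "init L (anc e) \<in> fam (init L e)" by (rule fam_at_point[OF F(1) _ a(2)]) (use mF[OF F] in blast)
  then show ?thesis using a F by blast
qed

lemma tagged: "tagged P S e\<^sub>0 K J Fl (init L) anc"
proof unfold_locales
  show "finite S" by (rule finS)
  show "S \<subseteq> P" by (rule S_P)
  show "S \<noteq> {}" using S0 by (simp add: S_def)
  have "Nf \<subseteq> Edges L" "Fl \<subseteq> Edges L" using NfD FlD by auto
  then show "finite K" "finite J" using finE K_Nf by (auto simp: J_def intro: finite_subset)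
  show "e\<^sub>0 \<notin> K" by (rule e0_K)
  show "e\<^sub>0 \<notin> J" using e0 FlD by (auto simp: J_def)
  show "K \<inter> J = {}" using K_Nf FlD by (auto simp: J_def)
  show "Fl \<subseteq> J" by (auto simp: J_def)
  show "anc j \<in> insert e\<^sub>0 K" if "j \<in> J" for j
    using that anc_F0[of j] anc_other[of j] by (auto simp: J_def)
  show "anc f = e\<^sub>0" if "f \<in> Fl" for f using anc_F0 that by blast
  show "\<exists>a\<in>asub S. init L j = init L (anc j) \<^bold>+ a" if "j \<in> J - Fl" for j
  proof -
    have j: "j \<in> Nf" using that by (auto simp: J_def)
    have "same_family S (init L (anc j)) (init L j)"
    proof (cases "init L j \<in> F\<^sub>0")
      case True
      then show ?thesis using anc_F0[of j] same_fam[OF F0 e0(2) True] by simp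
    next
      case False
      then show ?thesis using anc_other[OF j False] same_family_sym unfolding fam_def by blast
    qed
    then have "snd (init L j) - snd (init L (anc j)) \<in> asub S"
      "init L j = init L (anc j) \<^bold>+ (snd (init L j) - snd (init L (anc j)))"
      unfolding same_family_iff by (auto intro: shift_eqI)
    then show ?thesis by blast
  qed
  show "k = k'" if "k \<in> insert e\<^sub>0 K" "k' \<in> insert e\<^sub>0 K" "fst (init L k) = fst (init L k')"
    "snd (init L k) - snd (init L k') \<in> asub S" for k k'
  proof -
    have sf: "same_family S (init L k') (init L k)" using that(3,4) unfolding same_family_iff by simp
    have kQ: "init L k \<in> Q" "init L k' \<in> Q" using that(1,2) e0 K_Nf NfD init_Q by blast+
    then have "init L k \<in> fam (init L k')" using sf by (simp add: fam_def)
    then have eq: "fam (init L k) = fam (init L k')" by (rule fam_eq)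
    have F0e: "F\<^sub>0 = fam (init L e\<^sub>0)" by (rule families_fam[OF F0 e0(2)])
    have K1: "fam (init L x) \<noteq> F\<^sub>0 \<and> at_point (mF (fam (init L x))) (init L x)
      \<and> fam (init L x) \<in> families P L Q" if "x \<in> K" for x using K_family[OF that] by metis
    show ?thesis
    proof (cases "k \<in> K \<and> k' \<in> K")
      case True
      then show ?thesis using K1[of k] K1[of k'] anchor[of "fam (init L k)"] eq by auto
    next
      case False
      then show ?thesis using that(1,2) K1[of k] K1[of k'] eq F0e by auto
    qed
  qed
qed

lemma cover:
  assumes "p \<in> Q"
  shows "\<exists>k\<in>insert e\<^sub>0 K. same_family S (init L k) p"
proof (cases "p \<in> F\<^sub>0")
  case True
  then show ?thesis using same_fam[OF F0 e0(2) True] by blast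
next
  case False
  have F: "fam p \<in> families P L Q" "fam p \<noteq> F\<^sub>0" using fam_families[OF assms] fam_in[OF assms] False by auto
  obtain c where c: "c \<in> K" "at_point (mF (fam p)) (init L c)" using anchor[OF F] by blast
  have "init L c \<in> fam p" by (rule fam_at_point[OF F(1) _ c(2)]) (use mF[OF F] in blast)
  then show ?thesis using c(1) same_family_sym unfolding fam_def by blast
qed

text \<open>Non-floating edges are oriented to start at a minimal point, which is unambiguous
  because no edge of a clean graph has both ends at minimal points.\<close>

lemma rep_ends: "rep (Verts L) (insert e\<^sub>0 (K \<union> J)) L id (ends L)"
  unfolding rep_def Ed_eq
proof (intro conjI ballI impI)
  fix e assume e: "e \<in> Edges L"
  show "bar L e \<in> Edges L" "bar L (bar L e) = e" "bar L e \<noteq> e" using edge[OF e] by auto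
  show "\<exists>d\<in>Nf \<union> Fl. e = id d \<or> e = bar L (id d)"
  proof -
    have "e \<in> Nf \<union> Fl \<or> bar L e \<in> Nf \<union> Fl" using edge_cases[OF e] Fl_bar[of e] by blast
    moreover have "e = bar L (bar L e)" using edge[OF e] by simp
    ultimately show ?thesis by (metis id_apply)
  qed
next
  fix d assume "d \<in> Nf \<union> Fl"
  then show "id d \<in> Edges L" using NfD FlD by auto
  show "init L (id d) = fst (ends L d)" "init L (bar L (id d)) = snd (ends L d)" by (simp_all add: init_bar)
next
  fix d d' assume d: "d \<in> Nf \<union> Fl" "d' \<in> Nf \<union> Fl" "d \<noteq> d'"
  then show "id d \<noteq> id d'" by simp
  show "id d \<noteq> bar L (id d')"
  proof
    assume "id d = bar L (id d')"
    then have eq: "d = bar L d'" by simp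
    from d(2) show False
    proof
      assume "d' \<in> Nf"
      then have "bar L d' \<notin> Nf" "d' \<in> Edges L" using NfD by auto
      then have "bar L d' \<in> Fl" using d(1) eq by auto
      then show False using FlD[of "bar L d'"] edge[OF \<open>d' \<in> Edges L\<close>] \<open>d' \<in> Nf\<close> by simp
    next
      assume "d' \<in> Fl"
      then show False using d(1) eq FlD[of d'] Fl_bar[of d'] by auto
    qed
  qed
qed simp

end
section \<open>Matching the edges of the two graphs\<close>

lemma finite_prime_divisors:
  assumes "k \<noteq> (0 :: int)"
  shows "finite {r. int r dvd k}"
proof (rule finite_subset)
  show "{r. int r dvd k} \<subseteq> {..nat \<bar>k\<bar>}"
  proof
    fix r assume "r \<in> {r. int r dvd k}"
    then have "int r \<le> \<bar>k\<bar>" using dvd_imp_le_int[OF assms, of "int r"] by simp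
    then show "r \<in> {..nat \<bar>k\<bar>}" by simp
  qed
qed simp

lemma agraph_affine_rep:
  assumes "gbs_graph G \<psi>"
  shows "agraph (gbs_primes G \<psi>) (affine_rep G \<psi>) (Verts G)"
proof
  have G: "sgraph G" "finite (Edges G)" "\<And>e. e \<in> Edges G \<Longrightarrow> \<psi> e \<noteq> 0"
    using assms by (auto simp: gbs_graph_def)
  have "gbs_primes G \<psi> \<subseteq> (\<Union>e\<in>Edges G. {r. int r dvd \<psi> e})" by (auto simp: gbs_primes_def)
  moreover have "finite (\<Union>e\<in>Edges G. {r. int r dvd \<psi> e})" using G finite_prime_divisors by blast
  ultimately show "finite (gbs_primes G \<psi>)" by (rule finite_subset)
  show "finite (Edges (affine_rep G \<psi>))" using G by (simp add: affine_rep_def)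
  show "Verts (affine_rep G \<psi>) = Verts G \<times> Apos (gbs_primes G \<psi>)" by (simp add: affine_rep_def)
  fix e assume "e \<in> Edges (affine_rep G \<psi>)"
  then have e: "e \<in> Edges G" by (simp add: affine_rep_def)
  then have b: "bar G e \<in> Edges G" "bar G (bar G e) = e" "bar G e \<noteq> e" "init G e \<in> Verts G"
    using G(1) by (auto simp: sgraph_def)
  have "exponents (\<psi> (bar G e)) \<in> Apos (gbs_primes G \<psi>)"
  proof -
    have "r \<in> gbs_primes G \<psi>" if "snd (exponents (\<psi> (bar G e))) r \<noteq> 0" for r
    proof -
      have p: "prime r" "multiplicity (int r) (\<psi> (bar G e)) \<noteq> 0"
        using that unfolding exponents_def snd_conv by (simp_all split: if_splits)
      then have "int r dvd \<psi> (bar G e)"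
        using not_dvd_imp_multiplicity_0[of "int r" "\<psi> (bar G e)"] by argo
      then show ?thesis using p(1) b(1) unfolding gbs_primes_def by blast
    qed
    moreover have "0 \<le> snd (exponents (\<psi> (bar G e))) r" for r by (simp add: exponents_def)
    ultimately show ?thesis unfolding Apos_def supp_def by blast
  qed
  then show "init (affine_rep G \<psi>) e \<in> Verts (affine_rep G \<psi>) \<and> bar (affine_rep G \<psi>) e \<in> Edges (affine_rep G \<psi>)
    \<and> bar (affine_rep G \<psi>) (bar (affine_rep G \<psi>) e) = e \<and> bar (affine_rep G \<psi>) e \<noteq> e"
    using b by (simp add: affine_rep_def)
qed

lemma bij_of_equal_fibres:
  assumes "finite A" "finite B" "\<And>c. card {a \<in> A. f a = c} = card {b \<in> B. g b = c}"
  shows "\<exists>h. bij_betw h A B \<and> (\<forall>a\<in>A. g (h a) = f a)"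
proof -
  have "\<exists>h. bij_betw h {a \<in> A. f a = c} {b \<in> B. g b = c}" for c
    using assms by (intro finite_same_card_bij) auto
  then obtain h where h: "\<And>c. bij_betw (h c) {a \<in> A. f a = c} {b \<in> B. g b = c}" by metis
  define k where "k a = h (f a) a" for a
  have k: "k a \<in> B \<and> g (k a) = f a" if "a \<in> A" for a
    using bij_betw_apply[OF h[of "f a"], of a] that by (simp add: k_def)
  have "inj_on k A"
  proof (rule inj_onI)
    fix a a' assume a: "a \<in> A" "a' \<in> A" "k a = k a'"
    then have "f a = f a'" using k by metis
    then show "a = a'" using a bij_betw_imp_inj_on[OF h[of "f a"]] by (auto simp: k_def inj_on_def)
  qed
  moreover have "k ` A = B"
  proof (intro equalityI subsetI)
    fix b assume "b \<in> B"
    then have "b \<in> h (g b) ` {a \<in> A. f a = g b}" using bij_betw_imp_surj_on[OF h[of "g b"]] by simp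
    then obtain a where "a \<in> A" "f a = g b" "b = h (g b) a" by blast
    then have "a \<in> A" "b = k a" by (simp_all add: k_def)
    then show "b \<in> k ` A" by blast
  qed (use k in auto)
  ultimately show ?thesis using k by (auto simp: bij_betw_def)
qed

lemma rep_iconj:
  assumes "rep V D L \<theta> s"
  shows "iconj P (Edges L) (ends L) = iconj P D s"
proof -
  have dD: "\<theta> d \<in> Edges L" "init L (\<theta> d) = fst (s d)" "term_of L (\<theta> d) = snd (s d)" if "d \<in> D" for d
    using assms that by (auto simp: rep_def term_of_def)
  have "istep P (Edges L) (ends L) p q \<longleftrightarrow> istep P D s p q" for p q
  proof
    assume "istep P (Edges L) (ends L) p q"
    then obtain e a where e: "e \<in> Edges L" "a \<in> Apos P" "(p = init L e \<^bold>+ a \<and> q = term_of L e \<^bold>+ a) \<or>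
      (p = term_of L e \<^bold>+ a \<and> q = init L e \<^bold>+ a)" unfolding istep_def by auto
    obtain d where d: "d \<in> D" "e = \<theta> d \<or> e = bar L (\<theta> d)" using assms e(1) unfolding rep_def by blast
    have "bar L (bar L (\<theta> d)) = \<theta> d" using assms dD(1)[OF d(1)] unfolding rep_def by blast
    then have "(init L e = fst (s d) \<and> term_of L e = snd (s d)) \<or> (init L e = snd (s d) \<and> term_of L e = fst (s d))"
      using d(2) dD[OF d(1)] by (auto simp: term_of_def)
    then show "istep P D s p q" unfolding istep_def using e(2,3) d(1)
      by (intro bexI[of _ d] bexI[of _ a]) auto
  next
    assume "istep P D s p q"
    then obtain d a where d: "d \<in> D" "a \<in> Apos P" "(p = fst (s d) \<^bold>+ a \<and> q = snd (s d) \<^bold>+ a) \<or>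
      (p = snd (s d) \<^bold>+ a \<and> q = fst (s d) \<^bold>+ a)" unfolding istep_def by blast
    then show "istep P (Edges L) (ends L) p q" unfolding istep_def
      using dD[OF d(1)] by (intro bexI[of _ "\<theta> d"] bexI[of _ a]) auto
  qed
  then have "istep P (Edges L) (ends L) = istep P D s" by (intro ext)
  then show ?thesis by simp
qed

definition signed :: "'i set \<Rightarrow> ('i \<Rightarrow> avec) \<Rightarrow> ('i \<Rightarrow> 'v point \<times> 'v point) \<Rightarrow> 'i \<Rightarrow> 'v point \<times> 'v point" where
  "signed A c s d = (if d \<in> A then (fst (s d) \<^bold>+ c d, snd (s d) \<^bold>+ c d) else s d)"

lemma signed_sts:
  assumes "finite A" "A \<subseteq> D" "\<And>d. d \<in> A \<Longrightarrow> c d = 0 \<or> c d = eps"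
  shows "(st P D)\<^sup>*\<^sup>* s (signed A c s)"
  using assms
proof (induction A rule: finite_induct)
  case empty
  have "signed {} c s = s" by (rule ext) (simp add: signed_def)
  then show ?case by simp
next
  case (insert a A)
  then have IH: "(st P D)\<^sup>*\<^sup>* s (signed A c s)" by blast
  have eq: "signed (insert a A) c s = (signed A c s)(a := (fst (signed A c s a) \<^bold>+ c a, snd (signed A c s a) \<^bold>+ c a))"
    using insert.hyps by (intro ext) (simp add: signed_def)
  show ?case
  proof (cases "c a = 0")
    case True
    have "signed (insert a A) c s = signed A c s" unfolding eq True by (intro ext) simp
    then show ?thesis using IH by simp
  next
    case False
    then have c: "c a = eps" using insert.prems(2)[of a] by simp
    have aD: "a \<in> D" using insert.prems(1) by blast
    have "st P D (signed A c s) (signed (insert a A) c s)" unfolding eq c by (rule st_sign[OF aD refl])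
    with IH show ?thesis by (rule rtranclp.rtrancl_into_rtrancl[of "st P D"])
  qed
qed

lemma signed_istep_le:
  assumes "\<And>d. d \<in> D \<Longrightarrow> c d = 0 \<or> c d = eps" "istep P D (signed D c s) p q"
  shows "istep P D s p q"
proof -
  obtain d a where d: "d \<in> D" "a \<in> Apos P" "(p = fst (s d) \<^bold>+ (c d + a) \<and> q = snd (s d) \<^bold>+ (c d + a)) \<or>
      (p = snd (s d) \<^bold>+ (c d + a) \<and> q = fst (s d) \<^bold>+ (c d + a))"
    using assms(2) unfolding istep_def by (auto simp: signed_def)
  have "c d \<in> Apos P" using assms(1)[OF d(1)] Apos_0[of P] Apos_eps[of P] by metis
  then show ?thesis unfolding istep_def using d Apos_add by blast
qed

text \<open>As \<open>eps\<close> is nonnegative, a step along a sign-changed edge is a step along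
  the original one; the converse holds because sign-changing twice is trivial.\<close>

lemma signed_iconj:
  assumes c: "\<And>d. d \<in> D \<Longrightarrow> c d = 0 \<or> c d = eps"
  shows "iconj P D (signed D c s) = iconj P D s"
proof -
  have 1: "istep P D s p q" if "istep P D (signed D c s) p q" for p q
    using signed_istep_le[of D c P s p q] c that by blast
  have 2: "istep P D (signed D c s) p q" if st: "istep P D s p q" for p q
  proof -
    have "istep P D (signed D c (signed D c s)) p q"
    proof -
      have cc: "c d + c d = 0" if "d \<in> D" for d using c[OF that] by auto
      have "signed D c (signed D c s) d = s d" if "d \<in> D" for d
        using that cc[OF that] by (simp add: signed_def)
      then show ?thesis using st unfolding istep_def by simp
    qed
    then show ?thesis using signed_istep_le[of D c P "signed D c s" p q] c by blast
  qed
  have "istep P D (signed D c s) p q \<longleftrightarrow> istep P D s p q" for p q by (rule iffI[OF 1 2])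
  then have "istep P D (signed D c s) = istep P D s" by (intro ext)
  then show ?thesis by simp
qed

lemma rep_reindex:
  assumes rep: "rep V D L id s" and bij: "bij_betw \<theta> D' D"
  shows "rep V D' L \<theta> (\<lambda>d. s (\<theta> d))"
  unfolding rep_def
proof (intro conjI ballI impI)
  show "Verts L = V" using rep by (simp add: rep_def)
  show "bar L e \<in> Edges L" "bar L (bar L e) = e" "bar L e \<noteq> e" if "e \<in> Edges L" for e
    using rep that by (simp_all add: rep_def)
  show "\<theta> d \<in> Edges L" "init L (\<theta> d) = fst (s (\<theta> d))" "init L (bar L (\<theta> d)) = snd (s (\<theta> d))" if "d \<in> D'" for d
    using rep bij_betw_apply[OF bij that] by (simp_all add: rep_def)
  show "\<theta> d \<noteq> \<theta> d'" "\<theta> d \<noteq> bar L (\<theta> d')" if d: "d \<in> D'" "d' \<in> D'" "d \<noteq> d'" for d d'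
  proof -
    show ne: "\<theta> d \<noteq> \<theta> d'" using bij_betw_imp_inj_on[OF bij] d by (auto simp: inj_on_def)
    show "\<theta> d \<noteq> bar L (\<theta> d')"
      using rep bij_betw_apply[OF bij d(1)] bij_betw_apply[OF bij d(2)] ne by (simp add: rep_def)
  qed
  show "\<exists>d\<in>D'. e = \<theta> d \<or> e = bar L (\<theta> d)" if ee: "e \<in> Edges L" for e
  proof -
    have "\<exists>x\<in>D. e = x \<or> e = bar L x" using rep ee by (simp add: rep_def)
    then obtain x where x: "x \<in> D" "e = x \<or> e = bar L x" by blast
    obtain d where "d \<in> D'" "x = \<theta> d" using bij_betw_imp_surj_on[OF bij] x(1) by blast
    then show ?thesis using x(2) by blast
  qed
qed

lemma rep_cong:
  assumes "rep V D L \<theta> s" "\<And>d. d \<in> D \<Longrightarrow> s' d = s d"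
  shows "rep V D L \<theta> s'"
  using assms unfolding rep_def by simp

text \<open>Two sign-changes of the same edge cancel, so a single sign \<open>c\<close> describes
  the accumulated effect on both of its ends.\<close>

lemma sign_changes:
  assumes "sign_change\<^sup>*\<^sup>* L L'" and L: "\<And>e. e \<in> Edges L \<Longrightarrow> bar L e \<in> Edges L \<and> bar L (bar L e) = e \<and> bar L e \<noteq> e"
  shows "Edges L' = Edges L \<and> bar L' = bar L \<and> Verts L' = Verts L \<and>
    (\<forall>e\<in>Edges L. \<exists>c. (c = 0 \<or> c = eps) \<and> init L' e = init L e \<^bold>+ c \<and> term_of L' e = term_of L e \<^bold>+ c)"
  using assms(1)
proof (induction rule: rtranclp_induct)
  case base
  show ?case by (intro conjI ballI refl exI[of _ 0]) simp_all
next
  case (step M N)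
  then have M: "Edges M = Edges L" "bar M = bar L" "Verts M = Verts L"
    "\<And>e. e \<in> Edges L \<Longrightarrow> \<exists>c. (c = 0 \<or> c = eps) \<and> init M e = init L e \<^bold>+ c \<and> term_of M e = term_of L e \<^bold>+ c" by blast+
  obtain d p q where d0: "joins M d p q" "N = set_ends d (p \<^bold>+ eps) (q \<^bold>+ eps) M"
    using step(2) by (cases rule: sign_change.cases) blast
  then have d: "d \<in> Edges L" "N = set_ends d (init M d \<^bold>+ eps) (term_of M d \<^bold>+ eps) M"
    by (auto simp: joins_def M(1))
  have N: "Edges N = Edges L" "bar N = bar L" "Verts N = Verts L"
    "init N = (init M)(d := init M d \<^bold>+ eps, bar L d := term_of M d \<^bold>+ eps)"
    unfolding d(2) set_ends_def by (simp_all add: M)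
  have "\<exists>c. (c = 0 \<or> c = eps) \<and> init N e = init L e \<^bold>+ c \<and> term_of N e = term_of L e \<^bold>+ c" if e: "e \<in> Edges L" for e
  proof -
    obtain c where c: "c = 0 \<or> c = eps" "init M e = init L e \<^bold>+ c" "term_of M e = term_of L e \<^bold>+ c" using M(4)[OF e] by blast
    show ?thesis
    proof (cases "e = d \<or> e = bar L d")
      case True
      then have "init N e = init M e \<^bold>+ eps \<and> term_of N e = term_of M e \<^bold>+ eps"
        using L[OF d(1)] unfolding term_of_def N by (auto simp: M term_of_def)
      then have "init N e = init L e \<^bold>+ (c + eps) \<and> term_of N e = term_of L e \<^bold>+ (c + eps)" using c by simp
      moreover have "c + eps = 0 \<or> c + eps = eps" using c(1) by auto
      ultimately show ?thesis by blast
    next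
      case False
      then have "bar L e \<noteq> d" "bar L e \<noteq> bar L d" using L[OF e] L[OF d(1)] by metis+
      then have "init N e = init M e \<and> term_of N e = term_of M e"
        using False unfolding term_of_def N by (simp add: M)
      then show ?thesis using c by auto
    qed
  qed
  then show ?case using N by blast
qed

section \<open>Counting edges by conjugacy class\<close>

context agraph
begin

text \<open>The two ends of an edge are conjugate, so a geometric edge determines its class.\<close>

lemma class_disjoint:
  assumes "C \<in> edge_classes P L" "C' \<in> edge_classes P L" "X \<in> edges_in_class L C" "X \<in> edges_in_class L C'"
  shows "C = C'"
proof -
  obtain e where e: "X = {e, bar L e}" "e \<in> Edges L" "init L e \<in> C" using assms(3) unfolding edges_in_class_def by blast
  obtain e' where e': "X = {e', bar L e'}" "e' \<in> Edges L" "init L e' \<in> C'" using assms(4) unfolding edges_in_class_def by blast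
  obtain g where g: "C = conj_class P L (init L g)" using assms(1) unfolding edge_classes_def by blast
  obtain g' where g': "C' = conj_class P L (init L g')" using assms(2) unfolding edge_classes_def by blast
  have "e' \<in> {e, bar L e}" using e(1) e'(1) by blast
  then have "e' = e \<or> e' = bar L e" by blast
  then have "cj (init L e) (init L e')"
    using cj_edge[OF e(2)] edge[OF e(2)] cj_refl[of "init L e"] by (auto simp: init_bar)
  moreover have "cj (init L g) (init L e)" "cj (init L g') (init L e')" using e(3) e'(3) g g' by (auto simp: conj_class_def)
  ultimately have gg: "cj (init L g) (init L g')" using cj_trans cj_sym by blast
  have "cj (init L g) p \<longleftrightarrow> cj (init L g') p" for p
    using cj_trans[OF gg, of p] cj_trans[OF cj_sym[OF gg], of p] by blast
  then show ?thesis unfolding g g' conj_class_def by blast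
qed

lemma card_edges_in_classes:
  assumes "\<C> \<subseteq> edge_classes P L"
  shows "card (\<Union>C\<in>\<C>. edges_in_class L C) = (\<Sum>C\<in>\<C>. card (edges_in_class L C))"
proof (rule card_UN_disjoint)
  have "edge_classes P L \<subseteq> (\<lambda>e. conj_class P L (init L e)) ` Edges L" unfolding edge_classes_def by blast
  then show "finite \<C>" using assms finE by (meson finite_imageI finite_subset)
  show "\<forall>C\<in>\<C>. finite (edges_in_class L C)" using finE unfolding edges_in_class_def by simp
  show "\<forall>C\<in>\<C>. \<forall>C'\<in>\<C>. C \<noteq> C' \<longrightarrow> edges_in_class L C \<inter> edges_in_class L C' = {}"
    using class_disjoint assms by blast
qed

end

context qgraph
begin

text \<open>In a clean graph the non-floating edges correspond to the minimal points up to sign, so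
  a surplus of edges must float.\<close>

lemma Fl_nonempty:
  assumes "floating_pieces P L Q"
  shows "Fl \<noteq> {}"
proof
  assume F: "Fl = {}"
  have nofl: "\<not> floating_edge P L Q e" for e using Fl_bar[of e] F by blast
  have sub: "geom_edges L \<subseteq> (\<lambda>e. {e, bar L e}) ` Nf"
  proof
    fix X assume "X \<in> geom_edges L"
    then obtain e where e: "e \<in> Edges L" "X = {e, bar L e}" unfolding geom_edges_def by blast
    from edge_cases[OF e(1)] nofl have "e \<in> Nf \<or> bar L e \<in> Nf" by blast
    moreover have "X = {bar L e, bar L (bar L e)}" using e edge[OF e(1)] by auto
    ultimately show "X \<in> (\<lambda>e. {e, bar L e}) ` Nf" using e(2) by blast
  qed
  have "Nf \<subseteq> Edges L" using NfD by blast
  then have finN: "finite Nf" using finE by (rule finite_subset)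
  have "card (geom_edges L) \<le> card Nf"
    by (rule order_trans[OF card_mono[OF finite_imageI[OF finN] sub] card_image_le[OF finN]])
  have at: "at_point a b" if "{a, a \<^bold>+ eps} = {b, b \<^bold>+ eps}" for a b :: "'v point"
    using that unfolding at_point_def by blast
  have "inj_on (\<lambda>e. {init L e, init L e \<^bold>+ eps}) Nf"
  proof (rule inj_onI)
    fix e e' assume e: "e \<in> Nf" "e' \<in> Nf" "{init L e, init L e \<^bold>+ eps} = {init L e', init L e' \<^bold>+ eps}"
    have "at_point (init L e) (init L e)" by (simp add: at_point_def)
    then show "e = e'" using Min_edge_unique[OF _ _ _ _ at[OF e(3)]] NfD[OF e(1)] NfD[OF e(2)] by blast
  qed
  then have "card Nf = card ((\<lambda>e. {init L e, init L e \<^bold>+ eps}) ` Nf)" by (simp add: card_image)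
  also have "(\<lambda>e. {init L e, init L e \<^bold>+ eps}) ` Nf = (\<lambda>m. {m, m \<^bold>+ eps}) ` minpts"
  proof (intro equalityI subsetI)
    fix X assume "X \<in> (\<lambda>m. {m, m \<^bold>+ eps}) ` minpts"
    then obtain m where m: "m \<in> minpts" "X = {m, m \<^bold>+ eps}" by blast
    obtain e where e: "e \<in> Edges L" "at_point m (init L e)" using edge_at[OF m(1)] by blast
    have "e \<in> Nf" using e at_point_Min[OF m(1) e(2)] by (simp add: Nf_def)
    moreover have "X = {init L e, init L e \<^bold>+ eps}" using e(2) unfolding m(2) at_point_def by auto
    ultimately show "X \<in> (\<lambda>e. {init L e, init L e \<^bold>+ eps}) ` Nf" by blast
  qed (use NfD in blast)
  finally show False using assms \<open>card (geom_edges L) \<le> card Nf\<close> unfolding floating_pieces_def by simp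
qed

lemma full_add_sign: "w \<in> full S \<Longrightarrow> c = 0 \<or> c = eps \<Longrightarrow> w + c \<in> full S"
  unfolding full_iff by (auto simp: eps_def)

text \<open>Labels, anchors and reference points come from \<open>L\<close>, endpoints from a second
  graph \<open>N\<close> in normal form for the same data, after sign-changes \<open>c\<close>. This
  puts both graphs of the theorem on one configuration.\<close>

lemma valid_transfer:
  assumes G: "qgraph P N V' Q F\<^sub>0 mF" and supp: "supp_qc P N Q = supp_qc P L Q"
    and \<theta>: "\<And>d. d \<in> Nf \<Longrightarrow> \<theta> d \<in> Edges N \<and> at_point (init L d) (init N (\<theta> d))"
    and \<theta>F: "\<And>d. d \<in> Fl \<Longrightarrow> floating_edge P N Q (\<theta> d)"
    and c: "\<And>d. d \<in> Nf \<union> Fl \<Longrightarrow> c d = 0 \<or> c d = eps"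
    and s: "\<And>d. d \<in> Nf \<union> Fl \<Longrightarrow> s d = (init N (\<theta> d) \<^bold>+ c d, term_of N (\<theta> d) \<^bold>+ c d)"
    and fst: "\<And>d. d \<in> Nf \<Longrightarrow> fst (s d) = init L d"
  shows "config.valid S e\<^sub>0 K J Fl (init L) anc s"
proof -
  interpret T: tagged P S e\<^sub>0 K J Fl "init L" anc by (rule tagged)
  interpret N: qgraph P N V' Q F\<^sub>0 mF by (rule G)
  have NS: "N.S = S" by (simp add: N.S_def S_def supp)
  have fams: "families P N Q = families P L Q" by (simp add: families_def supp)
  have b0: "init L e\<^sub>0 \<in> minpts" "init L e\<^sub>0 \<in> F\<^sub>0" "e\<^sub>0 \<in> Nf" using e0 NfD by auto
  have loop: "\<exists>w\<in>full S. snd (s d) = m \<^bold>+ w"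
    if d: "d \<in> Nf" "F \<in> families P L Q" "init L d \<in> F" "F = F\<^sub>0 \<or> \<not> at_point (mF F) (init L d)" "m \<in> minpts" "m \<in> F" for d F m
  proof -
    have at: "at_point (init L d) (init N (\<theta> d))" and E: "\<theta> d \<in> Edges N" using \<theta>[OF d(1)] by auto
    have M: "init N (\<theta> d) \<in> minpts" by (rule at_point_Min[OF _ at]) (use NfD[OF d(1)] in blast)
    have "init N (\<theta> d) \<in> F" by (rule fam_at_point[OF d(2,3) at])
    moreover have "F = F\<^sub>0 \<or> \<not> at_point (mF F) (init N (\<theta> d))"
      using d(4) at_point_trans[OF _ at_point_sym[OF at]] by blast
    ultimately obtain w where w: "w \<in> full S" "term_of N (\<theta> d) = m \<^bold>+ w"
      using N.nf_loop[OF d(2)[folded fams] E M _ _ d(5,6)] unfolding NS by blast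
    have "snd (s d) = m \<^bold>+ (w + c d)" using s[of d] d(1) unfolding w(2) by simp
    then show ?thesis using full_add_sign[OF w(1) c[of d]] d(1) by blast
  qed
  have e0s: "\<exists>w\<in>full S. s e\<^sub>0 = (init L e\<^sub>0, init L e\<^sub>0 \<^bold>+ w)"
  proof -
    obtain w where "w \<in> full S" "snd (s e\<^sub>0) = init L e\<^sub>0 \<^bold>+ w" using loop[OF b0(3) F0 b0(2) _ b0(1,2)] by blast
    then show ?thesis using fst[OF b0(3)] by (intro bexI[of _ w]) (simp_all add: prod_eq_iff)
  qed
  have Ks: "fst (s k) = init L k \<and> snd (s k) \<in> up S (init L e\<^sub>0)" if k: "k \<in> K" for k
  proof -
    have kN: "k \<in> Nf" using k K_Nf by blast
    have at: "at_point (init L k) (init N (\<theta> k))" and E: "\<theta> k \<in> Edges N" using \<theta>[OF kN] by auto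
    obtain F where F: "F \<in> families P L Q" "F \<noteq> F\<^sub>0" "at_point (mF F) (init L k)" using K_family[OF k] .
    obtain w where w: "w \<in> full S" "term_of N (\<theta> k) = init L e\<^sub>0 \<^bold>+ w"
      using N.nf_connector[OF F(1)[folded fams] F(2) E at_point_trans[OF F(3) at] b0(1,2)] unfolding NS by blast
    have "snd (s k) = init L e\<^sub>0 \<^bold>+ (w + c k)" using s[of k] kN unfolding w(2) by simp
    moreover have "w + c k \<in> Apos S" using full_Apos[OF full_add_sign[OF w(1) c[of k]]] kN by blast
    ultimately show ?thesis using fst[OF kN] upI by metis
  qed
  have Js: "snd (s j) \<in> up S (init L (anc j)) \<and> (if j \<in> Fl then fst (s j) \<in> up S (init L e\<^sub>0) else fst (s j) = init L j)"
    if j: "j \<in> J" for j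
  proof (cases "j \<in> Fl")
    case True
    obtain w w' where w: "w \<in> full S" "init N (\<theta> j) = init L e\<^sub>0 \<^bold>+ w" "w' \<in> full S" "term_of N (\<theta> j) = init L e\<^sub>0 \<^bold>+ w'"
      using N.nf_floating[OF \<theta>F[OF True] b0(1,2)] unfolding NS by blast
    have "s j = (init L e\<^sub>0 \<^bold>+ (w + c j), init L e\<^sub>0 \<^bold>+ (w' + c j))" using s[of j] True unfolding w(2,4) by simp
    moreover have "w + c j \<in> Apos S" "w' + c j \<in> Apos S"
      using full_Apos[OF full_add_sign[OF w(1) c[of j]]] full_Apos[OF full_add_sign[OF w(3) c[of j]]] True by blast+
    ultimately show ?thesis using True anc_F0[of j] by simp
  next
    case False
    then have jN: "j \<in> Nf" "j \<notin> K" using j by (auto simp: J_def)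
    have "\<exists>w\<in>full S. snd (s j) = init L (anc j) \<^bold>+ w"
    proof (cases "init L j \<in> F\<^sub>0")
      case True
      then show ?thesis using loop[OF jN(1) F0 True _ b0(1,2)] anc_F0[of j] by auto
    next
      case nF: False
      let ?F = "fam (init L j)"
      have a: "anc j \<in> K" "init L (anc j) \<in> ?F" "?F \<in> families P L Q" "?F \<noteq> F\<^sub>0" using anc_other[OF jN(1) nF] by auto
      have "\<not> at_point (mF ?F) (init L j)" using jN a(3,4) unfolding K_def by blast
      moreover have "init L (anc j) \<in> minpts" using a(1) K_Nf NfD by blast
      moreover have "init L j \<in> ?F" using fam_in init_Q NfD[OF jN(1)] by blast
      ultimately show ?thesis using loop[OF jN(1) a(3) _ _ _ a(2)] by blast
    qed
    then obtain w where w: "w \<in> full S" "snd (s j) = init L (anc j) \<^bold>+ w" by blast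
    have "snd (s j) \<in> up S (init L (anc j))" unfolding w(2) by (rule upI[OF full_Apos[OF w(1)]])
    then show ?thesis using False fst[OF jN(1)] by simp
  qed
  show ?thesis unfolding T.valid_def using e0s Ks Js by blast
qed

end

text \<open>Each geometric edge has exactly one representative in \<open>Nf\<close> or
  \<open>Fl\<close>, and by \<open>f\<close> it does not matter which orientation is
  counted.\<close>

lemma (in qgraph) card_edges_split:
  assumes f: "\<And>e. e \<in> Edges L \<Longrightarrow> f (term_of L e) = f (init L e)"
  shows "card ((\<lambda>e. {e, bar L e}) ` {e \<in> Edges L. f (init L e) = \<kappa>}) =
    card {e \<in> Nf. f (init L e) = \<kappa>} + card {e \<in> Fl. f (init L e) = \<kappa>}"
proof -
  let ?A = "{e \<in> Nf. f (init L e) = \<kappa>}" and ?B = "{e \<in> Fl. f (init L e) = \<kappa>}"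
  have "(\<lambda>e. {e, bar L e}) ` {e \<in> Edges L. f (init L e) = \<kappa>} = (\<lambda>e. {e, bar L e}) ` (?A \<union> ?B)"
  proof (intro equalityI subsetI)
    fix X assume "X \<in> (\<lambda>e. {e, bar L e}) ` {e \<in> Edges L. f (init L e) = \<kappa>}"
    then obtain e where e: "e \<in> Edges L" "f (init L e) = \<kappa>" "X = {e, bar L e}" by blast
    have X: "X = {bar L e, bar L (bar L e)}" using e(3) edge[OF e(1)] by auto
    have fb: "f (init L (bar L e)) = \<kappa>" using f[OF e(1)] e(2) by (simp add: init_bar)
    have "e \<in> Nf \<union> Fl \<or> bar L e \<in> Nf \<union> Fl" using edge_cases[OF e(1)] Fl_bar[of e] by blast
    then show "X \<in> (\<lambda>e. {e, bar L e}) ` (?A \<union> ?B)"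
    proof
      assume "e \<in> Nf \<union> Fl"
      then have "e \<in> ?A \<union> ?B" using e(2) by blast
      then show ?thesis using e(3) by blast
    next
      assume "bar L e \<in> Nf \<union> Fl"
      then have "bar L e \<in> ?A \<union> ?B" using fb by blast
      then show ?thesis using X by blast
    qed
  next
    fix X assume "X \<in> (\<lambda>e. {e, bar L e}) ` (?A \<union> ?B)"
    then obtain e where e: "e \<in> Nf \<union> Fl" "f (init L e) = \<kappa>" "X = {e, bar L e}" by blast
    then have "e \<in> Edges L" using NfD FlD by blast
    then show "X \<in> (\<lambda>e. {e, bar L e}) ` {e \<in> Edges L. f (init L e) = \<kappa>}" using e by blast
  qed
  moreover have "inj_on (\<lambda>e. {e, bar L e}) (?A \<union> ?B)"
  proof (rule inj_onI)
    fix e e' assume e: "e \<in> ?A \<union> ?B" "e' \<in> ?A \<union> ?B" "{e, bar L e} = {e', bar L e'}"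
    have "e \<in> insert e\<^sub>0 (K \<union> J)" "e' \<in> insert e\<^sub>0 (K \<union> J)" using e(1,2) unfolding Ed_eq by auto
    then have "e \<noteq> e' \<longrightarrow> e \<noteq> bar L e'" using rep_ends unfolding rep_def id_apply by blast
    then show "e = e'" using e(3) by blast
  qed
  moreover have "card (?A \<union> ?B) = card ?A + card ?B"
  proof (rule card_Un_disjoint)
    have "?A \<subseteq> Edges L" "?B \<subseteq> Edges L" using NfD FlD by blast+
    then show "finite ?A" "finite ?B" using finE finite_subset by blast+
    show "?A \<inter> ?B = {}" using FlD by blast
  qed
  ultimately show ?thesis by (simp add: card_image)
qed

section \<open>Source and target graph together\<close>

lemma zspan_insert_eps:
  assumes "v \<in> zspan (insert eps A)"
  obtains c where "c = 0 \<or> c = eps" "v - c \<in> zspan A"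
proof -
  have "v \<in> zspan ({eps} \<union> A)" using assms by simp
  then obtain n w where v: "v = zmult n eps + w" "w \<in> zspan A"
    unfolding zmod.span_Un zmod.span_singleton by blast
  have "snd (zmult n eps) r = 0" for r unfolding snd_zmult by (simp add: eps_def)
  then have "snd (zmult n eps) = 0" by (simp add: fun_eq_iff)
  then have "zmult n eps = 0 \<or> zmult n eps = eps"
    by (cases "fst (zmult n eps)") (simp_all add: eps_def prod_eq_iff)
  then show ?thesis using that[of "zmult n eps"] v by simp
qed

text \<open>\<open>M\<close> is the target and supplies the labels, the reference points and the
  positions \<open>Pt\<close>; \<open>L\<close> is the source, whose endpoints are to be moved to
  those of \<open>M\<close>.\<close>

locale gbs_pair = D: qgraph P M V Q F\<^sub>0 mF + G: qgraph P L V Q F\<^sub>0 mF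
  for P :: "nat set" and M :: "('v point, 'f) sgraph" and L :: "('v point, 'e) sgraph" and V :: "'v set"
    and Q F\<^sub>0 :: "'v point set" and mF :: "'v point set \<Rightarrow> 'v point" +
  assumes supp: "supp_qc P L Q = supp_qc P M Q" and lin: "lin_qc P L Q = lin_qc P M Q"
    and counts: "same_class_counts P L M" and pieces: "floating_pieces P M Q"
begin

sublocale T: tagged P D.S D.e\<^sub>0 D.K D.J D.Fl "init M" D.anc
  by (rule D.tagged)

abbreviation "W \<equiv> zspan (gen (ends M) ` T.I)"
abbreviation "W' \<equiv> zspan (insert eps (gen (ends M) ` T.I))"
abbreviation "Pt \<equiv> T.Pot (ends M)"

lemma W_W': "v \<in> W \<Longrightarrow> v \<in> W'"
  using zmod.span_mono[of "gen (ends M) ` T.I" "insert eps (gen (ends M) ` T.I)"] by blast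

lemma c_asub: "c = 0 \<or> c = eps \<Longrightarrow> c \<in> asub S"
  using asub_0[of S] asub_eps[of S] by metis

lemma valid_M: "T.valid (ends M)"
proof (rule D.valid_transfer[OF D.qgraph_axioms refl, of id "\<lambda>_. 0"])
  show "id d \<in> Edges M \<and> at_point (init M d) (init M (id d))" if "d \<in> D.Nf" for d
    using D.NfD[OF that] by (simp add: at_point_def)
  show "floating_edge P M Q (id d)" if "d \<in> D.Fl" for d using D.FlD[OF that] by simp
qed (simp_all add: ends_def)

lemma conn_M: "iconj P (Edges M) (ends M) = iconj P T.Ed (ends M)"
  by (rule rep_iconj[OF D.rep_ends])

lemma Ed_edge: "d \<in> T.Ed \<Longrightarrow> d \<in> Edges M"
  unfolding D.Ed_eq using D.NfD D.FlD by blast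

lemma Pot_ex: "p \<in> Q \<Longrightarrow> \<exists>v. Pt p v"
proof -
  assume "p \<in> Q"
  then obtain k where k: "k \<in> insert D.e\<^sub>0 D.K" "same_family D.S (init M k) p" using D.cover by blast
  then have a: "snd p - snd (init M k) \<in> asub D.S" "fst (init M k) = fst p" unfolding D.same_family_iff by auto
  have "p = init M k \<^bold>+ (snd p - snd (init M k))" by (rule shift_eqI) (simp_all add: a(2))
  then show ?thesis using T.PotI[OF k(1) a(1), of "ends M"] by metis
qed

lemma Pot_cj:
  assumes "p \<in> Q" "D.cj p q" "Pt p a"
  shows "\<exists>b. Pt q b \<and> b - a \<in> W"
proof -
  have ic: "iconj P T.Ed (ends M) p q" using assms(2) unfolding D.conjugate_iff conn_M by blast
  have "q \<in> Q \<and> (\<exists>b. Pt q b \<and> b - a \<in> W)"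
  proof (rule T.Pot_iconj[OF valid_M _ _ ic assms(1,3)])
    show "w \<in> Apos D.S" if "d \<in> T.Ed" "w \<in> Apos P" "fst (ends M d) \<^bold>+ w \<in> Q \<or> snd (ends M d) \<^bold>+ w \<in> Q" for d w
      using that(2,3) D.gap_S[OF D.init_Q[OF Ed_edge[OF that(1)]]] D.gap_S[OF D.term_Q[OF Ed_edge[OF that(1)]]]
      unfolding fst_ends snd_ends by blast
    show "fst (ends M d) \<^bold>+ w \<in> Q \<and> snd (ends M d) \<^bold>+ w \<in> Q" if "d \<in> T.Ed" "w \<in> Apos D.S" for d w
      using that(2) D.up_Q[OF D.init_Q[OF Ed_edge[OF that(1)]]] D.up_Q[OF D.term_Q[OF Ed_edge[OF that(1)]]]
      unfolding fst_ends snd_ends by blast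
  qed
  then show ?thesis by blast
qed

text \<open>The coset of the transported position modulo \<open>W'\<close>. It is an invariant of
  conjugacy in \<open>M\<close> that ignores signs, as the edge counts are given only up to
  sign-changes.\<close>

definition kap :: "'v point \<Rightarrow> avec set" where
  "kap p = {v. \<exists>u. Pt p u \<and> v - u \<in> W'}"

lemma kap_eqI:
  assumes "Pt p a" "Pt q b" "b - a \<in> W'"
  shows "kap p = kap q"
proof -
  have k: "kap p = {v. v - a \<in> W'}" "kap q = {v. v - b \<in> W'}"
    unfolding kap_def using T.Pot_unique assms(1,2) by blast+
  have "v - a \<in> W' \<longleftrightarrow> v - b \<in> W'" for v
  proof
    assume "v - a \<in> W'"
    from zmod.span_diff[OF this assms(3)] show "v - b \<in> W'" by simp
  next
    assume "v - b \<in> W'"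
    from zmod.span_add[OF this assms(3)] show "v - a \<in> W'" by simp
  qed
  then show ?thesis unfolding k by blast
qed

lemma kap_eqD:
  assumes "kap p = kap q" "Pt p a" "Pt q b"
  shows "a - b \<in> W'"
proof -
  have "a - a \<in> W'" by (simp add: zmod.span_zero)
  then have "a \<in> kap p" unfolding kap_def using assms(2) by blast
  then obtain u where "Pt q u" "a - u \<in> W'" unfolding assms(1) unfolding kap_def by blast
  then show ?thesis using T.Pot_unique[OF _ assms(3)] by blast
qed

lemma kap_cj:
  assumes "p \<in> Q" "D.cj p q"
  shows "kap p = kap q"
proof -
  obtain a where a: "Pt p a" using Pot_ex[OF assms(1)] by blast
  obtain b where "Pt q b" "b - a \<in> W" using Pot_cj[OF assms a] by blast
  then show ?thesis using kap_eqI[OF a] W_W' by blast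
qed

lemma kap_sign:
  assumes "p \<in> Q" "c = 0 \<or> c = eps"
  shows "kap (p \<^bold>+ c) = kap p"
proof -
  obtain a where a: "Pt p a" using Pot_ex[OF assms(1)] by blast
  have b: "Pt (p \<^bold>+ c) (a + c)" by (rule T.Pot_shift[OF a c_asub[OF assms(2)]])
  have "c \<in> W'" using assms(2) zmod.span_zero zmod.span_base[of eps "insert eps (gen (ends M) ` T.I)"] by blast
  then have "a + c - a \<in> W'" by simp
  from kap_eqI[OF a b this] show ?thesis by simp
qed

text \<open>Since \<open>kap\<close> is constant on every edge class of \<open>M\<close>, the edges
  with a given value make up a union of common classes. This is used for \<open>M\<close> itself and
  for a sign-changed copy of \<open>L\<close>.\<close>

lemma edges_of_kap:
  assumes N: "agraph P N V" and cl: "edge_classes P N = edge_classes P M"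
    and Q: "\<And>e. e \<in> Edges N \<Longrightarrow> init N e \<in> Q"
  shows "card ((\<lambda>e. {e, bar N e}) ` {e \<in> Edges N. kap (init N e) = \<kappa>}) =
    (\<Sum>C | C \<in> edge_classes P M \<and> (\<exists>p\<in>C. p \<in> Q \<and> kap p = \<kappa>). card (edges_in_class N C))"
proof -
  interpret N: agraph P N V by (rule N)
  let ?C = "{C \<in> edge_classes P M. \<exists>p\<in>C. p \<in> Q \<and> kap p = \<kappa>}"
  have "(\<lambda>e. {e, bar N e}) ` {e \<in> Edges N. kap (init N e) = \<kappa>} = (\<Union>C\<in>?C. edges_in_class N C)"
  proof (intro equalityI subsetI)
    fix X assume "X \<in> (\<lambda>e. {e, bar N e}) ` {e \<in> Edges N. kap (init N e) = \<kappa>}"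
    then obtain e where e: "e \<in> Edges N" "kap (init N e) = \<kappa>" "X = {e, bar N e}" by blast
    define C where "C = conj_class P N (init N e)"
    have "C \<in> edge_classes P N" unfolding edge_classes_def C_def using e(1) by blast
    then have "C \<in> edge_classes P M" using cl by simp
    moreover have i: "init N e \<in> C" unfolding C_def conj_class_def using N.cj_refl N.edge[OF e(1)] by blast
    ultimately have "C \<in> ?C" using e(2) Q[OF e(1)] by blast
    moreover have "X \<in> edges_in_class N C" unfolding edges_in_class_def using e i by blast
    ultimately show "X \<in> (\<Union>C\<in>?C. edges_in_class N C)" by blast
  next
    fix X assume "X \<in> (\<Union>C\<in>?C. edges_in_class N C)"
    then obtain C p where C: "C \<in> edge_classes P M" "p \<in> C" "p \<in> Q" "kap p = \<kappa>" "X \<in> edges_in_class N C" by blast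
    obtain e where e: "X = {e, bar N e}" "e \<in> Edges N" "init N e \<in> C" using C(5) unfolding edges_in_class_def by blast
    obtain g where g: "g \<in> Edges M" "C = conj_class P M (init M g)" using C(1) unfolding edge_classes_def by blast
    have "D.cj (init M g) p" "D.cj (init M g) (init N e)" using C(2) e(3) unfolding g(2) conj_class_def by blast+
    then have "kap (init N e) = \<kappa>" using kap_cj[OF D.init_Q[OF g(1)]] C(4) by metis
    then show "X \<in> (\<lambda>e. {e, bar N e}) ` {e \<in> Edges N. kap (init N e) = \<kappa>}" using e by blast
  qed
  moreover have "?C \<subseteq> edge_classes P N" unfolding cl by blast
  ultimately show ?thesis using N.card_edges_in_classes[of ?C] by simp
qed

text \<open>Conjugacy in \<open>L\<close> and in \<open>M\<close> are a priori different relations.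
  After sign-changes, however, each edge of \<open>L\<close> lies in a class that is also a class of
  \<open>M\<close>; so its ends are conjugate in \<open>M\<close>, where \<open>kap\<close> is
  invariant.\<close>

lemma cj_M_edge: "e \<in> Edges L \<Longrightarrow> D.cj (init L e) (term_of L e)"
  and card_kap: "card ((\<lambda>e. {e, bar L e}) ` {e \<in> Edges L. kap (init L e) = \<kappa>}) =
    card ((\<lambda>e. {e, bar M e}) ` {e \<in> Edges M. kap (init M e) = \<kappa>})"
proof -
  obtain L' where L': "sign_change\<^sup>*\<^sup>* L L'" "edge_classes P L' = edge_classes P M"
    "\<And>C. C \<in> edge_classes P M \<Longrightarrow> card (edges_in_class L' C) = card (edges_in_class M C)"
    using counts unfolding same_class_counts_def by blast
  have sc: "Edges L' = Edges L" "bar L' = bar L" "Verts L' = Verts L"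
    "\<And>e. e \<in> Edges L \<Longrightarrow> \<exists>c. (c = 0 \<or> c = eps) \<and> init L' e = init L e \<^bold>+ c \<and> term_of L' e = term_of L e \<^bold>+ c"
    using sign_changes[OF L'(1)] G.edge by blast+
  have Q': "init L' e \<in> Q" "kap (init L' e) = kap (init L e)" if e: "e \<in> Edges L" for e
  proof -
    obtain c where "c = 0 \<or> c = eps" "init L' e = init L e \<^bold>+ c" using sc(4)[OF e] by blast
    then show "init L' e \<in> Q" "kap (init L' e) = kap (init L e)"
      using D.eps_Q[OF G.init_Q[OF e]] G.init_Q[OF e] kap_sign[OF G.init_Q[OF e]] by auto
  qed
  interpret H: agraph P L' V
  proof
    show "finite P" by (rule D.finP)
    show "finite (Edges L')" using G.finE sc(1) by simp
    show "Verts L' = V \<times> Apos P" using G.VL sc(3) by simp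
    fix e assume "e \<in> Edges L'"
    then have e: "e \<in> Edges L" using sc(1) by simp
    have "init L' e \<in> Verts L'" using G.Q_Verts[OF Q'(1)[OF e]] sc(3) by simp
    then show "init L' e \<in> Verts L' \<and> bar L' e \<in> Edges L' \<and> bar L' (bar L' e) = e \<and> bar L' e \<noteq> e"
      using G.edge[OF e] sc by simp
  qed
  show "D.cj (init L e) (term_of L e)" if e: "e \<in> Edges L" for e
  proof -
    obtain c where c: "c = 0 \<or> c = eps" "init L' e = init L e \<^bold>+ c" "term_of L' e = term_of L e \<^bold>+ c" using sc(4)[OF e] by blast
    have e': "e \<in> Edges L'" using e sc(1) by simp
    define C where "C = conj_class P L' (init L' e)"
    have "C \<in> edge_classes P L'" unfolding edge_classes_def C_def using e' by blast
    then have "C \<in> edge_classes P M" using L'(2) by simp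
    then obtain g where g: "C = conj_class P M (init M g)" unfolding edge_classes_def by blast
    have "init L' e \<in> C" "term_of L' e \<in> C" unfolding C_def conj_class_def
      using H.cj_refl H.edge[OF e'] H.cj_edge[OF e'] by blast+
    then have "D.cj (init M g) (init L' e)" "D.cj (init M g) (term_of L' e)" unfolding g conj_class_def by blast+
    then have 1: "D.cj (init L' e) (term_of L' e)" using D.cj_sym D.cj_trans by blast
    \<comment> \<open>Shifting by \<open>c\<close> once more undoes the sign-change.\<close>
    have "c \<in> Apos P" "c + c = 0" using c(1) by auto
    then show ?thesis using D.cj_shift[OF 1, of c] unfolding c(2,3) by simp
  qed
  have "{e \<in> Edges L. kap (init L e) = \<kappa>} = {e \<in> Edges L'. kap (init L' e) = \<kappa>}"
    using Q'(2) sc(1) by auto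
  then have "card ((\<lambda>e. {e, bar L e}) ` {e \<in> Edges L. kap (init L e) = \<kappa>}) =
      card ((\<lambda>e. {e, bar L' e}) ` {e \<in> Edges L'. kap (init L' e) = \<kappa>})" by (simp only: sc(2))
  also have "\<dots> = (\<Sum>C | C \<in> edge_classes P M \<and> (\<exists>p\<in>C. p \<in> Q \<and> kap p = \<kappa>). card (edges_in_class L' C))"
    by (rule edges_of_kap[OF H.agraph_axioms L'(2)]) (use Q'(1) sc(1) in simp)
  also have "\<dots> = (\<Sum>C | C \<in> edge_classes P M \<and> (\<exists>p\<in>C. p \<in> Q \<and> kap p = \<kappa>). card (edges_in_class M C))"
    by (rule sum.cong) (use L'(3) in auto)
  also have "\<dots> = card ((\<lambda>e. {e, bar M e}) ` {e \<in> Edges M. kap (init M e) = \<kappa>})"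
    by (rule edges_of_kap[OF D.agraph_axioms refl D.init_Q, symmetric])
  finally show "card ((\<lambda>e. {e, bar L e}) ` {e \<in> Edges L. kap (init L e) = \<kappa>}) =
    card ((\<lambda>e. {e, bar M e}) ` {e \<in> Edges M. kap (init M e) = \<kappa>})" .
qed

definition "partner d \<equiv> (THE e. e \<in> Edges L \<and> at_point (init M d) (init L e))"

lemma partner:
  assumes "d \<in> D.Nf"
  shows "partner d \<in> Edges L" "at_point (init M d) (init L (partner d))" "partner d \<in> G.Nf"
proof -
  have m: "init M d \<in> D.minpts" using D.NfD[OF assms] by blast
  have "partner d \<in> Edges L \<and> at_point (init M d) (init L (partner d))"
    unfolding partner_def by (rule theI'[OF G.edge_at[OF m]])
  then show "partner d \<in> Edges L" "at_point (init M d) (init L (partner d))" by blast+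
  then show "partner d \<in> G.Nf" using D.at_point_Min[OF m] unfolding G.Nf_def by blast
qed

lemma partner_bij: "bij_betw partner D.Nf G.Nf"
proof -
  have "inj_on partner D.Nf"
  proof (rule inj_onI)
    fix d d' assume d: "d \<in> D.Nf" "d' \<in> D.Nf" "partner d = partner d'"
    have "at_point (init M d) (init L (partner d'))" using partner(2)[OF d(1)] d(3) by simp
    then have "at_point (init M d) (init M d')"
      using D.at_point_trans D.at_point_sym[OF partner(2)[OF d(2)]] by blast
    moreover have "at_point (init M d) (init M d)" by (simp add: at_point_def)
    ultimately show "d = d'" using D.Min_edge_unique D.NfD[OF d(1)] D.NfD[OF d(2)] by blast
  qed
  moreover have "partner ` D.Nf = G.Nf"
  proof (intro equalityI subsetI)
    fix e assume e: "e \<in> G.Nf"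
    then have m: "init L e \<in> D.minpts" using G.NfD by blast
    obtain d where d: "d \<in> Edges M" "at_point (init L e) (init M d)" using D.edge_at[OF m] by blast
    have dN: "d \<in> D.Nf" using D.at_point_Min[OF m d(2)] d(1) unfolding D.Nf_def by blast
    have "partner d = e"
      using G.Min_edge_unique[OF partner(1)[OF dN] _ _ partner(2)[OF dN] D.at_point_sym[OF d(2)]]
        G.NfD[OF e] D.NfD[OF dN] by blast
    then show "e \<in> partner ` D.Nf" using dN by blast
  qed (use partner(3) in blast)
  ultimately show ?thesis by (simp add: bij_betw_def)
qed

lemma kap_partner: "d \<in> D.Nf \<Longrightarrow> kap (init L (partner d)) = kap (init M d)"
proof -
  assume d: "d \<in> D.Nf"
  have "init M d \<in> Q" using D.init_Q D.NfD[OF d] by blast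
  from kap_sign[OF this, of eps] partner(2)[OF d] show ?thesis unfolding at_point_def by (elim disjE) simp_all
qed

text \<open>For each value of \<open>kap\<close> the total numbers of edges agree, and so do those
  of the non-floating edges, which are matched by their minimal points; hence the numbers of
  floating edges agree.\<close>

lemma floating_bij: "\<exists>\<gamma>. bij_betw \<gamma> D.Fl G.Fl \<and> (\<forall>d\<in>D.Fl. kap (init L (\<gamma> d)) = kap (init M d))"
proof (rule bij_of_equal_fibres)
  have "D.Fl \<subseteq> Edges M" "G.Fl \<subseteq> Edges L" using D.FlD G.FlD by blast+
  then show "finite D.Fl" "finite G.Fl" using D.finE G.finE finite_subset by blast+
  fix \<kappa>
  have "bij_betw partner {d \<in> D.Nf. kap (init M d) = \<kappa>} {e \<in> G.Nf. kap (init L e) = \<kappa>}"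
  proof (rule bij_betw_subset[OF partner_bij])
    show "partner ` {d \<in> D.Nf. kap (init M d) = \<kappa>} = {e \<in> G.Nf. kap (init L e) = \<kappa>}"
    proof (intro equalityI subsetI)
      fix e assume e: "e \<in> {e \<in> G.Nf. kap (init L e) = \<kappa>}"
      then obtain d where "d \<in> D.Nf" "e = partner d" using bij_betw_imp_surj_on[OF partner_bij] by blast
      then show "e \<in> partner ` {d \<in> D.Nf. kap (init M d) = \<kappa>}" using kap_partner[of d] e by auto
    qed (use partner(3) kap_partner in auto)
  qed blast
  then have "card {d \<in> D.Nf. kap (init M d) = \<kappa>} = card {e \<in> G.Nf. kap (init L e) = \<kappa>}"
    by (rule bij_betw_same_card)
  moreover have "card ((\<lambda>e. {e, bar L e}) ` {e \<in> Edges L. kap (init L e) = \<kappa>}) =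
      card {e \<in> G.Nf. kap (init L e) = \<kappa>} + card {e \<in> G.Fl. kap (init L e) = \<kappa>}"
    by (rule G.card_edges_split) (use kap_cj[OF G.init_Q cj_M_edge] in simp)
  moreover have "card ((\<lambda>e. {e, bar M e}) ` {e \<in> Edges M. kap (init M e) = \<kappa>}) =
      card {e \<in> D.Nf. kap (init M e) = \<kappa>} + card {e \<in> D.Fl. kap (init M e) = \<kappa>}"
    by (rule D.card_edges_split) (use kap_cj[OF D.init_Q D.cj_edge] in simp)
  ultimately show "card {a \<in> D.Fl. kap (init M a) = \<kappa>} = card {b \<in> G.Fl. kap (init L b) = \<kappa>}"
    using card_kap[of \<kappa>] by simp
qed

theorem moves_to: "\<exists>N. (move P)\<^sup>*\<^sup>* L N \<and> same_graph N M"
proof -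
  obtain \<gamma> where \<gamma>: "bij_betw \<gamma> D.Fl G.Fl" "\<And>d. d \<in> D.Fl \<Longrightarrow> kap (init L (\<gamma> d)) = kap (init M d)"
    using floating_bij by blast
  have GS: "G.S = D.S" by (simp add: G.S_def D.S_def supp)
  define \<theta> where "\<theta> d = (if d \<in> D.Nf then partner d else \<gamma> d)" for d
  have \<theta>N: "\<theta> d = partner d" if "d \<in> D.Nf" for d using that by (simp add: \<theta>_def)
  have \<theta>F: "\<theta> d = \<gamma> d" if "d \<in> D.Fl" for d using that D.FlD by (auto simp: \<theta>_def)
  have "bij_betw \<theta> (D.Nf \<union> D.Fl) (G.Nf \<union> G.Fl)"
  proof (rule bij_betw_combine)
    show "bij_betw \<theta> D.Nf G.Nf" using bij_betw_cong[of D.Nf \<theta> partner G.Nf] \<theta>N partner_bij by blast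
    show "bij_betw \<theta> D.Fl G.Fl" using bij_betw_cong[of D.Fl \<theta> \<gamma> G.Fl] \<theta>F \<gamma>(1) by blast
    show "G.Nf \<inter> G.Fl = {}" using G.FlD by blast
  qed
  then have bij: "bij_betw \<theta> T.Ed (insert G.e\<^sub>0 (G.K \<union> G.J))" unfolding D.Ed_eq G.Ed_eq .
  define s\<^sub>0 where "s\<^sub>0 d = ends L (\<theta> d)" for d
  have rep0: "rep (Verts L) T.Ed L \<theta> s\<^sub>0" unfolding s\<^sub>0_def by (rule rep_reindex[OF G.rep_ends bij])
  have \<theta>E: "\<theta> d \<in> Edges L" if "d \<in> T.Ed" for d
    using bij_betw_apply[OF bij that] G.NfD G.FlD unfolding G.Ed_eq by blast
  have b0: "init M D.e\<^sub>0 \<in> D.minpts" "init M D.e\<^sub>0 \<in> F\<^sub>0" using D.e0 D.NfD by auto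
  have fl: "\<exists>w\<in>full D.S. init M d = init M D.e\<^sub>0 \<^bold>+ w" "\<exists>w\<in>full D.S. init L (\<gamma> d) = init M D.e\<^sub>0 \<^bold>+ w"
    if d: "d \<in> D.Fl" for d
  proof -
    have "floating_edge P M Q d" using D.FlD[OF d] by blast
    then show "\<exists>w\<in>full D.S. init M d = init M D.e\<^sub>0 \<^bold>+ w" using D.nf_floating b0 by blast
    have "\<gamma> d \<in> G.Fl" by (rule bij_betw_apply[OF \<gamma>(1) d])
    then have "floating_edge P L Q (\<gamma> d)" using G.FlD by blast
    then show "\<exists>w\<in>full D.S. init L (\<gamma> d) = init M D.e\<^sub>0 \<^bold>+ w" using G.nf_floating b0 GS by metis
  qed
  \<comment> \<open>The sign to be changed on each edge: on a non-floating edge it makes the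
    starting points equal, on a floating one it improves agreement modulo \<open>W'\<close> to
    agreement modulo \<open>W\<close>.\<close>
  have "\<exists>x. (x = 0 \<or> x = eps) \<and> (d \<in> D.Nf \<longrightarrow> init L (\<theta> d) \<^bold>+ x = init M d) \<and>
      (d \<in> D.Fl \<longrightarrow> snd (init M d) - snd (init L (\<theta> d) \<^bold>+ x) \<in> W)" for d
  proof (cases "d \<in> D.Nf")
    case True
    then have "d \<notin> D.Fl" using D.FlD by blast
    moreover have "init L (\<theta> d) = init M d \<or> init L (\<theta> d) = init M d \<^bold>+ eps"
      using partner(2)[OF True] unfolding \<theta>N[OF True] at_point_def .
    then have "init L (\<theta> d) \<^bold>+ 0 = init M d \<or> init L (\<theta> d) \<^bold>+ eps = init M d" by auto
    ultimately show ?thesis by blast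
  next
    case N: False
    show ?thesis
    proof (cases "d \<in> D.Fl")
      case True
      obtain w where w: "w \<in> full D.S" "init M d = init M D.e\<^sub>0 \<^bold>+ w" using fl(1)[OF True] by blast
      obtain w' where w': "w' \<in> full D.S" "init L (\<gamma> d) = init M D.e\<^sub>0 \<^bold>+ w'" using fl(2)[OF True] by blast
      have "Pt (init M d) w" "Pt (init L (\<gamma> d)) w'" unfolding w(2) w'(2)
        using T.PotI[of D.e\<^sub>0 w "ends M"] T.PotI[of D.e\<^sub>0 w' "ends M"] Apos_asub[OF full_Apos[OF w(1)]]
          Apos_asub[OF full_Apos[OF w'(1)]] by simp_all
      then have "w - w' \<in> W'" using kap_eqD[OF \<gamma>(2)[OF True, symmetric]] by blast
      then obtain c where c: "c = 0 \<or> c = eps" "w - w' - c \<in> W" by (rule zspan_insert_eps)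
      have eq: "snd (init M d) - snd (init L (\<theta> d) \<^bold>+ c) = w - w' - c"
        unfolding \<theta>F[OF True] w(2) w'(2) by simp
      have "snd (init M d) - snd (init L (\<theta> d) \<^bold>+ c) \<in> W" unfolding eq by (rule c(2))
      then show ?thesis using c(1) N by blast
    qed (use N in blast)
  qed
  then obtain c where c: "\<And>d. c d = 0 \<or> c d = eps" "\<And>d. d \<in> D.Nf \<Longrightarrow> init L (\<theta> d) \<^bold>+ c d = init M d"
    "\<And>d. d \<in> D.Fl \<Longrightarrow> snd (init M d) - snd (init L (\<theta> d) \<^bold>+ c d) \<in> W" by metis
  define s where "s = signed T.Ed c s\<^sub>0"
  have s_eq: "s d = (init L (\<theta> d) \<^bold>+ c d, term_of L (\<theta> d) \<^bold>+ c d)" if "d \<in> T.Ed" for d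
    using that by (simp add: s_def signed_def s\<^sub>0_def)
  have finEd: "finite T.Ed" using T.fin by simp
  have s0s: "(st P T.Ed)\<^sup>*\<^sup>* s\<^sub>0 s" unfolding s_def by (rule signed_sts[OF finEd subset_refl c(1)])
  have vs: "T.valid s"
  proof (rule D.valid_transfer[OF G.qgraph_axioms supp, of \<theta> c])
    show "\<theta> d \<in> Edges L \<and> at_point (init M d) (init L (\<theta> d))" if "d \<in> D.Nf" for d
      using partner[OF that] \<theta>N[OF that] by simp
    show "floating_edge P L Q (\<theta> d)" if "d \<in> D.Fl" for d
      using bij_betw_apply[OF \<gamma>(1) that] G.FlD \<theta>F[OF that] by simp
    show "s d = (init L (\<theta> d) \<^bold>+ c d, term_of L (\<theta> d) \<^bold>+ c d)" if "d \<in> D.Nf \<union> D.Fl" for d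
      using s_eq that unfolding D.Ed_eq by blast
    show "fst (s d) = init M d" if "d \<in> D.Nf" for d
    proof -
      have "d \<in> T.Ed" unfolding D.Ed_eq using that by blast
      then show ?thesis using s_eq c(2)[OF that] by simp
    qed
  qed (rule c(1))
  have sQ: "fst (s d) \<in> Q \<and> snd (s d) \<in> Q" if "d \<in> T.Ed" for d
    using c(1)[of d] G.init_Q[OF \<theta>E[OF that]] G.term_Q[OF \<theta>E[OF that]]
      D.eps_Q[OF G.init_Q[OF \<theta>E[OF that]]] D.eps_Q[OF G.term_Q[OF \<theta>E[OF that]]]
    unfolding s_eq[OF that] fst_conv snd_conv by (elim disjE) simp_all
  have "lin_qc P L Q = zspan (gen s ` insert D.e\<^sub>0 D.J)"
  proof (rule lin_qc_eq_zspan[OF G.qgraph_axioms])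
    show "tagged P (supp_qc P L Q) D.e\<^sub>0 D.K D.J D.Fl (init M) D.anc"
      using D.tagged unfolding D.S_def supp .
    show "config.valid (supp_qc P L Q) D.e\<^sub>0 D.K D.J D.Fl (init M) D.anc s"
      using vs unfolding D.S_def supp .
    show "iconj P (Edges L) (ends L) p q = iconj P T.Ed s p q" for p q
      unfolding rep_iconj[OF rep0] s_def using signed_iconj[of T.Ed c P s\<^sub>0] c(1) by simp
    show "\<exists>k\<in>insert D.e\<^sub>0 D.K. same_family (supp_qc P L Q) (init M k) p" if "p \<in> Q" for p
      using D.cover[OF that] unfolding D.S_def supp .
  qed (rule sQ)
  moreover have "lin_qc P M Q = W"
  proof (rule lin_qc_eq_zspan[OF D.qgraph_axioms])
    show "tagged P (supp_qc P M Q) D.e\<^sub>0 D.K D.J D.Fl (init M) D.anc" using D.tagged unfolding D.S_def .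
    show "config.valid (supp_qc P M Q) D.e\<^sub>0 D.K D.J D.Fl (init M) D.anc (ends M)"
      using valid_M unfolding D.S_def .
    show "fst (ends M d) \<in> Q \<and> snd (ends M d) \<in> Q" if "d \<in> T.Ed" for d
      using D.init_Q[OF Ed_edge[OF that]] D.term_Q[OF Ed_edge[OF that]] by simp
    show "\<exists>k\<in>insert D.e\<^sub>0 D.K. same_family (supp_qc P M Q) (init M k) p" if "p \<in> Q" for p
      using D.cover[OF that] unfolding D.S_def .
  qed (simp only: conn_M)
  \<comment> \<open>Here equality of the two \<open>lin_qc\<close> becomes equality of the groups
    generated by the two tuples.\<close>
  ultimately have span: "zspan (gen s ` T.I) = W" using lin by simp
  obtain f where f: "f \<in> D.Fl" using D.Fl_nonempty[OF pieces] by blast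
  have "\<exists>s'. (st P T.Ed)\<^sup>*\<^sup>* s s' \<and> (\<forall>d\<in>T.Ed. s' d = ends M d)"
  proof (rule T.reach[OF vs valid_M f span])
    show "snd (snd (ends M k)) - snd (snd (s k)) \<in> W" if k: "k \<in> D.K" for k
    proof -
      have kE: "k \<in> T.Ed" "k \<in> D.Nf" "k \<noteq> D.e\<^sub>0" using k D.K_Nf D.e0_K by auto
      \<comment> \<open>In \<open>M\<close> the far end of the source edge is conjugate to the
        common starting point of both edges, so its position agrees modulo \<open>W\<close> with
        that of the far end of the target edge.\<close>
      have "D.cj (init L (\<theta> k) \<^bold>+ c k) (term_of L (\<theta> k) \<^bold>+ c k)"
        by (rule D.cj_shift[OF cj_M_edge[OF \<theta>E[OF kE(1)]]]) (use c(1)[of k] in auto)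
      then have cj: "D.cj (init M k) (snd (s k))" using s_eq[OF kE(1)] c(2)[OF kE(2)] by simp
      obtain w where w: "w \<in> Apos D.S" "s k = (init M k, init M D.e\<^sub>0 \<^bold>+ w)" using T.valid_K[OF vs k] .
      obtain t where t: "t \<in> Apos D.S" "ends M k = (init M k, init M D.e\<^sub>0 \<^bold>+ t)" using T.valid_K[OF valid_M k] .
      have Pk: "Pt (init M k) t" using T.PotI[of k 0 "ends M"] k kE(3) t(2) by simp
      have Pw: "Pt (snd (s k)) w" using T.PotI[of D.e\<^sub>0 w "ends M", OF _ Apos_asub[OF w(1)]] w(2) by simp
      have "init M k \<in> Q" using D.init_Q D.NfD[OF kE(2)] by blast
      from Pot_cj[OF this cj Pk] obtain b where "Pt (snd (s k)) b" "b - t \<in> W" by blast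
      then have "w - t \<in> W" using T.Pot_unique[OF Pw] by blast
      then have "- (w - t) \<in> W" by (rule zmod.span_neg)
      then show ?thesis using w(2) t(2) by simp
    qed
    show "snd (fst (ends M h)) - snd (fst (s h)) \<in> W" if h: "h \<in> D.Fl" for h
    proof -
      have "h \<in> T.Ed" unfolding D.Ed_eq using h by blast
      then show ?thesis using c(3)[OF h] s_eq by simp
    qed
  qed
  then obtain s' where s': "(st P T.Ed)\<^sup>*\<^sup>* s s'" "\<And>d. d \<in> T.Ed \<Longrightarrow> s' d = ends M d" by blast
  obtain N \<eta> where N: "(move P)\<^sup>*\<^sup>* L N" "rep (Verts L) T.Ed N \<eta> s'"
    using rep_sts[OF rep0 rtranclp_trans[OF s0s s'(1)]] by blast
  have "rep (Verts L) T.Ed N \<eta> (ends M)" by (rule rep_cong[OF N(2)]) (simp add: s'(2))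
  moreover have "Verts L = Verts M" using G.VL D.VL by simp
  ultimately have "same_graph N M" using rep_same_graph[OF _ D.rep_ends] by simp
  then show ?thesis using N(1) by blast
qed

end

lemma Q_unique:
  assumes "qgraph P L V Q F\<^sub>0 mF" "qgraph P M V Q' F\<^sub>0 mF" "min_qc P Q = min_qc P Q'"
    "supp_qc P L Q = supp_qc P M Q'"
  shows "Q = Q'"
proof -
  have "Q = {m \<^bold>+ w | m w. m \<in> min_qc P Q \<and> w \<in> Apos (supp_qc P L Q)}"
    using qgraph.Q_eq[OF assms(1)] unfolding qgraph.S_def[OF assms(1)] .
  moreover have "Q' = {m \<^bold>+ w | m w. m \<in> min_qc P Q' \<and> w \<in> Apos (supp_qc P M Q')}"
    using qgraph.Q_eq[OF assms(2)] unfolding qgraph.S_def[OF assms(2)] .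
  ultimately show ?thesis unfolding assms(3,4) by simp
qed

theorem proposition5p15:
  fixes \<Gamma> :: "('v, 'e) sgraph" and \<psi> :: "'e \<Rightarrow> int"
    and \<Delta> :: "('v, 'f) sgraph" and \<phi> :: "'f \<Rightarrow> int"
    and P :: "nat set" and Q\<^sub>\<Gamma> Q\<^sub>\<Delta> F\<^sub>0 :: "'v point set"
    and mF :: "'v point set \<Rightarrow> 'v point"
  assumes "totally_reduced \<Gamma> \<psi>" and "totally_reduced \<Delta> \<phi>"
    and "Verts \<Gamma> = Verts \<Delta>"
    and "gbs_primes \<Gamma> \<psi> = P" and "gbs_primes \<Delta> \<phi> = P"
    and "one_qc_class P (affine_rep \<Gamma> \<psi>) Q\<^sub>\<Gamma>" and "one_qc_class P (affine_rep \<Delta> \<phi>) Q\<^sub>\<Delta>"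
    and "supp_qc P (affine_rep \<Gamma> \<psi>) Q\<^sub>\<Gamma> \<noteq> {}" and "supp_qc P (affine_rep \<Delta> \<phi>) Q\<^sub>\<Delta> \<noteq> {}"
    and "clean P (affine_rep \<Gamma> \<psi>) Q\<^sub>\<Gamma>" and "clean P (affine_rep \<Delta> \<phi>) Q\<^sub>\<Delta>"
    and "floating_pieces P (affine_rep \<Gamma> \<psi>) Q\<^sub>\<Gamma>" and "floating_pieces P (affine_rep \<Delta> \<phi>) Q\<^sub>\<Delta>"
    and "min_qc P Q\<^sub>\<Gamma> = min_qc P Q\<^sub>\<Delta>"
    and "supp_qc P (affine_rep \<Gamma> \<psi>) Q\<^sub>\<Gamma> = supp_qc P (affine_rep \<Delta> \<phi>) Q\<^sub>\<Delta>"
    and "lin_qc P (affine_rep \<Gamma> \<psi>) Q\<^sub>\<Gamma> = lin_qc P (affine_rep \<Delta> \<phi>) Q\<^sub>\<Delta>"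
    and "same_class_counts P (affine_rep \<Gamma> \<psi>) (affine_rep \<Delta> \<phi>)"
    and "normal_form P (affine_rep \<Gamma> \<psi>) Q\<^sub>\<Gamma> F\<^sub>0 mF"
    and "normal_form P (affine_rep \<Delta> \<phi>) Q\<^sub>\<Delta> F\<^sub>0 mF"
  shows "\<exists>L. (move P)\<^sup>*\<^sup>* (affine_rep \<Gamma> \<psi>) L \<and> same_graph L (affine_rep \<Delta> \<phi>)"
proof -
  let ?L = "affine_rep \<Gamma> \<psi>" and ?M = "affine_rep \<Delta> \<phi>"
  have "agraph P ?L (Verts \<Delta>)" "agraph P ?M (Verts \<Delta>)"
    using agraph_affine_rep[of \<Gamma> \<psi>] agraph_affine_rep[of \<Delta> \<phi>] assms(1-5)
    by (simp_all add: totally_reduced_def)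
  then have L: "qgraph P ?L (Verts \<Delta>) Q\<^sub>\<Gamma> F\<^sub>0 mF" and M: "qgraph P ?M (Verts \<Delta>) Q\<^sub>\<Delta> F\<^sub>0 mF"
    using assms(6-11,18,19) by (simp_all add: qgraph_def qgraph_axioms_def)
  have Q: "Q\<^sub>\<Gamma> = Q\<^sub>\<Delta>" by (rule Q_unique[OF L M assms(14,15)])
  have "gbs_pair P ?M ?L (Verts \<Delta>) Q\<^sub>\<Delta> F\<^sub>0 mF"
    using L M assms(13,15-17) unfolding Q by (simp add: gbs_pair_def gbs_pair_axioms_def)
  then show ?thesis by (rule gbs_pair.moves_to)
qed

end
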